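(* Let $\varphi:[0,2\pi]\to\mathbb{R}$ be a strictly increasing, concave, continuous function with $\varphi(0)=0$ and $\varphi(2\pi)=1$. The set of extreme points of the closed unit ball of the Hardy-Lorentz space $H(\Lambda(\varphi))$ coincides with the set of outer functions $F\in H(\Lambda(\varphi))$ with $\|F\|_{H(\Lambda(\varphi))}=1$ if and only if $\varphi(t)=t/(2\pi)$ for all $t\in[0,2\pi]$ (i.e. $H(\Lambda(\varphi))=H^1$).
   Context: Let $m$ be Lebesgue measure on $[0,2\pi]$. For a measurable $x:[0,2\pi]\to\mathbb{C}$, the decreasing rearrangement of $|x|$ is $x^*(t):=\inf\{\tau\ge 0: m\{s\in[0,2\pi]:|x(s)|>\tau\}\le t\}$, $0<t\le 2\pi$. The Lorentz space $\Lambda(\varphi)=\Lambda(\varphi)[0,2\pi]$ consists of all measurable $x:[0,2\pi]\to\mathbb{C}$ with $\|x\|_{\Lambda(\varphi)}:=\int_0^{2\pi}x^*(t)\,d\varphi(t)<\infty$. Let $\mathbb{D}=\{z\in\mathbb{C}:|z|<1\}$. The Hardy-Lorentz space $H(\Lambda(\varphi))$ consists of all analytic functions $f:\mathbb{D}\to\mathbb{C}$ with $\|f\|_{H(\Lambda(\varphi))}:=\sup_{0\le r<1}\|f_r\|_{\Lambda(\varphi)}<\infty$, where $f_r(t):=f(re^{it})$, $t\in[0,2\pi]$. One has $H(\Lambda(\varphi))\subseteq H^1$, where $H^1=H^1(\mathbb{D})$ is the classical Hardy space, with norm normalized as $\sup_{0\le r<1}\frac1{2\pi}\int_0^{2\pi}|f(re^{it})|\,dt$.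 Every $f\in H(\Lambda(\varphi))$ has nontangential boundary limits $\tilde f(t):=f(e^{it})$ for almost all $t\in[0,2\pi]$. A non-null function $F\in H^1$ is outer if $\ln|F(0)|=\frac{1}{2\pi}\int_0^{2\pi}\ln|\tilde F(s)|\,ds$. A point $x_0$ of the closed unit ball $\{x:\|x\|\le 1\}$ of a Banach space is extreme if it is not the midpoint of any nondegenerate segment contained in the ball. *)

theory Defs
  imports
    "HOL-Complex_Analysis.Complex_Analysis"
    "HOL-Library.Function_Algebras"
begin

text \<open>
  Complex functions with the pointwise operations form a real vector space, so that
  \<^const>\<open>extreme_point_of\<close> applies to sets of functions.
\<close>

instantiation "fun" :: (type, real_vector) real_vector
begin

definition scaleR_fun :: "real \<Rightarrow> ('a \<Rightarrow> 'b) \<Rightarrow> 'a \<Rightarrow> 'b"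
  where "scaleR_fun c f = (\<lambda>x. c *\<^sub>R f x)"

instance
  by standard (simp_all add: scaleR_fun_def plus_fun_def scaleR_add_right scaleR_add_left)

end

text \<open>
  On a convex set, such as the unit ball of a normed space, \<^const>\<open>extreme_point_of\<close>
  says that the point is not the midpoint of a nondegenerate segment contained in the set.
\<close>

lemma extreme_point_of_iff_midpoint:
  fixes S :: "'a :: real_vector set"
  assumes "convex S"
  shows "x extreme_point_of S \<longleftrightarrow>
    x \<in> S \<and> \<not> (\<exists>a b. a \<noteq> b \<and> closed_segment a b \<subseteq> S \<and> x = midpoint a b)"
proof (intro iffI conjI)
  assume ext: "x extreme_point_of S"
  then show "x \<in> S"
    by (simp add: extreme_point_of_def)
  show "\<not> (\<exists>a b. a \<noteq> b \<and> closed_segment a b \<subseteq> S \<and> x = midpoint a b)"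
  proof
    assume "\<exists>a b. a \<noteq> b \<and> closed_segment a b \<subseteq> S \<and> x = midpoint a b"
    then obtain a b where ab: "a \<noteq> b" "closed_segment a b \<subseteq> S" "x = midpoint a b"
      by blast
    have "x = (1 - 1/2) *\<^sub>R a + (1/2) *\<^sub>R b"
      using ab(3) by (simp add: midpoint_def scaleR_add_right inverse_eq_divide)
    then have "x \<in> open_segment a b"
      using ab(1) unfolding in_segment by (intro conjI exI[of _ "1/2"]) simp_all
    moreover have "a \<in> S" "b \<in> S"
      using ab(2) by auto
    ultimately show False
      using ext by (simp add: extreme_point_of_def)
  qed
next
  assume R: "x \<in> S \<and> \<not> (\<exists>a b. a \<noteq> b \<and> closed_segment a b \<subseteq> S \<and> x = midpoint a b)"
  show "x extreme_point_of S"
    unfolding extreme_point_of_def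
  proof (intro conjI ballI notI)
    show "x \<in> S"
      using R by simp
    fix a b
    assume ab: "a \<in> S" "b \<in> S" "x \<in> open_segment a b"
    then obtain u where u: "a \<noteq> b" "0 < u" "u < 1" "x = (1 - u) *\<^sub>R a + u *\<^sub>R b"
      unfolding in_segment by blast
    define d where "d = min u (1 - u)"
    have d: "0 < d" "d \<le> u" "d \<le> 1 - u"
      using u by (auto simp: d_def)
    define p where "p = (1 - (u - d)) *\<^sub>R a + (u - d) *\<^sub>R b"
    define q where "q = (1 - (u + d)) *\<^sub>R a + (u + d) *\<^sub>R b"
    have "p \<in> S" "q \<in> S"
      unfolding p_def q_def using d by (intro convexD_alt[OF assms ab(1,2)]; linarith)+
    then have "closed_segment p q \<subseteq> S"
      using assms by (simp add: closed_segment_subset)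
    moreover have "q - p = 2 *\<^sub>R (d *\<^sub>R (b - a))"
      unfolding p_def q_def scaleR_2 by (simp add: scaleR_diff_left scaleR_add_left scaleR_diff_right)
    then have "p \<noteq> q"
      using u(1) d(1) by auto
    moreover have "p + q = 2 *\<^sub>R x"
      unfolding p_def q_def u(4) scaleR_2
      by (simp add: scaleR_diff_left scaleR_add_left scaleR_diff_right)
    then have "x = midpoint p q"
      by (simp add: midpoint_def)
    ultimately show False
      using R by blast
  qed
qed

definition decreasing_rearrangement :: "(real \<Rightarrow> complex) \<Rightarrow> real \<Rightarrow> real"
  where "decreasing_rearrangement x t =
    Inf {\<tau>. 0 \<le> \<tau> \<and>
      measure (lebesgue_on {0..2*pi}) {s \<in> {0..2*pi}. cmod (x s) > \<tau>} \<le> t}"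

text \<open>
  The Lebesgue--Stieltjes measure \<open>d\<phi>\<close>: a weight on \<open>[0, 2\<pi>]\<close> is extended
  to the real line by constants, so that the measure lives on that interval.
\<close>

definition stieltjes :: "(real \<Rightarrow> real) \<Rightarrow> real measure"
  where "stieltjes \<phi> = interval_measure (\<lambda>t. \<phi> (max 0 (min (2*pi) t)))"

text \<open>
  The norms are extended nonnegative reals; membership in the corresponding spaces is
  finiteness of the norm.  The rearrangement may be unbounded near \<open>0\<close>, but \<open>d\<phi>\<close>
  has no atom there for continuous \<open>\<phi>\<close>.
\<close>

definition lorentz_norm :: "(real \<Rightarrow> real) \<Rightarrow> (real \<Rightarrow> complex) \<Rightarrow> ennreal"
  where "lorentz_norm \<phi> x =
    (\<integral>\<^sup>+t\<in>{0<..2*pi}. ennreal (decreasing_rearrangement x t) \<partial>stieltjes \<phi>)"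

text \<open>
  Functions on the open unit disc are represented by their extension by \<open>0\<close>, so that
  equality of representatives is equality on the disc.
\<close>

definition disc_analytic :: "(complex \<Rightarrow> complex) set"
  where "disc_analytic = {f. f holomorphic_on ball 0 1 \<and> (\<forall>z. z \<notin> ball 0 1 \<longrightarrow> f z = 0)}"

definition circle_slice :: "(complex \<Rightarrow> complex) \<Rightarrow> real \<Rightarrow> real \<Rightarrow> complex"
  where "circle_slice f r t = f (of_real r * cis t)"

definition hardy_lorentz_norm :: "(real \<Rightarrow> real) \<Rightarrow> (complex \<Rightarrow> complex) \<Rightarrow> ennreal"
  where "hardy_lorentz_norm \<phi> f = (SUP r\<in>{0..<1}. lorentz_norm \<phi> (circle_slice f r))"

definition hardy_lorentz :: "(real \<Rightarrow> real) \<Rightarrow> (complex \<Rightarrow> complex) set"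
  where "hardy_lorentz \<phi> = {f \<in> disc_analytic. hardy_lorentz_norm \<phi> f < \<infinity>}"

definition hardy_lorentz_ball :: "(real \<Rightarrow> real) \<Rightarrow> (complex \<Rightarrow> complex) set"
  where "hardy_lorentz_ball \<phi> = {f \<in> hardy_lorentz \<phi>. hardy_lorentz_norm \<phi> f \<le> 1}"

definition hardy1_norm :: "(complex \<Rightarrow> complex) \<Rightarrow> ennreal"
  where "hardy1_norm f =
    (SUP r\<in>{0..<1}. ennreal (1 / (2*pi)) *
      (\<integral>\<^sup>+t. ennreal (cmod (circle_slice f r t)) \<partial>lebesgue_on {0..2*pi}))"

definition hardy1 :: "(complex \<Rightarrow> complex) set"
  where "hardy1 = {f \<in> disc_analytic. hardy1_norm f < \<infinity>}"

definition stolz_region :: "real \<Rightarrow> real \<Rightarrow> complex set"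
  where "stolz_region \<alpha> t = {z. cmod z < 1 \<and> cmod (z - cis t) < \<alpha> * (1 - cmod z)}"

definition has_nontangential_limit :: "(complex \<Rightarrow> complex) \<Rightarrow> real \<Rightarrow> complex \<Rightarrow> bool"
  where "has_nontangential_limit f t l \<longleftrightarrow>
    (\<forall>\<alpha>>1. (f \<longlongrightarrow> l) (at (cis t) within stolz_region \<alpha> t))"

text \<open>
  The limit is unique when it exists; where it does not exist the value is arbitrary.
\<close>

definition boundary_function :: "(complex \<Rightarrow> complex) \<Rightarrow> real \<Rightarrow> complex"
  where "boundary_function f t = (THE l. has_nontangential_limit f t l)"

text \<open>
  Since \<^term>\<open>ln (0::real) = 0\<close> in HOL while \<open>ln 0 = -\<infinity>\<close> here, the condition
  \<open>F 0 \<noteq> 0\<close> has to be stated; it implies that \<open>F\<close> is non-null.  Integrability makes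
  explicit that the integral is a genuine finite value (it holds for all non-null
  \<open>F\<close> in \<^const>\<open>hardy1\<close>).
\<close>

definition outer_function :: "(complex \<Rightarrow> complex) \<Rightarrow> bool"
  where "outer_function F \<longleftrightarrow>
    F \<in> hardy1 \<and> F 0 \<noteq> 0 \<and>
    integrable (lebesgue_on {0..2*pi}) (\<lambda>s. ln (cmod (boundary_function F s))) \<and>
    ln (cmod (F 0)) =
      1 / (2*pi) * integral\<^sup>L (lebesgue_on {0..2*pi}) (\<lambda>s. ln (cmod (boundary_function F s)))"

end

theory Submission
  imports Defs
begin

text \<open>
  If \<open>\<phi>\<close> is not linear, concavity gives \<open>\<phi> t \<ge> t / 2\<pi> + k min t (2\<pi> - t)\<close> with \<open>k > 0\<close>, and the layer-cake
  formula turns this into a quantitative gap: a function of Lorentz norm at most \<open>1\<close> whose mean modulus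
  is close to \<open>1\<close> has modulus close to \<open>1\<close> in mean.  Applied on circles of radius \<open>r \<rightarrow> 1\<close> to both ends of a
  segment through \<open>z\<close>, the parallelogram identity collapses the segment, so \<open>z\<close> is extreme; but \<open>z\<close> is
  not outer.

  If \<open>\<phi>\<close> is linear, the claim is the theorem of de Leeuw and Rudin for \<open>H\<^sup>1\<close>.  Instead of Poisson
  integrals, a majorant \<open>G\<close> of \<open>F\<close> with \<open>log \<bar>G 0\<bar>\<close> equal to the mean of \<open>log \<bar>F\<bar>\<close> on the circle is
  obtained as a normal-family limit of exponentials of polynomials; \<open>F\<close> is outer exactly when \<open>F / G\<close> is
  a unimodular constant.  Boundary values come from the a.e. differentiability of the Lipschitz
  boundary function of a primitive, combined with a Phragmen--Lindelof argument.
\<close>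

section \<open>Harmonic approximation on the circle\<close>

text \<open>The tent \<open>min t (2*pi - t)\<close> is the shape of the gap because, evaluated at
  the distribution function of a modulus, it is the layer-cake integrand of the distance to a
  median; the excess of the Lorentz norm over the mean modulus therefore pays for deviation from a
  constant. This case is settled on interior circles alone. In the Hardy space case the obstacle is
  to carry a bound \<open>|H| \<le> |F|\<close> from the circle into the disc, which fails when
  \<open>F\<close> has an inner factor. The majorant is therefore built for two functions at once:
  if \<open>F\<close> is outer and dominates \<open>H\<close> almost everywhere on the circle, the
  log mean of the maximum is still \<open>ln |F 0|\<close>, the common majorant is a unimodular
  multiple of \<open>F\<close>, and so \<open>F\<close> dominates \<open>H\<close> in the disc. Two
  devices recur. Logarithms are cut off below at some \<open>d > 0\<close>, which makes them
  continuous and stable under limits, and \<open>F 0 \<noteq> 0\<close> bounds their means from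
  below uniformly in \<open>d\<close>. Monotonicity of circle means
  (\<open>circle_mean_cmod_mono\<close>) extends an estimate known only along a sequence of radii to
  every radius.\<close>

lemma poly_mult_cnj_poly_on_sphere:
  "\<exists>a b. \<forall>z\<in>sphere 0 1. poly p z * cnj (poly q z) = poly a z + cnj (poly b z)"
proof (induction p)
  case 0
  show ?case by (intro exI[of _ 0]) simp
next
  case (pCons c p)
  then obtain a b where ab: "\<forall>z\<in>sphere 0 1. poly p z * cnj (poly q z) = poly a z + cnj (poly b z)"
    by blast
  obtain b0 b' where b: "b = pCons b0 b'"
    by (cases b)
  \<comment> \<open>On the circle \<open>z * cnj z = 1\<close>, so a factor \<open>z\<close> strips
    one factor \<open>cnj z\<close> from \<open>cnj (poly b z)\<close>; only the constant
    coefficient \<open>b0\<close> crosses over to the analytic part, as the term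
    \<open>cnj b0 * z\<close>.\<close>
  have "poly (pCons c p) z * cnj (poly q z) =
      poly (pCons 0 a + [:0, cnj b0:]) z + cnj (poly (smult (cnj c) q + b') z)"
    if "z \<in> sphere 0 1" for z
  proof -
    have zz: "z * cnj z = 1"
      using that by (simp add: complex_norm_square[symmetric])
    have "poly (pCons c p) z * cnj (poly q z) = c * cnj (poly q z) + z * (poly p z * cnj (poly q z))"
      by (simp add: algebra_simps)
    also have "\<dots> = c * cnj (poly q z) + z * poly a z + z * cnj b0 + (z * cnj z) * cnj (poly b' z)"
      using ab that by (simp add: b algebra_simps)
    finally show ?thesis
      by (simp add: zz algebra_simps)
  qed
  then show ?case by blast
qed

text \<open>Real parts of polynomials replace Poisson extensions: \<open>exp p\<close> is zero-free
  with modulus \<open>exp (Re p)\<close>, and the mean of \<open>Re p\<close> over the circle is its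
  value at \<open>0\<close>. On the circle these functions form an algebra, by
  \<open>2 Re a Re b = Re (a b) + Re (a cnj b)\<close> and the preceding lemma, so Stone-Weierstrass
  applies.\<close>

lemma real_part_poly_approximation:
  fixes u :: "complex \<Rightarrow> real"
  assumes "continuous_on (sphere 0 1) u" "e > 0"
  obtains p where "\<And>z. z \<in> sphere 0 1 \<Longrightarrow> \<bar>u z - Re (poly p z)\<bar> < e"
proof -
  define R where "R = {g. \<exists>p. \<forall>z\<in>sphere (0::complex) 1. g z = Re (poly p z)}"
  interpret function_ring_on R "sphere (0::complex) 1"
  proof
    show "compact (sphere (0::complex) 1)" by simp
    fix f g :: "complex \<Rightarrow> real"
    assume fR: "f \<in> R"
    then obtain p where p: "\<And>z. z\<in>sphere 0 1 \<Longrightarrow> f z = Re (poly p z)" by (auto simp: R_def)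
    have "continuous_on (sphere 0 1) (\<lambda>z. Re (poly p z))"
      by (intro continuous_intros)
    then show "continuous_on (sphere 0 1) f"
      using p by (subst continuous_on_cong[OF refl, of _ _ "\<lambda>z. Re (poly p z)"]) auto
    assume "g \<in> R"
    then obtain q where q: "\<And>z. z\<in>sphere 0 1 \<Longrightarrow> g z = Re (poly q z)" by (auto simp: R_def)
    show "(\<lambda>x. f x + g x) \<in> R"
      unfolding R_def using p q by (auto intro!: exI[of _ "p+q"])
    obtain a b where ab: "\<forall>z\<in>sphere 0 1. poly p z * cnj (poly q z) = poly a z + cnj (poly b z)"
      using poly_mult_cnj_poly_on_sphere by blast
    have "f z * g z = Re (poly (smult (1/2) (p * q + a + b)) z)" if z: "z \<in> sphere 0 1" for z
    proof -
      have "2 * (Re (poly p z) * Re (poly q z)) = Re (poly p z * poly q z) + Re (poly p z * cnj (poly q z))"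
        by simp
      also have "Re (poly p z * cnj (poly q z)) = Re (poly a z) + Re (poly b z)"
        using bspec[OF ab z] by simp
      finally show ?thesis using p q z by simp
    qed
    then show "(\<lambda>x. f x * g x) \<in> R" unfolding R_def by blast
  next
    show "(\<lambda>_. c) \<in> R" for c
      by (auto simp: R_def intro!: exI[of _ "[:of_real c:]"])
    fix x y :: complex assume "x \<noteq> y"
    then have "Re x \<noteq> Re y \<or> Im x \<noteq> Im y" by (simp add: complex_eq_iff)
    moreover have "Re \<in> R" by (auto simp: R_def intro!: exI[of _ "[:0,1:]"])
    moreover have "Im \<in> R" by (auto simp: R_def intro!: exI[of _ "[:0,-\<i>:]"])
    ultimately show "\<exists>f\<in>R. f x \<noteq> f y" by blast
  qed
  from Stone_Weierstrass_basic[OF assms] show ?thesis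
    using that unfolding R_def by fastforce
qed

section \<open>Cauchy's formula and means over circles\<close>

lemma Cauchy_formula_circle_integral:
  fixes f :: "complex \<Rightarrow> complex" and R r :: real
  assumes f: "f holomorphic_on ball 0 R" and r: "cmod z < r" "r < R"
  shows "integral {0..2*pi} (\<lambda>t. f (of_real r * cis t) * (of_real r * cis t) / (of_real r * cis t - z)) = 2 * pi * f z"
proof -
  have "((\<lambda>w. f w / (w - z)) has_contour_integral (2 * of_real pi * \<i> * f z)) (circlepath 0 r)"
  proof (rule Cauchy_integral_circlepath_simple)
    show "f holomorphic_on cball 0 r"
      using f by (rule holomorphic_on_subset) (use r in auto)
    show "cmod (z - 0) < r" using r by simp
  qed
  then have "contour_integral (part_circlepath 0 r 0 (2*pi)) (\<lambda>w. f w / (w - z)) = 2 * of_real pi * \<i> * f z"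
    unfolding circlepath_def by (rule contour_integral_unique)
  then have "integral {0..2*pi} (\<lambda>t. f (0 + of_real r * cis t) / (0 + of_real r * cis t - z) * of_real r * \<i> * cis t) = 2 * of_real pi * \<i> * f z"
    by (subst (asm) contour_integral_part_circlepath_eq) auto
  also have "(\<lambda>t. f (0 + of_real r * cis t) / (0 + of_real r * cis t - z) * of_real r * \<i> * cis t) =
     (\<lambda>t. \<i> * (f (of_real r * cis t) * (of_real r * cis t) / (of_real r * cis t - z)))"
    by (auto simp: fun_eq_iff)
  finally have "\<i> * integral {0..2*pi} (\<lambda>t. f (of_real r * cis t) * (of_real r * cis t) / (of_real r * cis t - z)) = \<i> * (2 * of_real pi * f z)"
    unfolding integral_mult_right by (simp add: mult_ac)
  then show ?thesis by simp
qed

lemma circle_mean_value: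
  fixes f :: "complex \<Rightarrow> complex" and R r :: real
  assumes "f holomorphic_on ball 0 R" "0 < r" "r < R"
  shows "integral {0..2*pi} (\<lambda>t. f (of_real r * cis t)) = 2 * pi * f 0"
  using Cauchy_formula_circle_integral[of f R 0 r] assms by simp

text \<open>Real-valued, so that means can be subtracted; for a function that is not integrable the
  value is the default \<open>0\<close>. \<open>nn_integral_circle_eq_cmean\<close> leads back to
  the extended norms.\<close>

definition cmean :: "(real \<Rightarrow> real) \<Rightarrow> real"
  where "cmean g = (LINT t|lebesgue_on {0..2*pi}. g t) / (2*pi)"

abbreviation circle_mean :: "(complex \<Rightarrow> complex) \<Rightarrow> real \<Rightarrow> real"
  where "circle_mean f r \<equiv> cmean (\<lambda>t. cmod (f (of_real r * cis t)))"

lemma integrable_on_circle: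
  fixes g :: "real \<Rightarrow> 'a::{banach,second_countable_topology,euclidean_space}"
  assumes "continuous_on {0..2*pi} g"
  shows "integrable (lebesgue_on {0..2*pi}) g"
  using continuous_imp_integrable[of 0 "2*pi" g] assms by simp

lemma cmean_eq_integral:
  assumes "continuous_on {0..2*pi} g"
  shows "cmean g = integral {0..2*pi} g / (2*pi)"
  using lebesgue_integral_eq_integral[OF integrable_on_circle[OF assms]] by (simp add: cmean_def)

lemma Re_circle_mean_value:
  fixes f :: "complex \<Rightarrow> complex" and R r :: real
  assumes f: "f holomorphic_on ball 0 R" and r: "0 < r" "r < R"
  shows "cmean (\<lambda>t. Re (f (of_real r * cis t))) = Re (f 0)"
proof -
  have *: "continuous_on {0..2*pi} (\<lambda>t. f (of_real r * cis t))"
    by (intro continuous_on_compose2[OF holomorphic_on_imp_continuous_on[OF f]] continuous_intros)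
       (use r in \<open>auto simp: norm_mult\<close>)
  have "integral {0..2*pi} (\<lambda>t. Re (f (of_real r * cis t))) = Re (integral {0..2*pi} (\<lambda>t. f (of_real r * cis t)))"
    using integral_linear[OF integrable_continuous_real[OF *] bounded_linear_Re] by (simp add: o_def)
  then show ?thesis
    using circle_mean_value[OF f r] cmean_eq_integral[of "\<lambda>t. Re (f (of_real r * cis t))"] *
    by (simp add: continuous_on_Re)
qed

lemma continuous_on_circle:
  fixes f :: "complex \<Rightarrow> complex" and R r :: real
  assumes "f holomorphic_on ball 0 R" "0 \<le> r" "r < R"
  shows "continuous_on S (\<lambda>t. f (of_real r * cis t))"
  by (intro continuous_on_compose2[OF holomorphic_on_imp_continuous_on[OF assms(1)]] continuous_intros)
     (use assms in \<open>auto simp: norm_mult\<close>)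

lemma cmean_mono:
  assumes "continuous_on {0..2*pi} f" "continuous_on {0..2*pi} g" "\<And>t. t \<in> {0..2*pi} \<Longrightarrow> f t \<le> g t"
  shows "cmean f \<le> cmean g"
  unfolding cmean_def
  by (intro divide_right_mono integral_mono integrable_on_circle) (use assms in auto)

lemma cmean_const [simp]: "cmean (\<lambda>t. c) = c"
  by (simp add: cmean_eq_integral)

lemma cmean_mult_left: "cmean (\<lambda>t. c * f t) = c * cmean f"
  unfolding cmean_def by simp

lemma cmean_add:
  assumes "continuous_on {0..2*pi} f" "continuous_on {0..2*pi} g"
  shows "cmean (\<lambda>t. f t + g t) = cmean f + cmean g"
  unfolding cmean_def
  using assms by (simp add: integrable_on_circle add_divide_distrib)

lemma integral_rotate:
  fixes h :: "real \<Rightarrow> real"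
  assumes h: "continuous_on UNIV h" and per: "\<And>t. h (t + 2*pi) = h t" and a: "0 \<le> a" "a \<le> 2*pi"
  shows "integral {0..2*pi} (\<lambda>t. h (t + a)) = integral {0..2*pi} h"
proof -
  have io: "h integrable_on {c..d}" for c d
    by (intro integrable_continuous_real continuous_on_subset[OF h]) auto
  have "integral {0..2*pi} (\<lambda>t. h (t + a)) = integral {a..2*pi+a} h"
    using integral_shift_real_ivl[of a a "2*pi+a" h] by simp
  also have "\<dots> = integral {a..2*pi} h + integral {2*pi..2*pi+a} h"
    by (rule Henstock_Kurzweil_Integration.integral_combine[symmetric]) (use a io in auto)
  also have "integral {2*pi..2*pi+a} h = integral {0..a} (\<lambda>t. h (t + 2*pi))"
    using integral_shift_real_ivl[of "2*pi" "2*pi" "2*pi+a" h] by simp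
  also have "\<dots> = integral {0..a} h"
    by (simp add: per)
  also have "integral {a..2*pi} h + integral {0..a} h = integral {0..a} h + integral {a..2*pi} h"
    by simp
  also have "\<dots> = integral {0..2*pi} h"
    by (rule Henstock_Kurzweil_Integration.integral_combine) (use a io in auto)
  finally show ?thesis .
qed

text \<open>Duality in place of subharmonicity. A weight \<open>g\<close> of modulus at most
  \<open>1\<close> is chosen whose pairing with \<open>f\<close> on the circle of radius
  \<open>\<rho>\<close> almost returns the integral of \<open>|f|\<close>. The pairing
  \<open>\<phi> z\<close> of \<open>g\<close> with the slice \<open>f (z * cis t)\<close> is
  holomorphic in \<open>z\<close> and bounded on \<open>|z| = r\<close> by the integral over that
  circle; the maximum modulus principle compares the two.\<close>

lemma circle_mean_cmod_mono:
  fixes f :: "complex \<Rightarrow> complex" and R r \<rho> :: real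
  assumes f: "f holomorphic_on ball 0 R" and r: "0 \<le> \<rho>" "\<rho> \<le> r" "r < R"
  shows "circle_mean f \<rho> \<le> circle_mean f r"
proof (rule field_le_epsilon)
  fix \<delta> :: real assume \<delta>: "\<delta> > 0"
  have R: "0 < R" using r by linarith
  note cf = continuous_on_circle[OF f]
  define A where "A s = integral {0..2*pi} (\<lambda>t. cmod (f (of_real s * cis t)))" for s :: real
  \<comment> \<open>\<open>\<delta>\<close> keeps \<open>g\<close> continuous at the zeros of
    \<open>f\<close>. It costs at most \<open>2*pi*\<delta>\<close> in the integral, because
    \<open>(m - \<delta>) * (m + \<delta>) \<le> m^2\<close>.\<close>
  define g where "g t = cnj (f (of_real \<rho> * cis t)) / of_real (cmod (f (of_real \<rho> * cis t)) + \<delta>)" for t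
  have den: "complex_of_real (cmod z + \<delta>) \<noteq> 0" for z
    using \<delta> by (metis add_nonneg_pos norm_ge_zero of_real_eq_0_iff order_less_irrefl)
  have cg: "continuous_on S g" for S
    unfolding g_def using r den by (intro continuous_intros cf) auto
  have g1: "cmod (g t) \<le> 1" for t
  proof -
    have p: "0 < cmod (f (of_real \<rho> * cis t)) + \<delta>"
      by (rule add_nonneg_pos[OF norm_ge_zero \<delta>])
    show ?thesis
      unfolding g_def norm_divide norm_of_real complex_mod_cnj abs_of_pos[OF p]
      using \<delta> p by (simp add: divide_le_eq)
  qed
  define \<phi> where "\<phi> z = integral (cbox 0 (2*pi)) (\<lambda>t. f (z * cis t) * g t)" for z
  have df: "deriv f holomorphic_on ball 0 R"
    using f by (rule holomorphic_deriv) auto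
  have holo: "\<phi> holomorphic_on ball 0 R"
    unfolding \<phi>_def
  proof (rule leibniz_rule_holomorphic[where fx = "\<lambda>z t. deriv f (z * cis t) * cis t * g t"])
    fix z t assume z: "z \<in> ball (0::complex) R"
    have "(f has_field_derivative deriv f (z * cis t)) (at (z * cis t))"
      by (rule holomorphic_derivI[OF f]) (use z in \<open>auto simp: norm_mult\<close>)
    then have "((\<lambda>x. f (x * cis t)) has_field_derivative deriv f (z * cis t) * (1 * cis t)) (at z within ball 0 R)"
      by (rule DERIV_chain2) (auto intro!: derivative_eq_intros)
    then show "((\<lambda>x. f (x * cis t) * g t) has_field_derivative deriv f (z * cis t) * cis t * g t) (at z within ball 0 R)"
      using DERIV_cmult_right by fastforce
  next
    fix z assume z: "z \<in> ball (0::complex) R"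
    have "continuous_on {0..2*pi} (\<lambda>t. f (z * cis t) * g t)"
      by (intro continuous_intros cg continuous_on_compose2[OF holomorphic_on_imp_continuous_on[OF f]])
         (use z in \<open>auto simp: norm_mult\<close>)
    then show "(\<lambda>t. f (z * cis t) * g t) integrable_on cbox 0 (2*pi)"
      by (simp add: integrable_continuous_real)
  next
    have "continuous_on (ball 0 R \<times> cbox 0 (2*pi)) (\<lambda>x. deriv f (fst x * cis (snd x)) * cis (snd x) * g (snd x))"
      by (intro continuous_intros continuous_on_compose2[OF holomorphic_on_imp_continuous_on[OF df]]
           continuous_on_compose2[OF cg[of UNIV]])
         (auto simp: norm_mult)
    then show "continuous_on (ball 0 R \<times> cbox 0 (2*pi)) (\<lambda>(z, t). deriv f (z * cis t) * cis t * g t)"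
      by (simp add: case_prod_unfold)
  qed auto
  have bnd: "cmod (\<phi> z) \<le> A r" if z: "cmod z = r" for z
  proof -
    \<comment> \<open>\<open>z = r * cis a\<close> turns the slice through \<open>z\<close> into a
      rotation of the slice of radius \<open>r\<close>, which has the same integral.\<close>
    define a where "a = Arg2pi z"
    have a: "0 \<le> a" "a \<le> 2*pi" "z = of_real r * cis a"
      using Arg2pi[of z] z by (auto simp: a_def is_Arg_def cis_conv_exp)
    have ci: "continuous_on {0..2*pi} (\<lambda>t. f (z * cis t))"
      by (intro continuous_intros continuous_on_compose2[OF holomorphic_on_imp_continuous_on[OF f]])
         (use z r in \<open>auto simp: norm_mult\<close>)
    have "cmod (\<phi> z) \<le> integral {0..2*pi} (\<lambda>t. cmod (f (z * cis t)))"
      unfolding \<phi>_def cbox_interval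
      by (rule integral_norm_bound_integral)
         (auto intro!: integrable_continuous_real continuous_intros ci cg simp: norm_mult g1 mult_left_le)
    also have "(\<lambda>t. cmod (f (z * cis t))) = (\<lambda>t. cmod (f (of_real r * cis (t + a))))"
      by (simp add: a(3) mult.assoc cis_mult add.commute)
    also have "integral {0..2*pi} \<dots> = A r"
      unfolding A_def
      by (rule integral_rotate[where h = "\<lambda>t. cmod (f (of_real r * cis t))"])
         (use a r in \<open>auto intro!: continuous_intros cf simp: complex_eq_iff cis_mult[symmetric]\<close>)
    finally show ?thesis .
  qed
  have "cmod (\<phi> (of_real \<rho>)) \<le> A r"
  proof (rule maximum_modulus_frontier[of \<phi> "cball 0 r"])
    show "\<phi> holomorphic_on interior (cball 0 r)"
      by (rule holomorphic_on_subset[OF holo]) (use r in auto)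
    show "continuous_on (closure (cball 0 r)) \<phi>"
      by (rule continuous_on_subset[OF holomorphic_on_imp_continuous_on[OF holo]]) (use r in auto)
    show "cmod (\<phi> z) \<le> A r" if "z \<in> frontier (cball 0 r)" for z
      by (rule bnd) (use that r in \<open>auto simp: frontier_cball\<close>)
  qed (use r in auto)
  moreover have "A \<rho> - 2*pi*\<delta> \<le> cmod (\<phi> (of_real \<rho>))"
  proof -
    let ?m = "\<lambda>t. cmod (f (of_real \<rho> * cis t))"
    have fg: "f (of_real \<rho> * cis t) * g t = of_real ((?m t)\<^sup>2 / (?m t + \<delta>))" for t
      unfolding g_def times_divide_eq_right complex_norm_square[symmetric] by (simp flip: of_real_power of_real_divide of_real_add)
    have mp: "?m t + \<delta> \<noteq> 0" for t
      using \<delta> by (smt (verit) norm_ge_zero)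
    have c1: "continuous_on {0..2*pi} ?m"
      using r by (intro continuous_intros cf) auto
    have c2: "continuous_on {0..2*pi} (\<lambda>t. (?m t)\<^sup>2 / (?m t + \<delta>))"
      by (intro continuous_intros c1) (use mp in auto)
    have "A \<rho> - 2*pi*\<delta> = integral {0..2*pi} (\<lambda>t. ?m t - \<delta>)"
      unfolding A_def using c1 by (simp add: Henstock_Kurzweil_Integration.integral_diff integrable_continuous_real)
    also have "\<dots> \<le> integral {0..2*pi} (\<lambda>t. (?m t)\<^sup>2 / (?m t + \<delta>))"
    proof (rule integral_le)
      fix t
      have "?m t + \<delta> > 0" using \<delta> by (smt (verit) norm_ge_zero)
      then show "?m t - \<delta> \<le> (?m t)\<^sup>2 / (?m t + \<delta>)"
        by (simp add: le_divide_eq algebra_simps power2_eq_square)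
    qed (auto intro!: integrable_continuous_real c2 continuous_intros c1)
    also have "\<dots> \<le> cmod (\<phi> (of_real \<rho>))"
    proof -
      have "\<phi> (of_real \<rho>) = integral {0..2*pi} (\<lambda>t. of_real ((?m t)\<^sup>2 / (?m t + \<delta>)))"
        unfolding \<phi>_def cbox_interval fg ..
      also have "\<dots> = of_real (integral {0..2*pi} (\<lambda>t. (?m t)\<^sup>2 / (?m t + \<delta>)))"
        using integral_linear[OF integrable_continuous_real[OF c2] bounded_linear_of_real[where 'a = complex]]
        unfolding o_def .
      finally show ?thesis by simp
    qed
    finally show ?thesis .
  qed
  ultimately have "A \<rho> / (2*pi) \<le> A r / (2*pi) + \<delta>"
    by (simp add: field_simps)
  then show "circle_mean f \<rho> \<le> circle_mean f r + \<delta>"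
    unfolding A_def using r by (subst (1 2) cmean_eq_integral) (auto intro!: continuous_intros cf)
qed

section \<open>Jensen's inequality and holomorphic majorants\<close>

lemma cmod_le_exp_on_cball:
  fixes f p :: "complex \<Rightarrow> complex" and R :: real
  assumes f: "f holomorphic_on ball 0 R" and p: "p holomorphic_on ball 0 R" and R: "1 < R"
    and le: "\<And>z. z \<in> sphere 0 1 \<Longrightarrow> cmod (f z) \<le> exp (Re (p z) + e)" and z: "z \<in> cball 0 1"
  shows "cmod (f z) \<le> exp (Re (p z) + e)"
proof -
  \<comment> \<open>\<open>exp (p z)\<close> has no zeros, so dividing by it turns the variable
    bound on the circle into the constant \<open>exp e\<close>.\<close>
  have h: "(\<lambda>z. f z * exp (- p z)) holomorphic_on ball 0 R"
    by (intro holomorphic_intros f p)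
  have "cmod (f z * exp (- p z)) \<le> exp e"
  proof (rule maximum_modulus_frontier[of "\<lambda>z. f z * exp (- p z)" "cball 0 1" "exp e" z])
    show "(\<lambda>z. f z * exp (- p z)) holomorphic_on interior (cball 0 1)"
      by (rule holomorphic_on_subset[OF h]) (use R in auto)
    show "continuous_on (closure (cball 0 1)) (\<lambda>z. f z * exp (- p z))"
      by (rule continuous_on_subset[OF holomorphic_on_imp_continuous_on[OF h]]) (use R in auto)
    fix z assume "z \<in> frontier (cball (0::complex) 1)"
    then have "cmod (f z) \<le> exp (Re (p z) + e)"
      by (intro le) (simp add: frontier_cball)
    then show "cmod (f z * exp (- p z)) \<le> exp e"
      by (simp add: norm_mult norm_divide exp_add exp_minus field_simps)
  qed (use z in auto)
  then show ?thesis
    by (simp add: norm_mult norm_divide exp_add exp_minus field_simps)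
qed

lemma continuous_on_compose_cis:
  assumes "continuous_on (sphere 0 1) u"
  shows "continuous_on S (\<lambda>t. u (cis t))"
  by (intro continuous_on_compose2[OF assms] continuous_intros) auto

text \<open>Jensen's inequality without counting zeros: \<open>u\<close> lies within
  \<open>e / 2\<close> of some \<open>Re p\<close>, the bound
  \<open>|f| \<le> exp (Re p + e / 2)\<close> is carried from the circle to the centre, and there
  \<open>Re p\<close> is its own mean.\<close>

lemma cmod_at_0_le_exp_circle_mean:
  fixes f :: "complex \<Rightarrow> complex" and u :: "complex \<Rightarrow> real" and R :: real
  assumes f: "f holomorphic_on ball 0 R" and R: "1 < R" and u: "continuous_on (sphere 0 1) u"
    and le: "\<And>z. z \<in> sphere 0 1 \<Longrightarrow> cmod (f z) \<le> exp (u z)"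
  shows "cmod (f 0) \<le> exp (cmean (\<lambda>t. u (cis t)))"
proof (cases "f 0 = 0")
  case False
  have "ln (cmod (f 0)) \<le> cmean (\<lambda>t. u (cis t)) + e" if e: "e > 0" for e
  proof -
    obtain p where p: "\<And>z. z \<in> sphere 0 1 \<Longrightarrow> \<bar>u z - Re (poly p z)\<bar> < e / 2"
      using real_part_poly_approximation[OF u, of "e/2"] e by auto
    have "cmod (f 0) \<le> exp (Re (poly p 0) + e / 2)"
    proof (rule cmod_le_exp_on_cball[OF f _ R])
      fix z assume z: "z \<in> sphere (0::complex) 1"
      have "exp (u z) \<le> exp (Re (poly p z) + e / 2)"
        using p[OF z] unfolding exp_le_cancel_iff abs_less_iff by linarith
      with le[OF z] show "cmod (f z) \<le> exp (Re (poly p z) + e / 2)" by linarith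
    qed (auto intro!: holomorphic_intros)
    then have "ln (cmod (f 0)) \<le> Re (poly p 0) + e / 2"
      using False by (metis exp_gt_zero ln_exp ln_le_cancel_iff zero_less_norm_iff)
    also have "Re (poly p 0) = cmean (\<lambda>t. Re (poly p (of_real 1 * cis t)))"
      by (rule Re_circle_mean_value[symmetric, where R = 2]) (auto intro!: holomorphic_intros)
    also have "\<dots> \<le> cmean (\<lambda>t. u (cis t) + e / 2)"
    proof (intro cmean_mono continuous_intros continuous_on_compose_cis[OF u])
      show "Re (poly p (of_real 1 * cis t)) \<le> u (cis t) + e / 2" for t
      proof -
        have "\<bar>u (cis t) - Re (poly p (cis t))\<bar> < e / 2" by (rule p) simp
        then show ?thesis unfolding of_real_1 mult_1 by linarith
      qed
    qed
    also have "\<dots> = cmean (\<lambda>t. u (cis t)) + e / 2"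
      by (simp add: cmean_add continuous_on_compose_cis[OF u])
    finally show ?thesis by simp
  qed
  then have "ln (cmod (f 0)) \<le> cmean (\<lambda>t. u (cis t))"
    by (rule field_le_epsilon)
  then show ?thesis
    using False by (metis exp_le_cancel_iff exp_ln zero_less_norm_iff)
qed simp

text \<open>The Cauchy kernel satisfies \<open>|w / (w - z)| \<le> r / (r - |z|)\<close> on
  \<open>|w| = r\<close>. This crude factor serves for local boundedness of normal families and for
  concluding that \<open>f\<close> vanishes once its means do.\<close>

lemma cmod_le_circle_mean:
  fixes f :: "complex \<Rightarrow> complex" and R r :: real
  assumes f: "f holomorphic_on ball 0 R" and r: "cmod z < r" "r < R"
  shows "cmod (f z) \<le> r / (r - cmod z) * circle_mean f r"
proof -
  have r0: "0 < r" using r by (smt (verit) norm_ge_zero)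
  let ?k = "\<lambda>t. f (of_real r * cis t) * (of_real r * cis t) / (of_real r * cis t - z)"
  have far: "r - cmod z \<le> cmod (of_real r * cis t - z)" for t
    using norm_triangle_ineq2[of "of_real r * cis t" z] r0 by (simp add: norm_mult)
  have nz: "of_real r * cis t - z \<noteq> 0" for t
    using far[of t] r by auto
  have c: "continuous_on {0..2*pi} (\<lambda>t. f (of_real r * cis t))"
    by (rule continuous_on_circle[OF f]) (use r r0 in auto)
  have ck: "continuous_on {0..2*pi} ?k"
    by (intro continuous_intros c ballI nz)
  have "2*pi * cmod (f z) = cmod (integral {0..2*pi} ?k)"
    by (subst Cauchy_formula_circle_integral[OF f r]) (simp add: norm_mult)
  also have "\<dots> \<le> integral {0..2*pi} (\<lambda>t. r / (r - cmod z) * cmod (f (of_real r * cis t)))"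
  proof (rule integral_norm_bound_integral)
    show "?k integrable_on {0..2*pi}" by (rule integrable_continuous_real[OF ck])
    show "(\<lambda>t. r / (r - cmod z) * cmod (f (of_real r * cis t))) integrable_on {0..2*pi}"
      by (intro integrable_continuous_real continuous_intros c)
    fix t
    have "cmod (?k t) = cmod (f (of_real r * cis t)) * r / cmod (of_real r * cis t - z)"
      using r0 by (simp add: norm_mult norm_divide)
    also have "\<dots> \<le> cmod (f (of_real r * cis t)) * r / (r - cmod z)"
      by (rule divide_left_mono[OF far]) (use r r0 far[of t] in \<open>auto intro!: mult_pos_pos\<close>)
    finally show "cmod (?k t) \<le> r / (r - cmod z) * cmod (f (of_real r * cis t))"
      by (simp add: mult_ac)
  qed
  also have "\<dots> = 2*pi * (r / (r - cmod z) * circle_mean f r)"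
    by (subst cmean_eq_integral) (auto intro!: continuous_intros c)
  finally show ?thesis
    by (subst (asm) mult_le_cancel_left_pos) auto
qed

text \<open>The role of an outer function with \<open>\<bar>O\<bar> = e\<^sup>u\<close> on the circle is played by a normal-family limit of
  exponentials of polynomials; no Poisson integrals are needed.\<close>

lemma holomorphic_majorant:
  fixes u :: "nat \<Rightarrow> complex \<Rightarrow> real" and r k :: "nat \<Rightarrow> real"
  assumes u: "\<And>n. continuous_on (sphere 0 1) (u n)"
    and k: "\<And>n. cmean (\<lambda>t. exp (u n (cis t))) \<le> k n" "k \<longlonglongrightarrow> K"
    and L: "(\<lambda>n. cmean (\<lambda>t. u n (cis t))) \<longlonglongrightarrow> L"
    and r: "\<And>n. 0 < r n" "\<And>n. r n < 1" "r \<longlonglongrightarrow> 1"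
  obtains G where "G holomorphic_on ball 0 1" "\<And>z. z \<in> ball 0 1 \<Longrightarrow> G z \<noteq> 0"
    "cmod (G 0) = exp L"
    "\<And>\<rho>. 0 \<le> \<rho> \<Longrightarrow> \<rho> < 1 \<Longrightarrow> circle_mean G \<rho> \<le> K"
    "\<And>F z. F holomorphic_on ball 0 1 \<Longrightarrow>
        (\<And>n w. w \<in> sphere 0 1 \<Longrightarrow> cmod (F (of_real (r n) * w)) \<le> exp (u n w)) \<Longrightarrow>
        z \<in> ball 0 1 \<Longrightarrow> cmod (F z) \<le> cmod (G z)"
proof -
  \<comment> \<open>The tolerance tends to \<open>0\<close>, so that no error is left in the limit,
    and is at most \<open>1\<close>, so that \<open>exp (e n)\<close> stays bounded for the normal
    family.\<close>
  define e where "e n = inverse (real (Suc n))" for n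
  have e0: "e n > 0" "e n \<le> 1" for n by (auto simp: e_def divide_simps)
  have elim: "e \<longlonglongrightarrow> 0"
    unfolding e_def by (rule LIMSEQ_inverse_real_of_nat)
  have "\<exists>p. \<forall>z\<in>sphere 0 1. \<bar>u n z - Re (poly p z)\<bar> < e n" for n
    using real_part_poly_approximation[OF u e0(1)] by metis
  then obtain p where p: "\<And>n z. z \<in> sphere 0 1 \<Longrightarrow> \<bar>u n z - Re (poly (p n) z)\<bar> < e n"
    by metis
  have up: "u n z \<le> Re (poly (p n) z) + e n" "Re (poly (p n) z) \<le> u n z + e n" if "z \<in> sphere 0 1" for n z
    using p[OF that, of n] by linarith+
  define h where "h n z = exp (poly (p n) z)" for n z
  have hh: "h n holomorphic_on S" for n S
    unfolding h_def by (intro holomorphic_intros)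
  have hnz: "h n z \<noteq> 0" for n z
    unfolding h_def by simp
  have cu: "continuous_on S (\<lambda>t. u n (cis t))" for n S
    by (rule continuous_on_compose_cis[OF u])
  have cp: "continuous_on S (\<lambda>t. Re (poly (p n) (of_real s * cis t)))" for n S s
    by (intro continuous_intros)
  have ch: "continuous_on S (\<lambda>t. cmod (h n (of_real s * cis t)))" for n S s
    unfolding h_def by (intro continuous_intros)
  have m1: "cmean (\<lambda>t. cmod (h n (of_real 1 * cis t))) \<le> exp (e n) * k n" for n
  proof -
    have "cmean (\<lambda>t. cmod (h n (of_real 1 * cis t))) \<le> cmean (\<lambda>t. exp (e n) * exp (u n (cis t)))"
      using up(2)[of "cis t" for t]
      by (intro cmean_mono ch continuous_intros cu) (auto simp: h_def exp_add[symmetric] add.commute)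
    also have "\<dots> \<le> exp (e n) * k n"
      unfolding cmean_mult_left using k(1) by simp
    finally show ?thesis .
  qed
  have k0: "0 \<le> k n" for n
  proof -
    have "0 \<le> cmean (\<lambda>t. exp (u n (cis t)))"
      using cmean_mono[of "\<lambda>_. 0" "\<lambda>t. exp (u n (cis t))"] by (simp add: continuous_intros cu)
    with k(1)[of n] show ?thesis by linarith
  qed
  obtain B where B: "k n \<le> B" for n
    using convergent_imp_Bseq[OF convergentI[OF k(2)]] unfolding Bseq_def
    by (metis abs_le_iff real_norm_def)
  have B0: "0 \<le> B" using k0[of 0] B[of 0] by linarith
  have mr: "cmean (\<lambda>t. cmod (h n (of_real \<rho> * cis t))) \<le> exp (e n) * k n" if "0 \<le> \<rho>" "\<rho> < 1" for n \<rho>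
    using circle_mean_cmod_mono[OF hh, of \<rho> 1 2] m1[of n] that by (meson less_eq_real_def one_less_numeral_iff order_trans semiring_norm(76))
  have bound: "cmod (h n z) \<le> 1 / (1 - cmod z) * (exp 1 * B)" if "z \<in> ball 0 1" for n z
  proof -
    have "cmod (h n z) \<le> 1 / (1 - cmod z) * cmean (\<lambda>t. cmod (h n (of_real 1 * cis t)))"
      by (rule cmod_le_circle_mean[OF hh, where R = 2]) (use that in auto)
    also have "\<dots> \<le> 1 / (1 - cmod z) * (exp 1 * B)"
    proof (rule mult_left_mono)
      have "exp (e n) * k n \<le> exp 1 * B"
        using e0 k0 B by (intro mult_mono) auto
      with m1[of n] show "cmean (\<lambda>t. cmod (h n (of_real 1 * cis t))) \<le> exp 1 * B" by linarith
    qed (use that in auto)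
    finally show ?thesis .
  qed
  obtain G \<sigma> where G: "G holomorphic_on ball 0 1" and \<sigma>: "strict_mono (\<sigma> :: nat \<Rightarrow> nat)"
    and lim: "\<And>x. x \<in> ball 0 1 \<Longrightarrow> (\<lambda>n. h (\<sigma> n) x) \<longlonglongrightarrow> G x"
    and ul: "\<And>C. \<lbrakk>compact C; C \<subseteq> ball 0 1\<rbrakk> \<Longrightarrow> uniform_limit C (h \<circ> \<sigma>) G sequentially"
  proof (rule Montel[of "ball 0 1" "range h" h])
    fix C :: "complex set" assume C: "compact C" "C \<subseteq> ball 0 1"
    show "\<exists>B. \<forall>g\<in>range h. \<forall>z\<in>C. cmod (g z) \<le> B"
    proof (cases "C = {}")
      case False
      then obtain z0 where z0: "z0 \<in> C" "\<And>z. z \<in> C \<Longrightarrow> cmod z \<le> cmod z0"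
        using continuous_attains_sup[of C cmod] C by (auto intro: continuous_on_norm_id)
      have "cmod (h n z) \<le> 1 / (1 - cmod z0) * (exp 1 * B)" if "z \<in> C" for n z
      proof -
        have "cmod (h n z) \<le> 1 / (1 - cmod z) * (exp 1 * B)"
          using bound that C by blast
        also have "\<dots> \<le> 1 / (1 - cmod z0) * (exp 1 * B)"
          using z0(2)[OF that] z0(1) C that B0 by (intro mult_right_mono divide_left_mono) (auto intro!: mult_pos_pos)
        finally show ?thesis .
      qed
      then show ?thesis by blast
    qed auto
  qed (use hh in auto)
  have e\<sigma>: "(\<lambda>n. e (\<sigma> n)) \<longlonglongrightarrow> 0"
    using LIMSEQ_subseq_LIMSEQ[OF elim \<sigma>] by (simp add: o_def)
  have r\<sigma>: "(\<lambda>n. r (\<sigma> n)) \<longlonglongrightarrow> 1"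
    using LIMSEQ_subseq_LIMSEQ[OF r(3) \<sigma>] by (simp add: o_def)
  have k\<sigma>: "(\<lambda>n. k (\<sigma> n)) \<longlonglongrightarrow> K"
    using LIMSEQ_subseq_LIMSEQ[OF k(2) \<sigma>] by (simp add: o_def)
  have L\<sigma>: "(\<lambda>n. cmean (\<lambda>t. u (\<sigma> n) (cis t))) \<longlonglongrightarrow> L"
    using LIMSEQ_subseq_LIMSEQ[OF L \<sigma>] by (simp add: o_def)
  have Rp0: "Re (poly (p n) 0) = cmean (\<lambda>t. Re (poly (p n) (of_real 1 * cis t)))" for n
    by (rule Re_circle_mean_value[symmetric, where R = 2]) (auto intro!: holomorphic_intros)
  have le1: "Re (poly (p n) 0) \<le> cmean (\<lambda>t. u n (cis t)) + e n" for n
  proof -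
    have "Re (poly (p n) 0) \<le> cmean (\<lambda>t. u n (cis t) + e n)"
      unfolding Rp0 using up(2)[of "cis t" for t] by (intro cmean_mono cp continuous_intros cu) auto
    then show ?thesis by (simp add: cmean_add cu)
  qed
  have le2: "cmean (\<lambda>t. u n (cis t)) \<le> Re (poly (p n) 0) + e n" for n
  proof -
    have "cmean (\<lambda>t. u n (cis t)) \<le> cmean (\<lambda>t. Re (poly (p n) (of_real 1 * cis t)) + e n)"
      using up(1)[of "cis t" for t] by (intro cmean_mono cp continuous_intros cu) auto
    then show ?thesis using Rp0[of n] by (simp add: cmean_add continuous_intros)
  qed
  have "(\<lambda>n. Re (poly (p (\<sigma> n)) 0)) \<longlonglongrightarrow> L"
  proof (rule real_tendsto_sandwich)
    show "(\<lambda>n. cmean (\<lambda>t. u (\<sigma> n) (cis t)) - e (\<sigma> n)) \<longlonglongrightarrow> L"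
      using tendsto_diff[OF L\<sigma> e\<sigma>] by simp
    show "(\<lambda>n. cmean (\<lambda>t. u (\<sigma> n) (cis t)) + e (\<sigma> n)) \<longlonglongrightarrow> L"
      using tendsto_add[OF L\<sigma> e\<sigma>] by simp
  qed (use le1 le2 in \<open>auto simp: algebra_simps\<close>)
  then have "(\<lambda>n. cmod (h (\<sigma> n) 0)) \<longlonglongrightarrow> exp L"
    by (simp add: h_def tendsto_exp)
  moreover have "(\<lambda>n. cmod (h (\<sigma> n) 0)) \<longlonglongrightarrow> cmod (G 0)"
    by (intro tendsto_norm lim) auto
  ultimately have G0: "cmod (G 0) = exp L"
    by (rule LIMSEQ_unique[symmetric])
  show ?thesis
  proof (rule that)
    show "G holomorphic_on ball 0 1" by fact
    show "cmod (G 0) = exp L" by fact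
    \<comment> \<open>Hurwitz' theorem asks for a nonconstant limit; a constant limit has modulus
      \<open>exp L\<close>, which is positive.\<close>
    show "G z \<noteq> 0" if z: "z \<in> ball 0 1" for z
    proof (cases "G constant_on ball 0 1")
      case True
      then have "G z = G 0" using z by (auto simp: constant_on_def)
      with G0 show ?thesis by auto
    next
      case False
      show ?thesis
        by (rule Hurwitz_no_zeros[OF open_ball connected_ball _ G ul False _ z]) (auto simp: o_def hh hnz)
    qed
    show "circle_mean G \<rho> \<le> K" if \<rho>: "0 \<le> \<rho>" "\<rho> < 1" for \<rho>
    proof (rule field_le_epsilon)
      fix d :: real assume d: "d > 0"
      have "uniform_limit (sphere 0 \<rho>) (h \<circ> \<sigma>) G sequentially"
        by (rule ul) (use \<rho> in auto)
      then have "\<forall>\<^sub>F n in sequentially. \<forall>x\<in>sphere 0 \<rho>. dist ((h \<circ> \<sigma>) n x) (G x) < d / 2"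
        using d unfolding uniform_limit_iff by (meson half_gt_zero)
      moreover have "(\<lambda>n. exp (e (\<sigma> n)) * k (\<sigma> n)) \<longlonglongrightarrow> exp 0 * K"
        by (intro tendsto_intros e\<sigma> k\<sigma>)
      then have "\<forall>\<^sub>F n in sequentially. exp (e (\<sigma> n)) * k (\<sigma> n) < K + d / 2"
        by (rule order_tendstoD) (use d in auto)
      ultimately have "\<forall>\<^sub>F n in sequentially. (\<forall>x\<in>sphere 0 \<rho>. dist ((h \<circ> \<sigma>) n x) (G x) < d / 2) \<and> exp (e (\<sigma> n)) * k (\<sigma> n) < K + d / 2"
        by (rule eventually_conj)
      then obtain n where "(\<forall>x\<in>sphere 0 \<rho>. dist ((h \<circ> \<sigma>) n x) (G x) < d / 2) \<and> exp (e (\<sigma> n)) * k (\<sigma> n) < K + d / 2"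
        using eventually_happens'[OF sequentially_bot] by blast
      then have n: "\<And>x. x\<in>sphere 0 \<rho> \<Longrightarrow> dist (h (\<sigma> n) x) (G x) < d / 2" "exp (e (\<sigma> n)) * k (\<sigma> n) < K + d / 2"
        by auto
      have "circle_mean G \<rho> \<le> cmean (\<lambda>t. cmod (h (\<sigma> n) (of_real \<rho> * cis t)) + d / 2)"
      proof (rule cmean_mono)
        fix t
        have "dist (h (\<sigma> n) (of_real \<rho> * cis t)) (G (of_real \<rho> * cis t)) < d / 2"
          by (rule n) (use \<rho> in \<open>simp add: norm_mult\<close>)
        then show "cmod (G (of_real \<rho> * cis t)) \<le> cmod (h (\<sigma> n) (of_real \<rho> * cis t)) + d / 2"
          unfolding dist_norm by (smt (verit) norm_triangle_ineq3)
      qed (use \<rho> in \<open>auto intro!: continuous_intros ch continuous_on_circle[OF G]\<close>)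
      also have "\<dots> = cmean (\<lambda>t. cmod (h (\<sigma> n) (of_real \<rho> * cis t))) + d / 2"
        by (simp add: cmean_add ch)
      also have "\<dots> \<le> K + d"
        using mr[OF \<rho>, of "\<sigma> n"] n(2) by linarith
      finally show "circle_mean G \<rho> \<le> K + d" .
    qed
    show "cmod (F z) \<le> cmod (G z)" if F: "F holomorphic_on ball 0 1"
      and le: "\<And>n w. w \<in> sphere 0 1 \<Longrightarrow> cmod (F (of_real (r n) * w)) \<le> exp (u n w)"
      and z: "z \<in> ball 0 1" for F z
    proof (rule tendsto_le)
      show "(\<lambda>n. exp (e (\<sigma> n)) * cmod (h (\<sigma> n) z)) \<longlonglongrightarrow> cmod (G z)"
        using tendsto_mult[OF tendsto_exp[OF e\<sigma>] tendsto_norm[OF lim[OF z]]] by simp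
      have rz: "(\<lambda>n. of_real (r (\<sigma> n)) * z) \<longlonglongrightarrow> z"
        using tendsto_mult[OF tendsto_of_real[OF r\<sigma>] tendsto_const, of z] by simp
      have "isCont F z"
        using continuous_on_interior[OF holomorphic_on_imp_continuous_on[OF F]] z by simp
      from isCont_tendsto_compose[OF this rz]
      show "(\<lambda>n. cmod (F (of_real (r (\<sigma> n)) * z))) \<longlonglongrightarrow> cmod (F z)"
        by (rule tendsto_norm)
      show "\<forall>\<^sub>F n in sequentially. cmod (F (of_real (r (\<sigma> n)) * z)) \<le> exp (e (\<sigma> n)) * cmod (h (\<sigma> n) z)"
      proof (rule always_eventually, rule allI)
        fix n
        let ?m = "\<sigma> n"
        \<comment> \<open>The dilate of \<open>F\<close> is holomorphic on a ball of radius
          \<open>1 / r ?m > 1\<close>, so the comparison on the closed unit disc applies to it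
          although \<open>F\<close> itself need not extend to the circle.\<close>
        have "cmod (F (of_real (r ?m) * z)) \<le> exp (Re (poly (p ?m) z) + e ?m)"
        proof (rule cmod_le_exp_on_cball[where R = "1 / r ?m" and f = "\<lambda>z. F (of_real (r ?m) * z)" and p = "poly (p ?m)"])
          show "(\<lambda>z. F (of_real (r ?m) * z)) holomorphic_on ball 0 (1 / r ?m)"
            by (rule holomorphic_on_compose_gen[OF _ F, unfolded o_def])
               (use r(1,2)[of ?m] in \<open>auto intro!: holomorphic_intros simp: norm_mult field_simps\<close>)
          show "1 < 1 / r ?m" using r(1,2)[of ?m] by simp
          fix w :: complex assume w: "w \<in> sphere 0 1"
          have "exp (u ?m w) \<le> exp (Re (poly (p ?m) w) + e ?m)"
            using up(1)[OF w] by simp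
          with le[OF w] show "cmod (F (of_real (r ?m) * w)) \<le> exp (Re (poly (p ?m) w) + e ?m)"
            using order_trans by blast
        qed (use z in \<open>auto intro!: holomorphic_intros\<close>)
        then show "cmod (F (of_real (r ?m) * z)) \<le> exp (e ?m) * cmod (h ?m z)"
          by (simp add: h_def exp_add mult.commute)
      qed
    qed simp
  qed
qed

section \<open>Almost everywhere differentiability of Lipschitz functions\<close>

lemma emeasure_interval_measure_Ioo:
  assumes "a < b" and mono_F: "\<And>x y. x \<le> y \<Longrightarrow> F x \<le> F y" and cont_F: "continuous_on UNIV F"
  shows "emeasure (interval_measure F) {a<..<b} = ennreal (F b - F a)"
proof -
  have ac: "emeasure (interval_measure F) {a..b} = ennreal (F b - F a)"
    by (rule emeasure_interval_measure_Icc[OF less_imp_le mono_F cont_F]) (use \<open>a < b\<close> in auto)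
  have pt: "emeasure (interval_measure F) {x} = 0" for x
    using emeasure_interval_measure_Icc[OF order_refl mono_F cont_F, of x] by simp
  have "{x} \<in> null_sets (interval_measure F)" for x
    by (rule null_setsI[OF pt]) simp
  then have null: "{a} \<union> {b} \<in> null_sets (interval_measure F)"
    by (intro null_sets.Un)
  have "{a..b} = {a<..<b} \<union> ({a} \<union> {b})"
    using \<open>a < b\<close> by auto
  then have "emeasure (interval_measure F) {a..b} = emeasure (interval_measure F) ({a<..<b} \<union> ({a} \<union> {b}))"
    by (simp only:)
  also have "\<dots> = emeasure (interval_measure F) {a<..<b}"
    by (rule emeasure_Un_null_set[OF _ null]) simp
  finally show ?thesis using ac by simp
qed

text \<open>Says that the intervals with property \<open>P\<close> form a Vitali cover at
  \<open>x\<close>. Intervals straddle \<open>x\<close> strictly, which makes them open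
  neighbourhoods: this serves both measurability and the covering theorem for balls.\<close>

definition fine_interval :: "(real \<Rightarrow> real \<Rightarrow> bool) \<Rightarrow> real \<Rightarrow> bool"
  where "fine_interval P x \<longleftrightarrow> (\<forall>\<delta>>0. \<exists>c d. c < x \<and> x < d \<and> d - c < \<delta> \<and> P c d)"

text \<open>For each \<open>n\<close> the points straddled by an admissible interval shorter than
  \<open>1 / (n + 1)\<close> form an open set, so the whole set is a countable intersection of open
  sets, whatever \<open>P\<close> is.\<close>

lemma fine_interval_measurable: "{x. fine_interval P x} \<in> sets borel"
proof -
  define G where "G n = (\<Union>i\<in>{i. snd i - fst i < 1 / real (Suc n) \<and> P (fst i) (snd i)}. {fst i<..<snd i})" for n
  have G_iff: "x \<in> G n \<longleftrightarrow> (\<exists>c d. c < x \<and> x < d \<and> d - c < 1 / real (Suc n) \<and> P c d)" for x n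
    unfolding G_def by (simp add: conj_ac)
  have "open (G n)" for n
    unfolding G_def by (intro open_UN ballI open_greaterThanLessThan)
  then have "G n \<in> sets borel" for n
    by (rule borel_open)
  then have "(\<Inter>n. G n) \<in> sets borel"
    by (intro sets.countable_INT') auto
  moreover have "{x. fine_interval P x} = (\<Inter>n. G n)"
  proof (intro set_eqI iffI)
    fix x assume "x \<in> {x. fine_interval P x}"
    then have "x \<in> G n" for n
      unfolding G_iff by (simp add: fine_interval_def)
    then show "x \<in> (\<Inter>n. G n)" by (rule INT_I)
  next
    fix x assume x: "x \<in> (\<Inter>n. G n)"
    show "x \<in> {x. fine_interval P x}"
      unfolding fine_interval_def mem_Collect_eq
    proof (intro allI impI)
      fix \<delta> :: real assume "\<delta> > 0"
      then obtain n where n: "1 / real (Suc n) < \<delta>" by (rule nat_approx_posE)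
      have "x \<in> G n" using x by (rule INT_D) simp
      then obtain c d where "c < x" "x < d" "d - c < 1 / real (Suc n)" "P c d"
        unfolding G_iff by (elim exE conjE)
      with n have "c < x \<and> x < d \<and> d - c < \<delta> \<and> P c d" by simp
      then show "\<exists>c d. c < x \<and> x < d \<and> d - c < \<delta> \<and> P c d" by (intro exI)
    qed
  qed
  ultimately show ?thesis by (simp only:)
qed

text \<open>The covering theorem is about balls, so intervals are read as balls about their
  midpoints; taking them shorter than a ball radius around \<open>x\<close> inside \<open>U\<close>
  keeps the family within \<open>U\<close>.\<close>

lemma fine_interval_Vitali:
  assumes E: "\<And>x. x \<in> E \<Longrightarrow> fine_interval P x" and U: "open U" "E \<subseteq> U"
  shows "\<exists>C. countable C \<and> (\<forall>i\<in>C. fst i < snd i \<and> P (fst i) (snd i) \<and> {fst i<..<snd i} \<subseteq> U) \<and>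
    disjoint_family_on (\<lambda>i. {fst i<..<snd i}) C \<and> negligible (E - (\<Union>i\<in>C. {fst i<..<snd i}))"
proof -
  define K where "K = {(c, d). c < d \<and> P c d \<and> {c<..<d} \<subseteq> U}"
  have b: "ball ((fst i + snd i) / 2) ((snd i - fst i) / 2) = {fst i<..<snd i}" for i :: "real \<times> real"
  proof -
    have "(fst i + snd i) / 2 - (snd i - fst i) / 2 = fst i" "(fst i + snd i) / 2 + (snd i - fst i) / 2 = snd i"
      by argo+
    then show ?thesis by (simp only: ball_eq_greaterThanLessThan)
  qed
  obtain C where C: "countable C" "C \<subseteq> K"
     "pairwise (\<lambda>i j. disjnt (ball ((fst i + snd i) / 2) ((snd i - fst i) / 2)) (ball ((fst j + snd j) / 2) ((snd j - fst j) / 2))) C"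
     "negligible (E - (\<Union>i \<in> C. ball ((fst i + snd i) / 2) ((snd i - fst i) / 2)))"
  proof (rule Vitali_covering_theorem_balls[of E K "\<lambda>i. (fst i + snd i) / 2" "\<lambda>i. (snd i - fst i) / 2"])
    fix x \<delta> :: real assume x: "x \<in> E" "0 < \<delta>"
    then obtain e where e: "e > 0" "ball x e \<subseteq> U" using U openE by blast
    have "0 < min \<delta> e" using x e by simp
    then obtain c d where cd: "c < x" "x < d" "d - c < min \<delta> e" "P c d"
      using E[OF x(1), unfolded fine_interval_def, rule_format] by blast
    have "{c<..<d} \<subseteq> ball x e" using cd by (auto simp: dist_real_def)
    then have "(c, d) \<in> K" using cd e by (auto simp: K_def)
    moreover have "x \<in> ball ((c + d) / 2) ((d - c) / 2)"
      using b[of "(c, d)"] cd unfolding fst_conv snd_conv by (simp only: greaterThanLessThan_iff simp_thms)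
    moreover have "(d - c) / 2 < \<delta>" using cd x by simp
    ultimately show "\<exists>i. i \<in> K \<and> x \<in> ball ((fst i + snd i) / 2) ((snd i - fst i) / 2) \<and> (snd i - fst i) / 2 < \<delta>"
      by (intro exI[of _ "(c, d)"] conjI) (simp_all only: fst_conv snd_conv)
  qed
  show ?thesis
  proof (intro exI[of _ C] conjI ballI)
    show "fst i < snd i" "P (fst i) (snd i)" "{fst i<..<snd i} \<subseteq> U" if "i \<in> C" for i
      using subsetD[OF C(2) that] by (simp_all add: K_def case_prod_unfold)
    show "disjoint_family_on (\<lambda>i. {fst i<..<snd i}) C"
      using C(3) unfolding b by (auto simp: disjoint_family_on_def pairwise_def disjnt_def)
    show "negligible (E - (\<Union>i\<in>C. {fst i<..<snd i}))"
      using C(4) unfolding b .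
  qed (fact C(1))
qed

text \<open>The classical double covering. Within an open \<open>U\<close> barely larger than the
  set, disjoint intervals of slope below \<open>p\<close> cover almost all of it; within their union
  \<open>W\<close>, disjoint intervals of slope above \<open>q\<close> cover almost all of it again,
  with union \<open>V\<close>. The measure \<open>\<mu>\<close> of increments of \<open>F\<close>
  then gives \<open>q |E| \<le> \<mu> V \<le> \<mu> W \<le> p |W| \<le> p (|E| + e)\<close>, and
  \<open>p < q\<close> leaves only \<open>|E| = 0\<close>.\<close>

lemma negligible_slopes:
  fixes F :: "real \<Rightarrow> real"
  assumes mono_F: "\<And>x y. x \<le> y \<Longrightarrow> F x \<le> F y" and cont_F: "continuous_on UNIV F"
    and pq: "0 \<le> p" "p < q"
  shows "negligible {x. fine_interval (\<lambda>c d. F d - F c < p * (d - c)) x \<and>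
                        fine_interval (\<lambda>c d. q * (d - c) < F d - F c) x}" (is "negligible ?E")
proof -
  \<comment> \<open>Bounded pieces have finite measure \<open>s\<close>, without which
    \<open>q * s \<le> p * s\<close> could not be cancelled.\<close>
  have "negligible (?E \<inter> cbox a b)" for a b
  proof -
    define E where "E = ?E \<inter> cbox a b"
    have fE: "fine_interval (\<lambda>c d. F d - F c < p * (d - c)) x" "fine_interval (\<lambda>c d. q * (d - c) < F d - F c) x"
      if "x \<in> E" for x
      using that unfolding E_def by blast+
    have Ecb: "E \<subseteq> cbox a b" unfolding E_def by blast
    have "E = {x. fine_interval (\<lambda>c d. F d - F c < p * (d - c)) x} \<inter>
        {x. fine_interval (\<lambda>c d. q * (d - c) < F d - F c) x} \<inter> cbox a b"
      unfolding E_def by blast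
    moreover have "{x. fine_interval (\<lambda>c d. F d - F c < p * (d - c)) x} \<inter>
        {x. fine_interval (\<lambda>c d. q * (d - c) < F d - F c) x} \<inter> cbox a b \<in> sets borel"
      by (rule sets.Int[OF sets.Int[OF fine_interval_measurable fine_interval_measurable] borel_closed[OF closed_cbox]])
    ultimately have Eb: "E \<in> sets borel"
      by (rule ssubst)
    have El: "E \<in> sets lebesgue"
      by (rule sets_completionI_sets) (simp only: sets_lborel Eb)
    have "emeasure lebesgue E \<le> emeasure lebesgue (cbox a b)"
      by (rule emeasure_mono[OF Ecb]) simp
    also have "\<dots> < \<infinity>"
      using emeasure_lborel_cbox_finite[of a b] by simp
    finally have fin: "emeasure lebesgue E < \<infinity>" .
    define \<mu> where "\<mu> = interval_measure F"
    have s\<mu>: "sets \<mu> = sets borel" by (simp add: \<mu>_def)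
    have \<mu>I: "emeasure \<mu> {c<..<d} = ennreal (F d - F c)" if "c < d" for c d
      unfolding \<mu>_def by (rule emeasure_interval_measure_Ioo[OF that mono_F cont_F])
    define s where "s = measure lebesgue E"
    have sE: "emeasure lebesgue E = ennreal s"
      unfolding s_def using fin by (intro emeasure_eq_ennreal_measure) auto
    have main: "q * s \<le> p * (s + e)" if e: "e > 0" for e
    proof -
      obtain U where U: "open U" "E \<subseteq> U" "U - E \<in> lmeasurable" "emeasure lebesgue (U - E) < ennreal e"
        by (rule sets_lebesgue_outer_open[OF El e])
      have "emeasure lebesgue U = emeasure lebesgue E + emeasure lebesgue (U - E)"
        using plus_emeasure[OF El fmeasurableD[OF U(3)]] U(2) by (simp add: Un_absorb1)
      also have "\<dots> \<le> ennreal s + ennreal e"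
        using U sE by (intro add_mono) auto
      finally have Us: "emeasure lebesgue U \<le> ennreal (s + e)"
        using e by (simp add: s_def)
      obtain C where C: "countable C" "\<forall>i\<in>C. fst i < snd i \<and> F (snd i) - F (fst i) < p * (snd i - fst i) \<and> {fst i<..<snd i} \<subseteq> U"
        "disjoint_family_on (\<lambda>i. {fst i<..<snd i}) C" "negligible (E - (\<Union>i\<in>C. {fst i<..<snd i}))"
        using fine_interval_Vitali[of E "\<lambda>c d. F d - F c < p * (d - c)" U, OF fE(1) U(1,2)] by blast
      define W where "W = (\<Union>i\<in>C. {fst i<..<snd i})"
      have W: "open W" unfolding W_def by (intro open_UN ballI open_greaterThanLessThan)
      have W2: "W \<subseteq> U"
        using C(2) unfolding W_def by blast+
      have fEW: "fine_interval (\<lambda>c d. q * (d - c) < F d - F c) x" if "x \<in> E \<inter> W" for x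
        by (rule fE(2)[OF IntD1[OF that]])
      \<comment> \<open>The second cover is chosen inside \<open>W\<close>, not just inside
        \<open>U\<close>; this is what allows \<open>\<mu> V \<le> \<mu> W\<close>.\<close>
      obtain D where D: "countable D" "\<forall>i\<in>D. fst i < snd i \<and> q * (snd i - fst i) < F (snd i) - F (fst i) \<and> {fst i<..<snd i} \<subseteq> W"
        "disjoint_family_on (\<lambda>i. {fst i<..<snd i}) D" "negligible (E \<inter> W - (\<Union>i\<in>D. {fst i<..<snd i}))"
        using fine_interval_Vitali[of "E \<inter> W" "\<lambda>c d. q * (d - c) < F d - F c" W, OF fEW W Int_lower2] by blast
      define V where "V = (\<Union>i\<in>D. {fst i<..<snd i})"
      have V: "open V" unfolding V_def by (intro open_UN ballI open_greaterThanLessThan)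
      have V2: "V \<subseteq> W"
        using D(2) unfolding V_def by blast+
      have "negligible (E - V)"
        by (rule negligible_subset[OF negligible_Un[OF C(4) D(4)]]) (auto simp: W_def V_def)
      then have "emeasure lebesgue (E - V) = 0"
        by (simp add: negligible_iff_null_sets null_setsD1)
      moreover have "emeasure lebesgue E \<le> emeasure lebesgue (E - V) + emeasure lebesgue V"
        by (rule order_trans[OF emeasure_mono emeasure_subadditive]) (use El V in auto)
      ultimately have sV: "ennreal s \<le> emeasure lborel V"
        using sE V by simp
      have "ennreal q * ennreal s \<le> ennreal q * emeasure lborel V"
        using sV by (rule mult_left_mono) simp
      also have "emeasure lborel V = (\<integral>\<^sup>+i. emeasure lborel {fst i<..<snd i} \<partial>count_space D)"
        unfolding V_def by (rule emeasure_UN_countable[OF _ D(1,3)]) auto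
      also have "ennreal q * \<dots> = (\<integral>\<^sup>+i. ennreal q * emeasure lborel {fst i<..<snd i} \<partial>count_space D)"
        by (simp add: nn_integral_cmult)
      also have "\<dots> \<le> (\<integral>\<^sup>+i. emeasure \<mu> {fst i<..<snd i} \<partial>count_space D)"
      proof (rule nn_integral_mono)
        fix i assume "i \<in> space (count_space D)"
        then have "i \<in> D" by simp
        with D(2) have "fst i < snd i" and "q * (snd i - fst i) < F (snd i) - F (fst i)"
          by blast+
        moreover have "emeasure lborel {fst i<..<snd i} = ennreal (snd i - fst i)"
          using \<open>fst i < snd i\<close> by simp
        then have "ennreal q * emeasure lborel {fst i<..<snd i} = ennreal (q * (snd i - fst i))"
          using pq \<open>fst i < snd i\<close> by (simp only: ennreal_mult less_imp_le diff_ge_0_iff_ge)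
        ultimately show "ennreal q * emeasure lborel {fst i<..<snd i} \<le> emeasure \<mu> {fst i<..<snd i}"
          using \<mu>I[OF \<open>fst i < snd i\<close>] by (simp only: ennreal_leI less_imp_le)
      qed
      also have "\<dots> = emeasure \<mu> V"
        unfolding V_def by (rule emeasure_UN_countable[symmetric, OF _ D(1,3)]) (auto simp: s\<mu>)
      also have "\<dots> \<le> emeasure \<mu> W"
        by (rule emeasure_mono[OF V2]) (simp only: s\<mu> borel_open[OF W])
      also have "\<dots> = (\<integral>\<^sup>+i. emeasure \<mu> {fst i<..<snd i} \<partial>count_space C)"
        unfolding W_def by (rule emeasure_UN_countable[OF _ C(1,3)]) (auto simp: s\<mu>)
      also have "\<dots> \<le> (\<integral>\<^sup>+i. ennreal p * emeasure lborel {fst i<..<snd i} \<partial>count_space C)"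
      proof (rule nn_integral_mono)
        fix i assume "i \<in> space (count_space C)"
        then have "i \<in> C" by simp
        with C(2) have "fst i < snd i" and "F (snd i) - F (fst i) < p * (snd i - fst i)"
          by blast+
        moreover have "emeasure lborel {fst i<..<snd i} = ennreal (snd i - fst i)"
          using \<open>fst i < snd i\<close> by simp
        then have "ennreal p * emeasure lborel {fst i<..<snd i} = ennreal (p * (snd i - fst i))"
          using pq \<open>fst i < snd i\<close> by (simp only: ennreal_mult less_imp_le diff_ge_0_iff_ge)
        ultimately show "emeasure \<mu> {fst i<..<snd i} \<le> ennreal p * emeasure lborel {fst i<..<snd i}"
          using \<mu>I[OF \<open>fst i < snd i\<close>] by (simp only: ennreal_leI less_imp_le)
      qed
      also have "\<dots> = ennreal p * (\<integral>\<^sup>+i. emeasure lborel {fst i<..<snd i} \<partial>count_space C)"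
        by (simp add: nn_integral_cmult)
      also have "(\<integral>\<^sup>+i. emeasure lborel {fst i<..<snd i} \<partial>count_space C) = emeasure lborel W"
        unfolding W_def by (rule emeasure_UN_countable[symmetric, OF _ C(1,3)]) auto
      finally have fin: "ennreal q * ennreal s \<le> ennreal p * emeasure lborel W" .
      have "emeasure lborel W = emeasure lebesgue W"
        using W by simp
      also have "\<dots> \<le> emeasure lebesgue U"
        by (rule emeasure_mono[OF W2]) (use U(1) in simp)
      also note Us
      finally have "ennreal p * emeasure lborel W \<le> ennreal p * ennreal (s + e)"
        by (rule mult_left_mono) simp
      with fin have "ennreal q * ennreal s \<le> ennreal p * ennreal (s + e)"
        by (rule order_trans)
      moreover have "ennreal q * ennreal s = ennreal (q * s)" "ennreal p * ennreal (s + e) = ennreal (p * (s + e))"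
        using pq e by (simp_all add: ennreal_mult s_def)
      ultimately show ?thesis
        using pq e by (simp add: s_def)
    qed
    \<comment> \<open>\<open>main\<close> is applied with \<open>e / p\<close>; for
      \<open>p = 0\<close> it already says \<open>q * s \<le> 0\<close>.\<close>
    have "q * s \<le> p * s + e" if e: "e > 0" for e
    proof (cases "p = 0")
      case True
      with main[of 1] e show ?thesis by simp
    next
      case False
      then show ?thesis using main[of "e / p"] e pq by (simp add: algebra_simps)
    qed
    then have "q * s \<le> p * s" by (rule field_le_epsilon)
    then have "(q - p) * s \<le> 0" by (simp add: algebra_simps)
    then have "s \<le> 0" using pq by (simp add: mult_le_0_iff)
    then have "emeasure lebesgue E = 0" using sE by (simp add: ennreal_neg)
    then have "negligible E"
      using El by (simp add: negligible_iff_emeasure0)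
    then show ?thesis unfolding E_def .
  qed
  then show ?thesis using negligible_on_intervals by blast
qed

text \<open>An interval straddling \<open>x\<close> becomes one with end point \<open>x\<close> when
  its other end slides into \<open>x\<close>, and the Lipschitz bound makes the error of sliding
  arbitrarily small.\<close>

lemma slopes_imp_derivative:
  fixes F :: "real \<Rightarrow> real"
  assumes lip: "\<And>x y. \<bar>F y - F x\<bar> \<le> C * \<bar>y - x\<bar>"
    and sl: "\<And>e. e > 0 \<Longrightarrow> \<exists>\<delta>>0. \<forall>c d. c < x \<and> x < d \<and> d - c < \<delta> \<longrightarrow> \<bar>F d - F c - D * (d - c)\<bar> \<le> e * (d - c)"
  shows "(F has_real_derivative D) (at x)"
  unfolding DERIV_def
proof (rule LIM_I)
  fix e :: real assume e: "e > 0"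
  then obtain \<delta> where \<delta>: "\<delta> > 0"
    "\<And>c d. c < x \<Longrightarrow> x < d \<Longrightarrow> d - c < \<delta> \<Longrightarrow> \<bar>F d - F c - D * (d - c)\<bar> \<le> e / 2 * (d - c)"
    using sl[of "e/2"] by auto
  have C0: "0 \<le> C" using lip[of 1 0] abs_ge_zero[of "F 1 - F 0"] by simp
  define K where "K = C + \<bar>D\<bar> + e / 2"
  have K: "0 < K" using C0 e by (simp add: K_def add_nonneg_pos)
  have key: "\<bar>F (x + h) - F x - D * h\<bar> \<le> e / 2 * \<bar>h\<bar>" if h: "h \<noteq> 0" "\<bar>h\<bar> < \<delta> / 2" for h
  proof (rule field_le_epsilon)
    fix \<epsilon> :: real assume \<epsilon>: "\<epsilon> > 0"
    \<comment> \<open>One end of the straddling interval is \<open>x + h\<close>; the other is put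
      at distance \<open>\<eta>\<close> beyond \<open>x\<close>, a displacement that costs at most
      \<open>K * \<eta> \<le> \<epsilon>\<close>.\<close>
    define \<eta> where "\<eta> = min (\<delta> / 2) (\<epsilon> / K)"
    have \<eta>: "0 < \<eta>" "\<eta> \<le> \<delta> / 2" "\<eta> \<le> \<epsilon> / K"
      unfolding \<eta>_def by (use \<delta>(1) \<epsilon> K in simp) (rule min.cobounded1 min.cobounded2)+
    have K\<eta>: "K * \<eta> \<le> \<epsilon>" using \<eta>(3) K by (simp add: pos_le_divide_eq mult.commute)
    have D\<eta>: "\<bar>D * \<eta>\<bar> = \<bar>D\<bar> * \<eta>" using \<eta>(1) by (simp add: abs_mult)
    show "\<bar>F (x + h) - F x - D * h\<bar> \<le> e / 2 * \<bar>h\<bar> + \<epsilon>"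
    proof (cases "h > 0")
      case True
      have 1: "\<bar>F (x + h) - F (x - \<eta>) - D * (h + \<eta>)\<bar> \<le> e / 2 * (h + \<eta>)"
        using \<delta>(2)[of "x - \<eta>" "x + h"] \<eta> h True by (simp add: algebra_simps)
      have 2: "\<bar>F x - F (x - \<eta>)\<bar> \<le> C * \<eta>"
        using lip[of x "x - \<eta>"] \<eta>(1) by simp
      have "F (x + h) - F x - D * h = (F (x + h) - F (x - \<eta>) - D * (h + \<eta>)) - (F x - F (x - \<eta>)) + D * \<eta>"
        by (simp add: algebra_simps)
      then have "\<bar>F (x + h) - F x - D * h\<bar> \<le> e / 2 * (h + \<eta>) + C * \<eta> + \<bar>D\<bar> * \<eta>"
        using 1 2 D\<eta> by linarith
      also have "\<dots> = e / 2 * \<bar>h\<bar> + K * \<eta>"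
        using True by (simp add: K_def algebra_simps)
      finally show ?thesis using K\<eta> by linarith
    next
      case False
      then have h0: "h < 0" using h by simp
      have 1: "\<bar>F (x + \<eta>) - F (x + h) - D * (\<eta> - h)\<bar> \<le> e / 2 * (\<eta> - h)"
        using \<delta>(2)[of "x + h" "x + \<eta>"] \<eta> h h0 by (simp add: algebra_simps)
      have 2: "\<bar>F (x + \<eta>) - F x\<bar> \<le> C * \<eta>"
        using lip[of "x + \<eta>" x] \<eta>(1) by simp
      have "F (x + h) - F x - D * h = (F (x + \<eta>) - F x) - (F (x + \<eta>) - F (x + h) - D * (\<eta> - h)) - D * \<eta>"
        by (simp add: algebra_simps)
      then have "\<bar>F (x + h) - F x - D * h\<bar> \<le> e / 2 * (\<eta> - h) + C * \<eta> + \<bar>D\<bar> * \<eta>"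
        using 1 2 D\<eta> by linarith
      also have "\<dots> = e / 2 * \<bar>h\<bar> + K * \<eta>"
        using h0 by (simp add: K_def field_simps)
      finally show ?thesis using K\<eta> by linarith
    qed
  qed
  show "\<exists>s>0. \<forall>h. h \<noteq> 0 \<and> norm (h - 0) < s \<longrightarrow> norm ((F (x + h) - F x) / h - D) < e"
  proof (intro exI[of _ "\<delta> / 2"] conjI allI impI)
    fix h :: real assume h: "h \<noteq> 0 \<and> norm (h - 0) < \<delta> / 2"
    then have "\<bar>F (x + h) - F x - D * h\<bar> \<le> e / 2 * \<bar>h\<bar>" by (intro key) auto
    also have "\<dots> < e * \<bar>h\<bar>" using e h by simp
    finally have "\<bar>F (x + h) - F x - D * h\<bar> / \<bar>h\<bar> < e"
      using h by (simp add: pos_divide_less_eq)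
    moreover have "(F (x + h) - F x) / h - D = (F (x + h) - F x - D * h) / h"
      using h by (simp add: diff_divide_distrib)
    ultimately show "norm ((F (x + h) - F x) / h - D) < e"
      by (simp add: abs_divide)
  qed (use \<delta> in simp)
qed

text \<open>Where the derivative fails to exist, some rational pair \<open>p < q\<close> has
  arbitrarily short straddling intervals of slope below \<open>p\<close> and others of slope above
  \<open>q\<close>. There are countably many pairs, and each contributes a null set.\<close>

lemma negligible_not_derivative_mono:
  fixes F :: "real \<Rightarrow> real"
  assumes mono_F: "\<And>x y. x \<le> y \<Longrightarrow> F x \<le> F y" and lip: "\<And>x y. \<bar>F y - F x\<bar> \<le> C * \<bar>y - x\<bar>"
  shows "\<exists>N. negligible N \<and> (\<forall>x. x \<notin> N \<longrightarrow> (\<exists>D. (F has_real_derivative D) (at x)))"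
proof -
  have C0: "0 \<le> C" using lip[of 1 0] abs_ge_zero[of "F 1 - F 0"] by simp
  have cont: "continuous_on UNIV F"
  proof (rule lipschitz_on_continuous_on[of C])
    show "C-lipschitz_on UNIV F"
      using lip C0 by (auto simp: lipschitz_on_def dist_real_def)
  qed
  define lo where "lo p = fine_interval (\<lambda>c d. F d - F c < p * (d - c))" for p
  define hi where "hi q = fine_interval (\<lambda>c d. q * (d - c) < F d - F c)" for q
  define I :: "(real \<times> real) set" where "I = {i \<in> \<rat> \<times> \<rat>. 0 \<le> fst i \<and> fst i < snd i}"
  define N where "N = (\<Union>i\<in>I. {x. lo (fst i) x \<and> hi (snd i) x})"
  have "countable I"
    unfolding I_def by (rule countable_Collect) (intro countable_SIGMA countable_rat)
  then have "negligible N"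
    unfolding N_def
  proof (intro negligible_countable_Union countable_image)
    fix S assume "S \<in> (\<lambda>i. {x. lo (fst i) x \<and> hi (snd i) x}) ` I"
    then obtain i where i: "i \<in> I" "S = {x. lo (fst i) x \<and> hi (snd i) x}" by auto
    show "negligible S"
      unfolding i(2) lo_def hi_def by (rule negligible_slopes[OF mono_F cont]) (use i(1) in \<open>auto simp: I_def\<close>)
  qed
  moreover have "\<exists>D. (F has_real_derivative D) (at x)" if x: "x \<notin> N" for x
  proof -
    \<comment> \<open>\<open>Sup A\<close> is the lower derivative over straddling intervals. It is
      finite by the Lipschitz bound, and \<open>0\<close> belongs to \<open>A\<close> by
      monotonicity, so that only slopes \<open>0 \<le> p\<close>, as
      \<open>negligible_slopes\<close> requires, come into play.\<close>
    define A where "A = {p \<in> \<rat>. 0 \<le> p \<and> (\<exists>\<delta>>0. \<forall>c d. c < x \<and> x < d \<and> d - c < \<delta> \<longrightarrow> p * (d - c) \<le> F d - F c)}"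
    have "0 \<in> A"
      unfolding A_def using mono_F by (auto intro!: exI[of _ 1])
    have AC: "p \<le> C" if pA: "p \<in> A" for p
    proof -
      obtain \<delta> where \<delta>: "\<delta> > 0" "\<And>c d. c < x \<Longrightarrow> x < d \<Longrightarrow> d - c < \<delta> \<Longrightarrow> p * (d - c) \<le> F d - F c"
        using pA by (auto simp: A_def)
      have "p * (\<delta> / 2) \<le> F (x + \<delta> / 4) - F (x - \<delta> / 4)"
        using \<delta>(2)[of "x - \<delta> / 4" "x + \<delta> / 4"] \<delta>(1) by simp
      also have "\<dots> \<le> \<bar>F (x + \<delta> / 4) - F (x - \<delta> / 4)\<bar>"
        by (rule abs_ge_self)
      also have "\<dots> \<le> C * \<bar>(x + \<delta> / 4) - (x - \<delta> / 4)\<bar>"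
        by (rule lip)
      also have "\<dots> = C * (\<delta> / 2)"
        using \<delta>(1) by simp
      finally show ?thesis using \<delta>(1) by simp
    qed
    then have bdd: "bdd_above A" by (rule bdd_aboveI)
    define D where "D = Sup A"
    have D0: "0 \<le> D" unfolding D_def by (rule cSup_upper[OF \<open>0 \<in> A\<close> bdd])
    have "(F has_real_derivative D) (at x)"
    proof (rule slopes_imp_derivative[OF lip])
      fix e :: real assume e: "e > 0"
      obtain q1 where q1: "q1 \<in> \<rat>" "D < q1" "q1 < D + e" using Rats_dense_in_real[of D "D + e"] e by auto
      obtain q2 where q2: "q2 \<in> \<rat>" "q1 < q2" "q2 < D + e" using Rats_dense_in_real[OF q1(3)] by auto
      have "q1 \<notin> A" using cSup_upper[OF _ bdd, of q1] q1(2) by (auto simp: D_def)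
      then have "lo q1 x"
        unfolding lo_def fine_interval_def using q1 D0 by (auto simp: A_def not_le)
      moreover have "(q1, q2) \<in> I" using q1 q2 D0 by (auto simp: I_def)
      ultimately have "\<not> hi q2 x" using x by (force simp: N_def)
      then obtain \<delta>1 where \<delta>1: "\<delta>1 > 0" "\<not> (\<exists>c d. c < x \<and> x < d \<and> d - c < \<delta>1 \<and> q2 * (d - c) < F d - F c)"
        unfolding hi_def fine_interval_def by auto
      obtain p where p: "p \<in> A" "D - e < p"
        using less_cSupE[of "D - e" A] e \<open>0 \<in> A\<close> by (auto simp: D_def)
      then obtain \<delta>2 where \<delta>2: "\<delta>2 > 0" "\<And>c d. c < x \<Longrightarrow> x < d \<Longrightarrow> d - c < \<delta>2 \<Longrightarrow> p * (d - c) \<le> F d - F c"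
        by (auto simp: A_def)
      show "\<exists>\<delta>>0. \<forall>c d. c < x \<and> x < d \<and> d - c < \<delta> \<longrightarrow> \<bar>F d - F c - D * (d - c)\<bar> \<le> e * (d - c)"
      proof (intro exI[of _ "min \<delta>1 \<delta>2"] conjI allI impI)
        fix c d assume cd: "c < x \<and> x < d \<and> d - c < min \<delta>1 \<delta>2"
        have "q2 * (d - c) \<le> (D + e) * (d - c)" "(D - e) * (d - c) \<le> p * (d - c)"
          using q2 p cd by (auto intro!: mult_right_mono)
        moreover have "\<not> q2 * (d - c) < F d - F c"
          using \<delta>1(2) cd by auto
        moreover have "p * (d - c) \<le> F d - F c"
          using \<delta>2(2)[of c d] cd by auto
        ultimately show "\<bar>F d - F c - D * (d - c)\<bar> \<le> e * (d - c)"
          by (simp add: abs_le_iff algebra_simps not_less)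
      qed (use \<delta>1 \<delta>2 in simp)
    qed
    then show ?thesis by blast
  qed
  ultimately show ?thesis by blast
qed

text \<open>Adding \<open>C * x\<close> makes the function monotone, and subtracting it again does
  not affect differentiability.\<close>

lemma negligible_not_derivative_lipschitz:
  fixes F :: "real \<Rightarrow> real"
  assumes lip: "\<And>x y. \<bar>F y - F x\<bar> \<le> C * \<bar>y - x\<bar>"
  shows "\<exists>N. negligible N \<and> (\<forall>x. x \<notin> N \<longrightarrow> (\<exists>D. (F has_real_derivative D) (at x)))"
proof -
  have "\<exists>N. negligible N \<and> (\<forall>x. x \<notin> N \<longrightarrow> (\<exists>D. ((\<lambda>x. F x + C * x) has_real_derivative D) (at x)))"
  proof (rule negligible_not_derivative_mono)
    show "F x + C * x \<le> F y + C * y" if "x \<le> y" for x y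
      using lip[of x y] that by (simp add: abs_le_iff algebra_simps)
    fix x y
    have "F y + C * y - (F x + C * x) = (F y - F x) + C * (y - x)" by (simp add: algebra_simps)
    then have "\<bar>F y + C * y - (F x + C * x)\<bar> \<le> \<bar>F y - F x\<bar> + \<bar>C\<bar> * \<bar>y - x\<bar>"
      by (metis abs_mult abs_triangle_ineq)
    then show "\<bar>F y + C * y - (F x + C * x)\<bar> \<le> (C + \<bar>C\<bar>) * \<bar>y - x\<bar>"
      using lip[of y x] by (simp add: algebra_simps)
  qed
  then obtain N where N: "negligible N" "\<And>x. x \<notin> N \<Longrightarrow> \<exists>D. ((\<lambda>x. F x + C * x) has_real_derivative D) (at x)"
    by blast
  have "\<exists>D. (F has_real_derivative D) (at x)" if x: "x \<notin> N" for x
  proof -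
    obtain D where D: "((\<lambda>x. F x + C * x) has_real_derivative D) (at x)" using N(2)[OF x] by (elim exE)
    have "((\<lambda>x. (F x + C * x) - C * x) has_real_derivative D - C) (at x)"
      by (rule DERIV_diff[OF D]) (auto intro!: derivative_eq_intros)
    then show ?thesis by auto
  qed
  with N(1) show ?thesis by blast
qed

lemma negligible_not_derivative_lipschitz_complex:
  fixes F :: "real \<Rightarrow> complex"
  assumes lip: "\<And>x y. cmod (F y - F x) \<le> C * \<bar>y - x\<bar>"
  shows "\<exists>N. negligible N \<and> (\<forall>x. x \<notin> N \<longrightarrow> (\<exists>D. ((\<lambda>h. (F (x + h) - F x) / of_real h) \<longlongrightarrow> D) (at 0)))"
proof -
  have "\<bar>Re (F y) - Re (F x)\<bar> \<le> C * \<bar>y - x\<bar>" for x y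
    using lip[of y x] abs_Re_le_cmod[of "F y - F x"] by simp
  from negligible_not_derivative_lipschitz[of "\<lambda>x. Re (F x)", OF this] obtain N1
    where N1: "negligible N1" "\<And>x. x \<notin> N1 \<Longrightarrow> \<exists>D. ((\<lambda>x. Re (F x)) has_real_derivative D) (at x)" by blast
  have "\<bar>Im (F y) - Im (F x)\<bar> \<le> C * \<bar>y - x\<bar>" for x y
    using lip[of y x] abs_Im_le_cmod[of "F y - F x"] by simp
  from negligible_not_derivative_lipschitz[of "\<lambda>x. Im (F x)", OF this] obtain N2
    where N2: "negligible N2" "\<And>x. x \<notin> N2 \<Longrightarrow> \<exists>D. ((\<lambda>x. Im (F x)) has_real_derivative D) (at x)" by blast
  have "\<exists>D. ((\<lambda>h. (F (x + h) - F x) / of_real h) \<longlongrightarrow> D) (at 0)" if "x \<notin> N1 \<union> N2" for x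
  proof -
    from that have "x \<notin> N1" "x \<notin> N2" by auto
    from N1(2)[OF this(1)] N2(2)[OF this(2)] obtain D1 D2
      where "((\<lambda>x. Re (F x)) has_real_derivative D1) (at x)" "((\<lambda>x. Im (F x)) has_real_derivative D2) (at x)"
      by (elim exE)
    then have "((\<lambda>h. (F (x + h) - F x) / of_real h) \<longlongrightarrow> Complex D1 D2) (at 0)"
      unfolding DERIV_def by (subst tendsto_complex_iff) simp
    then show ?thesis by blast
  qed
  with N1(1) N2(1) show ?thesis by (intro exI[of _ "N1 \<union> N2"]) auto
qed

section \<open>Passing limits from the circle into the disc\<close>

lemma cmod_cis_diff_le: "cmod (cis x - cis y) \<le> \<bar>x - y\<bar>"
proof -
  have "norm (cis x - cis y) \<le> 1 * norm (x - y)"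
  proof (rule differentiable_bound[of UNIV cis "\<lambda>x t. t *\<^sub>R (\<i> * cis x)"])
    show "(cis has_derivative (\<lambda>t. t *\<^sub>R (\<i> * cis x))) (at x within UNIV)" for x
      using has_derivative_cis[OF has_derivative_ident, of x UNIV] by simp
    show "onorm (\<lambda>t. t *\<^sub>R (\<i> * cis x)) \<le> 1" for x
      by (rule onorm_le) (simp add: norm_mult)
  qed auto
  then show ?thesis by simp
qed

text \<open>A Phragmen--Lindelof argument: \<open>w\<close> below satisfies \<open>Re w = \<bar>w\<bar>\<^sup>2\<close> on the circle, so that
  \<open>exp (- A * w)\<close> damps \<open>G\<close> away from \<open>\<zeta>\<close> on the circle without being small near \<open>\<zeta>\<close> in the disc;
  a power of the product times \<open>w\<close> removes the exceptional point.\<close>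

lemma limit_from_circle_imp_limit_in_disc:
  fixes G :: "complex \<Rightarrow> complex"
  assumes cont: "continuous_on (cball 0 1 - {\<zeta>}) G" and hol: "G holomorphic_on ball 0 1"
    and bdd: "\<And>z. z \<in> cball 0 1 - {\<zeta>} \<Longrightarrow> cmod (G z) \<le> M"
    and \<zeta>: "cmod \<zeta> = 1"
    and circ: "\<And>e. e > 0 \<Longrightarrow> \<exists>\<delta>>0. \<forall>z\<in>sphere 0 1 - {\<zeta>}. cmod (z - \<zeta>) < \<delta> \<longrightarrow> cmod (G z) \<le> e"
    and e: "e > 0"
  shows "\<exists>\<delta>>0. \<forall>z\<in>ball 0 1. cmod (z - \<zeta>) < \<delta> \<longrightarrow> cmod (G z) \<le> e"
proof -
  obtain \<delta> where \<delta>: "\<delta> > 0" "\<And>z. z \<in> sphere 0 1 - {\<zeta>} \<Longrightarrow> cmod (z - \<zeta>) < \<delta> \<Longrightarrow> cmod (G z) \<le> e / 2"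
    using circ[of "e / 2"] e by auto
  \<comment> \<open>Enlarging the bound beyond \<open>e / 2\<close> makes the logarithm in the
    damping constant \<open>A\<close> positive.\<close>
  define M' where "M' = \<bar>M\<bar> + e"
  have M': "M' > e / 2" "M' > 0" "M \<le> M'" using e by (auto simp: M'_def)
  define w where "w z = (1 - cnj \<zeta> * z) / 2" for z
  have cw: "cnj \<zeta> * \<zeta> = 1" using \<zeta> by (metis complex_norm_square mult.commute of_real_1 power_one)
  have w_norm: "cmod (w z) = cmod (z - \<zeta>) / 2" for z
  proof -
    have "1 - cnj \<zeta> * z = - cnj \<zeta> * (z - \<zeta>)" using cw by (simp add: algebra_simps)
    then show ?thesis by (simp add: w_def norm_divide norm_mult \<zeta>)
  qed
  have w_Re: "0 \<le> Re (w z)" if "z \<in> cball 0 1" for z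
  proof -
    have "Re (cnj \<zeta> * z) \<le> cmod (cnj \<zeta> * z)" by (rule complex_Re_le_cmod)
    also have "\<dots> \<le> 1" using that by (simp add: norm_mult \<zeta>)
    finally show ?thesis by (simp add: w_def)
  qed
  have w_circ: "Re (w z) = (cmod (w z))\<^sup>2" if "z \<in> sphere 0 1" for z
  proof -
    have "(cmod (1 - v))\<^sup>2 = 1 - 2 * Re v + (cmod v)\<^sup>2" for v
      by (simp add: cmod_power2) (simp add: power2_eq_square algebra_simps)
    from this[of "cnj \<zeta> * z"] have "(cmod (1 - cnj \<zeta> * z))\<^sup>2 = 2 - 2 * Re (cnj \<zeta> * z)"
      using that by (simp only: norm_mult complex_mod_cnj \<zeta>) simp
    then show ?thesis unfolding w_def by (simp add: norm_divide power_divide)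
  qed
  \<comment> \<open>At distance \<open>\<delta>\<close> or more from \<open>\<zeta>\<close> on the
    circle \<open>Re (w z) \<ge> \<delta>^2 / 4\<close>, so this \<open>A\<close> makes the damping
    factor at most \<open>(e / 2) / M'\<close>, just enough against the bound
    \<open>M'\<close>.\<close>
  define A where "A = 4 / \<delta>\<^sup>2 * ln (M' / (e / 2))"
  have A0: "A > 0" using \<delta>(1) M' e by (auto simp: A_def intro!: mult_pos_pos ln_gt_zero)
  define H where "H z = G z * exp (- of_real A * w z)" for z
  have nH: "cmod (H z) = cmod (G z) * exp (- A * Re (w z))" for z
    by (simp add: H_def norm_mult)
  have H_circ: "cmod (H z) \<le> e / 2" if z: "z \<in> sphere 0 1 - {\<zeta>}" for z
  proof (cases "cmod (z - \<zeta>) < \<delta>")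
    case True
    have "exp (- A * Re (w z)) \<le> 1" using A0 w_Re[of z] z by simp
    then have "cmod (G z) * exp (- A * Re (w z)) \<le> e / 2 * 1"
      using \<delta>(2)[OF z True] e by (intro mult_mono) auto
    then show ?thesis unfolding nH by simp
  next
    case False
    have "\<delta>\<^sup>2 / 4 \<le> Re (w z)"
      using w_circ[of z] z False \<delta>(1) by (auto simp: w_norm power_divide intro!: divide_right_mono power_mono)
    then have "A * (\<delta>\<^sup>2 / 4) \<le> A * Re (w z)" using A0 by (intro mult_left_mono) auto
    moreover have "A * (\<delta>\<^sup>2 / 4) = ln (M' / (e / 2))" using \<delta>(1) by (simp add: A_def)
    ultimately have "exp (- A * Re (w z)) \<le> exp (- ln (M' / (e / 2)))" by simp
    also have "\<dots> = (e / 2) / M'" using e M' by (simp add: exp_minus field_simps)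
    finally have "cmod (G z) * exp (- A * Re (w z)) \<le> M' * ((e / 2) / M')"
      using bdd[of z] z M' by (intro mult_mono) auto
    then show ?thesis unfolding nH using M' by simp
  qed
  have H_bd: "cmod (H z) \<le> M'" if z: "z \<in> cball 0 1 - {\<zeta>}" for z
  proof -
    have "exp (- A * Re (w z)) \<le> 1" using A0 w_Re[of z] z by simp
    then have "cmod (G z) * exp (- A * Re (w z)) \<le> M' * 1"
      using bdd[OF z] M' by (intro mult_mono) auto
    then show ?thesis unfolding nH by simp
  qed
  have contH: "continuous_on (cball 0 1 - {\<zeta>}) H"
    unfolding H_def w_def by (intro continuous_intros cont) auto
  have holH: "H holomorphic_on ball 0 1"
    unfolding H_def w_def by (intro holomorphic_intros hol) auto
  \<comment> \<open>\<open>H\<close> is merely bounded near \<open>\<zeta>\<close>, but the single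
    factor \<open>w\<close> vanishes there and makes the product continuous on the closed disc.
    Since that factor does not grow with \<open>n\<close>, letting \<open>n\<close> increase gives
    \<open>|H| \<le> e / 2\<close>.\<close>
  have pow: "cmod (H z) ^ n * cmod (w z) \<le> (e / 2) ^ n" if z: "z \<in> ball 0 1" for z n
  proof -
    define \<Psi> where "\<Psi> z = (if z = \<zeta> then 0 else H z ^ n * w z)" for z
    have cont_w: "continuous_on S w" for S unfolding w_def by (intro continuous_intros) auto
    have "cmod (\<Psi> z) \<le> (e / 2) ^ n"
    proof (rule maximum_modulus_frontier[of \<Psi> "cball 0 1" _ z])
      have "(\<lambda>z. H z ^ n * w z) holomorphic_on ball 0 1"
        unfolding w_def by (intro holomorphic_intros holH) auto
      then have "\<Psi> holomorphic_on ball 0 1"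
        by (rule holomorphic_transform) (use \<zeta> in \<open>auto simp: \<Psi>_def\<close>)
      then show "\<Psi> holomorphic_on interior (cball 0 1)" by simp
      have "continuous_on (cball 0 1) \<Psi>"
      proof (rule continuous_on_eq_continuous_within[THEN iffD2], rule ballI)
        fix x assume x: "x \<in> cball (0::complex) 1"
        show "continuous (at x within cball 0 1) \<Psi>"
        proof (cases "x = \<zeta>")
          case True
          have "(\<Psi> \<longlongrightarrow> 0) (at \<zeta> within cball 0 1)"
          proof (rule Lim_null_comparison)
            show "\<forall>\<^sub>F z in at \<zeta> within cball 0 1. cmod (\<Psi> z) \<le> M' ^ n * cmod (w z)"
              unfolding eventually_at_filter
              by (rule always_eventually)
                 (auto simp: \<Psi>_def norm_mult norm_power intro!: mult_right_mono power_mono H_bd)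
            have "((\<lambda>z. M' ^ n * cmod (w z)) \<longlongrightarrow> M' ^ n * cmod (w \<zeta>)) (at \<zeta> within cball 0 1)"
              unfolding w_def by (intro tendsto_intros) auto
            then show "((\<lambda>z. M' ^ n * cmod (w z)) \<longlongrightarrow> 0) (at \<zeta> within cball 0 1)"
              by (simp add: w_norm)
          qed
          then show ?thesis unfolding continuous_within True by (simp add: \<Psi>_def)
        next
          case False
          have "continuous_on (cball 0 1 - {\<zeta>}) (\<lambda>z. H z ^ n * w z)"
            by (intro continuous_intros contH cont_w)
          then have "continuous_on (cball 0 1 - {\<zeta>}) \<Psi>"
            by (rule continuous_on_eq) (auto simp: \<Psi>_def)
          moreover have "x \<in> cball 0 1 - {\<zeta>}" using x False by simp
          ultimately have "continuous (at x within cball 0 1 - {\<zeta>}) \<Psi>"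
            by (simp add: continuous_on_eq_continuous_within)
          moreover have "at x within (cball 0 1 - {\<zeta>}) = at x within cball 0 1"
            by (rule at_within_nhd[of x "- {\<zeta>}"]) (use False in auto)
          ultimately show ?thesis by (simp add: continuous_within)
        qed
      qed
      then show "continuous_on (closure (cball 0 1)) \<Psi>" by simp
      fix x assume "x \<in> frontier (cball (0::complex) 1)"
      then have x: "x \<in> sphere 0 1" by (simp add: frontier_cball)
      show "cmod (\<Psi> x) \<le> (e / 2) ^ n"
      proof (cases "x = \<zeta>")
        case False
        have "cmod (x - \<zeta>) \<le> 2" using norm_triangle_ineq4[of x \<zeta>] x \<zeta> by simp
        then have "cmod (w x) \<le> 1" by (simp add: w_norm)
        moreover have "cmod (H x) ^ n \<le> (e / 2) ^ n" using H_circ[of x] x False by (intro power_mono) auto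
        ultimately have "cmod (H x) ^ n * cmod (w x) \<le> (e / 2) ^ n * 1" using e by (intro mult_mono) auto
        then show ?thesis using False by (simp add: \<Psi>_def norm_mult norm_power)
      qed (use e in \<open>simp add: \<Psi>_def\<close>)
    qed (use z in auto)
    moreover have "z \<noteq> \<zeta>" using z \<zeta> by auto
    ultimately show ?thesis by (simp add: \<Psi>_def norm_mult norm_power)
  qed
  have H_disc: "cmod (H z) \<le> e / 2" if z: "z \<in> ball 0 1" for z
  proof (rule ccontr)
    assume "\<not> cmod (H z) \<le> e / 2"
    then have gt: "1 < cmod (H z) / (e / 2)" using e by simp
    have wz: "cmod (w z) > 0" using z \<zeta> by (auto simp: w_norm)
    obtain n where n: "1 / cmod (w z) < (cmod (H z) / (e / 2)) ^ n"
      using real_arch_pow[OF gt] by blast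
    have "(cmod (H z) / (e / 2)) ^ n * cmod (w z) = cmod (H z) ^ n * cmod (w z) / (e / 2) ^ n"
      by (simp only: power_divide times_divide_eq_left)
    also have "\<dots> \<le> 1" using pow[OF z, of n] e by (simp only: pos_divide_le_eq zero_less_power half_gt_zero mult_1)
    finally show False using n wz by (simp add: pos_divide_less_eq)
  qed
  \<comment> \<open>Undoing the damping costs \<open>exp (A * Re (w z))\<close>; within distance
    \<open>ln 2 / A\<close> of \<open>\<zeta>\<close> this is at most \<open>2\<close>, which turns
    \<open>e / 2\<close> into \<open>e\<close>.\<close>
  show ?thesis
  proof (intro exI[of _ "ln 2 / A"] conjI ballI impI)
    fix z assume z: "z \<in> ball (0::complex) 1" and zz: "cmod (z - \<zeta>) < ln 2 / A"
    have "Re (w z) \<le> cmod (z - \<zeta>)"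
      using complex_Re_le_cmod[of "w z"] unfolding w_norm by (smt (verit) norm_ge_zero field_sum_of_halves)
    then have "A * Re (w z) \<le> A * (ln 2 / A)" using zz A0 by (intro mult_left_mono) auto
    moreover have "A * (ln 2 / A) = ln 2" using A0 by simp
    ultimately have "exp (A * Re (w z)) \<le> exp (ln 2)" by (simp only: exp_le_cancel_iff)
    then have "exp (A * Re (w z)) \<le> 2" by (simp only: exp_ln zero_less_numeral)
    moreover have "cmod (G z) = cmod (H z) * exp (A * Re (w z))"
      by (simp add: nH exp_minus)
    ultimately have "cmod (G z) \<le> e / 2 * 2"
      using H_disc[OF z] e by (simp only:) (intro mult_mono, auto)
    then show "cmod (G z) \<le> e" by simp
  qed (use A0 in simp)
qed

section \<open>Nontangential limits of bounded functions\<close>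

lemma stolz_region_radius:
  assumes "1 < \<alpha>" "0 \<le> r" "r < 1"
  shows "of_real r * cis t \<in> stolz_region \<alpha> t"
proof -
  have "of_real r * cis t - cis t = - (of_real (1 - r) * cis t)" by (simp add: algebra_simps)
  then have "cmod (of_real r * cis t - cis t) = 1 - r"
    using assms by (simp only: norm_minus_cancel norm_mult norm_of_real norm_cis) simp
  then show ?thesis using assms by (simp add: stolz_region_def norm_mult)
qed

lemma nontangential_limit_radial:
  assumes f: "has_nontangential_limit f t l" and r: "\<And>n. 0 \<le> r n" "\<And>n. r n < 1" "r \<longlonglongrightarrow> (1::real)"
  shows "(\<lambda>n. f (of_real (r n) * cis t)) \<longlonglongrightarrow> l"
proof -
  have "(f \<longlongrightarrow> l) (at (cis t) within stolz_region 2 t)"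
    using f by (simp add: has_nontangential_limit_def)
  moreover have "filterlim (\<lambda>n. of_real (r n) * cis t) (at (cis t) within stolz_region 2 t) sequentially"
    unfolding filterlim_at
  proof (intro conjI always_eventually allI)
    show "of_real (r n) * cis t \<in> stolz_region 2 t" for n
      using r by (intro stolz_region_radius) auto
    show "of_real (r n) * cis t \<noteq> cis t" for n
      using r(2)[of n] by (metis mult_cancel_right1 cis_neq_zero of_real_eq_1_iff order_less_irrefl)
    show "(\<lambda>n. of_real (r n) * cis t) \<longlonglongrightarrow> cis t"
      using tendsto_mult[OF tendsto_of_real[OF r(3)] tendsto_const[of "cis t"]] by simp
  qed
  ultimately show ?thesis by (rule filterlim_compose)
qed

text \<open>The radius ending at \<open>cis t\<close> runs inside every Stolz region, so the limit
  is never vacuous. This justifies the \<open>THE\<close> in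
  \<open>boundary_function\<close>.\<close>

lemma nontangential_limit_unique:
  assumes "has_nontangential_limit f t l" "has_nontangential_limit f t m"
  shows "l = m"
proof -
  define r where "r n = real n / real (Suc n)" for n
  have "0 \<le> r n" "r n < 1" for n by (auto simp: r_def)
  moreover have "r \<longlonglongrightarrow> 1" unfolding r_def by (rule LIMSEQ_n_over_Suc_n)
  ultimately show ?thesis
    using nontangential_limit_radial[OF assms(1)] nontangential_limit_radial[OF assms(2)] LIMSEQ_unique by metis
qed

lemma boundary_function_eq:
  assumes "has_nontangential_limit f t l"
  shows "boundary_function f t = l"
  unfolding boundary_function_def
  using assms nontangential_limit_unique by (intro the_equality) auto

lemma nontangential_limit_imp_boundary_function:
  "\<exists>l. has_nontangential_limit f t l \<Longrightarrow> has_nontangential_limit f t (boundary_function f t)"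
  using boundary_function_eq by metis

lemma has_nontangential_limit_divide:
  assumes "has_nontangential_limit f t l" "has_nontangential_limit g t m" "m \<noteq> 0"
  shows "has_nontangential_limit (\<lambda>z. f z / g z) t (l / m)"
  using assms unfolding has_nontangential_limit_def by (auto intro!: tendsto_divide)

lemma has_nontangential_limit_cong:
  assumes "has_nontangential_limit f t l" "\<And>z. z \<in> ball 0 1 \<Longrightarrow> f z = g z"
  shows "has_nontangential_limit g t l"
  unfolding has_nontangential_limit_def
proof (intro allI impI)
  fix \<alpha> :: real assume "\<alpha> > 1"
  then have "(f \<longlongrightarrow> l) (at (cis t) within stolz_region \<alpha> t)"
    using assms by (simp add: has_nontangential_limit_def)
  moreover have "\<forall>\<^sub>F z in at (cis t) within stolz_region \<alpha> t. f z = g z"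
    unfolding eventually_at_filter by (rule always_eventually) (auto simp: stolz_region_def assms(2))
  ultimately show "(g \<longlongrightarrow> l) (at (cis t) within stolz_region \<alpha> t)"
    by (rule Lim_transform_eventually)
qed

lemma bounded_holomorphic_lipschitz_primitive:
  assumes f: "f holomorphic_on ball 0 1" and K: "\<And>z. z \<in> ball 0 1 \<Longrightarrow> cmod (f z) \<le> K"
  obtains g where "\<And>z. z \<in> ball 0 1 \<Longrightarrow> (g has_field_derivative f z) (at z)" "K-lipschitz_on (cball 0 1) g"
proof -
  obtain h where h: "\<And>z. z \<in> ball 0 1 \<Longrightarrow> (h has_field_derivative f z) (at z within ball 0 1)"
    using holomorphic_convex_primitive'[OF convex_ball open_ball f] by metis
  have K0: "0 \<le> K" using K[of 0] norm_ge_zero[of "f 0"] by (simp del: norm_ge_zero)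
  have "K-lipschitz_on (ball 0 1) h"
  proof (rule lipschitz_onI)
    fix x y :: complex assume "x \<in> ball 0 1" "y \<in> ball 0 1"
    then show "dist (h x) (h y) \<le> K * dist x y"
      unfolding dist_norm by (intro field_differentiable_bound[OF convex_ball h K]) auto
  qed fact
  then obtain g where g: "K-lipschitz_on (closure (ball 0 1)) g" "\<And>x. x \<in> ball 0 1 \<Longrightarrow> g x = h x"
    using lipschitz_extend_closure by blast
  have "(g has_field_derivative f z) (at z)" if z: "z \<in> ball 0 1" for z
  proof -
    have "(h has_field_derivative f z) (at z)"
      using h[OF z] at_within_open[OF z open_ball] by simp
    then show ?thesis
      by (rule has_field_derivative_transform_within_open[OF _ open_ball z]) (simp add: g(2))
  qed
  with g(1) show ?thesis by (intro that[of g]) auto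
qed

text \<open>Dividing the quotient in the angle by that of \<open>cis\<close>, whose limit is
  \<open>\<i> * cis t\<close>, converts it into the quotient in \<open>z\<close>. The angle is
  recovered as \<open>Arg (z / cis t)\<close>, with argument near \<open>1\<close> and so away from
  the branch cut.\<close>

lemma circle_difference_quotient:
  fixes g :: "complex \<Rightarrow> complex"
  assumes lim: "((\<lambda>h. (g (cis (t + h)) - g (cis t)) / of_real h) \<longlongrightarrow> D) (at 0)" and e: "e > 0"
  shows "\<exists>\<delta>>0. \<forall>z\<in>sphere 0 1 - {cis t}. cmod (z - cis t) < \<delta> \<longrightarrow>
    cmod ((g z - g (cis t)) / (z - cis t) - D / (\<i> * cis t)) \<le> e"
proof -
  define \<zeta> where "\<zeta> = cis t"
  define S where "S = sphere (0::complex) 1 - {\<zeta>}"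
  have "((\<lambda>h. (cis (t + h) - cis t) / of_real h) \<longlongrightarrow> \<i> * cis t) (at 0)"
    unfolding tendsto_complex_iff
    using DERIV_cos[of t, unfolded DERIV_def] DERIV_sin[of t, unfolded DERIV_def] by simp
  from tendsto_divide[OF lim this]
  have q: "((\<lambda>h. (g (cis (t + h)) - g (cis t)) / of_real h / ((cis (t + h) - cis t) / of_real h)) \<longlongrightarrow> D / (\<i> * cis t)) (at 0)"
    by simp
  have q': "((\<lambda>h. (g (cis (t + h)) - g (cis t)) / (cis (t + h) - cis t)) \<longlongrightarrow> D / (\<i> * cis t)) (at 0)"
    by (rule Lim_transform_eventually[OF q]) (auto simp: eventually_at_filter)
  have cisA: "cis (t + Arg (z / \<zeta>)) = z" if "z \<in> S" for z
  proof -
    have "z / \<zeta> \<noteq> 0" using that by (auto simp: S_def \<zeta>_def)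
    moreover have "cmod (z / \<zeta>) = 1" using that by (simp add: S_def \<zeta>_def norm_divide)
    ultimately have "cis (Arg (z / \<zeta>)) = z / \<zeta>" by (simp add: cis_Arg sgn_div_norm)
    then show ?thesis by (simp add: \<zeta>_def flip: cis_mult)
  qed
  have "filterlim (\<lambda>z. Arg (z / \<zeta>)) (at 0) (at \<zeta> within S)"
    unfolding filterlim_at
  proof
    show "((\<lambda>z. Arg (z / \<zeta>)) \<longlongrightarrow> 0) (at \<zeta> within S)"
    proof -
      have "((\<lambda>z. Arg (z / \<zeta>)) \<longlongrightarrow> Arg (\<zeta> / \<zeta>)) (at \<zeta> within S)"
        by (intro tendsto_Arg tendsto_intros) (auto simp: \<zeta>_def)
      then show ?thesis by (simp add: \<zeta>_def)
    qed
    have "Arg (z / \<zeta>) \<noteq> 0" if "z \<in> S" for z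
      using cisA[OF that] that by (auto simp: S_def \<zeta>_def)
    then show "\<forall>\<^sub>F z in at \<zeta> within S. Arg (z / \<zeta>) \<in> UNIV \<and> Arg (z / \<zeta>) \<noteq> 0"
      unfolding eventually_at_filter by (intro always_eventually) auto
  qed
  from filterlim_compose[OF q' this]
  have "((\<lambda>z. (g (cis (t + Arg (z / \<zeta>))) - g (cis t)) / (cis (t + Arg (z / \<zeta>)) - cis t)) \<longlongrightarrow> D / (\<i> * cis t)) (at \<zeta> within S)" .
  then have "((\<lambda>z. (g z - g (cis t)) / (z - cis t)) \<longlongrightarrow> D / (\<i> * cis t)) (at \<zeta> within S)"
    by (rule Lim_transform_eventually) (auto simp: eventually_at_filter cisA)
  then show ?thesis
    using e unfolding Lim_within S_def \<zeta>_def dist_norm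
    by (smt (verit, best) DiffE insertI1 zero_less_norm_iff right_minus_eq)
qed

text \<open>Cauchy's inequality recovers \<open>f\<close> from its primitive: the remainder
  \<open>R\<close> is small compared with \<open>|w - \<zeta>|\<close>, and in a Stolz region a disc
  about \<open>z\<close> of radius comparable to \<open>|z - \<zeta>|\<close> fits into the unit
  disc, so the derivative \<open>f - c\<close> of \<open>R\<close> is small at
  \<open>z\<close>.\<close>

lemma primitive_difference_quotient_nontangential:
  fixes f g :: "complex \<Rightarrow> complex"
  assumes g: "\<And>z. z \<in> ball 0 1 \<Longrightarrow> (g has_field_derivative f z) (at z)"
    and lim: "\<And>e. e > 0 \<Longrightarrow> \<exists>\<delta>>0. \<forall>z\<in>ball 0 1. cmod (z - cis t) < \<delta> \<longrightarrow>
      cmod ((g z - g (cis t)) / (z - cis t) - c) \<le> e"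
  shows "has_nontangential_limit f t c"
  unfolding has_nontangential_limit_def
proof (intro allI impI)
  fix \<alpha> :: real assume \<alpha>: "\<alpha> > 1"
  define \<zeta> where "\<zeta> = cis t"
  show "(f \<longlongrightarrow> c) (at (cis t) within stolz_region \<alpha> t)"
    unfolding Lim_within
  proof (intro allI impI)
    fix e :: real assume e: "e > 0"
    \<comment> \<open>Chosen so that the final Cauchy estimate
      \<open>\<epsilon> * (2 * (\<alpha> + 1))\<close> equals \<open>e / 2\<close>.\<close>
    define \<epsilon> where "\<epsilon> = e / (4 * (\<alpha> + 1))"
    have \<epsilon>: "\<epsilon> > 0" using e \<alpha> by (simp add: \<epsilon>_def)
    obtain \<delta> where \<delta>: "\<delta> > 0" "\<And>z. z \<in> ball 0 1 \<Longrightarrow> cmod (z - \<zeta>) < \<delta> \<Longrightarrow> cmod ((g z - g \<zeta>) / (z - \<zeta>) - c) \<le> \<epsilon>"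
      using lim[OF \<epsilon>] unfolding \<zeta>_def by auto
    show "\<exists>d>0. \<forall>x\<in>stolz_region \<alpha> t. 0 < dist x (cis t) \<and> dist x (cis t) < d \<longrightarrow> dist (f x) c < e"
    proof (intro exI[of _ "\<delta> / 2"] conjI ballI impI)
      fix z assume zS: "z \<in> stolz_region \<alpha> t" and zd: "0 < dist z (cis t) \<and> dist z (cis t) < \<delta> / 2"
      \<comment> \<open>Half the distance from \<open>z\<close> to the circle: the closed disc of
        radius \<open>h\<close> stays inside, and on it
        \<open>|w - \<zeta>| \<le> h + 2 * \<alpha> * h\<close>, whence the factor
        \<open>2 * (\<alpha> + 1)\<close> below.\<close>
      define h where "h = (1 - cmod z) / 2"
      have "2 * h = 1 - cmod z" by (simp add: h_def)
      then have z: "cmod z < 1" "cmod (z - \<zeta>) < \<alpha> * (2 * h)" "cmod (z - \<zeta>) < \<delta> / 2"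
        using zS zd by (auto simp: stolz_region_def \<zeta>_def dist_norm)
      have h: "h > 0" using z by (simp add: h_def)
      have h2: "2 * h \<le> cmod (z - \<zeta>)"
        using norm_triangle_ineq2[of \<zeta> z] by (simp add: h_def \<zeta>_def norm_minus_commute)
      define R where "R w = g w - g \<zeta> - c * (w - \<zeta>)" for w
      have inb: "w \<in> ball 0 1" if "cmod (w - z) \<le> h" for w
        using norm_triangle_ineq[of "w - z" z] that h by (simp add: h_def)
      have dR: "(R has_field_derivative f w - c) (at w)" if "w \<in> ball 0 1" for w
        unfolding R_def by (rule derivative_eq_intros g[OF that] refl)+ simp
      have bR: "cmod (R w) \<le> \<epsilon> * (2 * (\<alpha> + 1) * h)" if w: "cmod (w - z) \<le> h" for w
      proof -
        have wz: "cmod (w - \<zeta>) \<le> h + cmod (z - \<zeta>)"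
          using norm_triangle_ineq[of "w - z" "z - \<zeta>"] w by simp
        have "w \<noteq> \<zeta>" using inb[OF w] by (auto simp: \<zeta>_def)
        then have "R w = ((g w - g \<zeta>) / (w - \<zeta>) - c) * (w - \<zeta>)"
          unfolding R_def left_diff_distrib[of "(g w - g \<zeta>) / (w - \<zeta>)"] by simp
        then have "cmod (R w) = cmod ((g w - g \<zeta>) / (w - \<zeta>) - c) * cmod (w - \<zeta>)"
          by (simp only: norm_mult)
        also have "\<dots> \<le> \<epsilon> * cmod (w - \<zeta>)"
        proof -
          have "cmod (w - \<zeta>) < \<delta>"
            using wz h2 z(3) h by linarith
          then show ?thesis
            by (intro mult_right_mono \<delta>(2) inb[OF w]) auto
        qed
        also have "\<dots> \<le> \<epsilon> * (2 * (\<alpha> + 1) * h)"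
        proof (rule mult_left_mono)
          have "h \<le> 2 * h" using h by simp
          then show "cmod (w - \<zeta>) \<le> 2 * (\<alpha> + 1) * h"
            using wz z(2) by (simp add: algebra_simps)
        qed (use \<epsilon> in simp)
        finally show ?thesis .
      qed
      have holR: "R holomorphic_on ball 0 1"
        unfolding holomorphic_on_open[OF open_ball] using dR by blast
      have "cmod ((deriv ^^ 1) R z) \<le> fact 1 * (\<epsilon> * (2 * (\<alpha> + 1) * h)) / h ^ 1"
      proof (rule Cauchy_inequality)
        have sub: "cball z h \<subseteq> ball 0 1"
          using inb by (auto simp: dist_norm norm_minus_commute)
        show "R holomorphic_on ball z h"
          by (rule holomorphic_on_subset[OF holR]) (use sub ball_subset_cball in blast)
        show "continuous_on (cball z h) R"
          by (rule continuous_on_subset[OF holomorphic_on_imp_continuous_on[OF holR] sub])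
        show "cmod (R x) \<le> \<epsilon> * (2 * (\<alpha> + 1) * h)" if "cmod (z - x) = h" for x
          using bR[of x] that by (simp add: norm_minus_commute)
      qed (rule h)
      moreover have "deriv R z = f z - c"
        using dR[of z] z by (intro DERIV_imp_deriv) auto
      ultimately have "cmod (f z - c) \<le> \<epsilon> * (2 * (\<alpha> + 1))"
        using h by simp
      also have "\<dots> = e / 2" using \<alpha> by (simp add: \<epsilon>_def field_simps)
      also have "\<dots> < e" using e by simp
      finally show "dist (f z) c < e" by (simp add: dist_norm)
    qed (use \<delta> in simp)
  qed
qed

theorem Fatou_bounded:
  assumes f: "f holomorphic_on ball 0 1" and K: "\<And>z. z \<in> ball 0 1 \<Longrightarrow> cmod (f z) \<le> K"
  shows "AE t in lebesgue_on {0..2*pi}. \<exists>l. has_nontangential_limit f t l"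
proof -
  obtain g where g: "\<And>z. z \<in> ball 0 1 \<Longrightarrow> (g has_field_derivative f z) (at z)" and L: "K-lipschitz_on (cball 0 1) g"
    using bounded_holomorphic_lipschitz_primitive[OF f K] by metis
  have K0: "0 \<le> K" using L by (rule lipschitz_on_nonneg)
  have gl: "cmod (g x - g y) \<le> K * cmod (x - y)" if "x \<in> cball 0 1" "y \<in> cball 0 1" for x y
    using lipschitz_onD[OF L that] by (simp add: dist_norm)
  have "cmod (g (cis y) - g (cis x)) \<le> K * \<bar>y - x\<bar>" for x y
    using gl[of "cis y" "cis x"] mult_left_mono[OF cmod_cis_diff_le[of y x] K0] by simp
  from negligible_not_derivative_lipschitz_complex[of "\<lambda>t. g (cis t)", OF this]
  obtain N where N: "negligible N"
    "\<And>t. t \<notin> N \<Longrightarrow> \<exists>D. ((\<lambda>h. (g (cis (t + h)) - g (cis t)) / of_real h) \<longlongrightarrow> D) (at 0)" by blast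
  have "\<exists>l. has_nontangential_limit f t l" if t: "t \<notin> N" for t
  proof -
    from N(2)[OF t] obtain D where D: "((\<lambda>h. (g (cis (t + h)) - g (cis t)) / of_real h) \<longlongrightarrow> D) (at 0)"
      by (elim exE)
    define c where "c = D / (\<i> * cis t)"
    define G where "G z = (g z - g (cis t)) / (z - cis t) - c" for z
    have "has_nontangential_limit f t c"
    proof (rule primitive_difference_quotient_nontangential[OF g])
      fix e :: real assume e: "e > 0"
      have "\<exists>\<delta>>0. \<forall>z\<in>ball 0 1. cmod (z - cis t) < \<delta> \<longrightarrow> cmod (G z) \<le> e"
      proof (rule limit_from_circle_imp_limit_in_disc)
        show "continuous_on (cball 0 1 - {cis t}) G"
          unfolding G_def
          by (intro continuous_intros continuous_on_subset[OF lipschitz_on_continuous_on[OF L]]) auto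
        have "g holomorphic_on ball 0 1"
          unfolding holomorphic_on_open[OF open_ball] using g by blast
        then show "G holomorphic_on ball 0 1"
          unfolding G_def by (intro holomorphic_intros) auto
        \<comment> \<open>Boundedness up to the circle, required for the Phragmen-Lindelof step,
          comes from the Lipschitz constant of the primitive.\<close>
        show "cmod (G z) \<le> K + cmod c" if z: "z \<in> cball 0 1 - {cis t}" for z
        proof -
          have "cmod ((g z - g (cis t)) / (z - cis t)) \<le> K"
            using gl[of z "cis t"] z by (simp add: norm_divide pos_divide_le_eq)
          then show ?thesis unfolding G_def using norm_triangle_ineq4[of "(g z - g (cis t)) / (z - cis t)" c] by linarith
        qed
        show "cmod (cis t) = 1" by simp
        show "\<exists>\<delta>>0. \<forall>z\<in>sphere 0 1 - {cis t}. cmod (z - cis t) < \<delta> \<longrightarrow> cmod (G z) \<le> e" if "e > 0" for e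
          unfolding G_def c_def by (rule circle_difference_quotient[OF D that])
      qed (rule e)
      then show "\<exists>\<delta>>0. \<forall>z\<in>ball 0 1. cmod (z - cis t) < \<delta> \<longrightarrow> cmod ((g z - g (cis t)) / (z - cis t) - c) \<le> e"
        unfolding G_def .
    qed
    then show ?thesis by blast
  qed
  then have "AE t in lebesgue. \<exists>l. has_nontangential_limit f t l"
    using N(1) by (intro AE_I'[of N]) (auto simp: negligible_iff_null_sets)
  then have "AE t in lebesgue. t \<in> {0..2*pi} \<longrightarrow> (\<exists>l. has_nontangential_limit f t l)"
    by (rule eventually_mono) simp
  then show ?thesis
    by (subst AE_restrict_space_iff) simp_all
qed

section \<open>Logarithmic means\<close>

text \<open>Fatou's lemma for Bochner integrals: a uniform bound on the integrals takes the place of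
  a dominating function.\<close>

lemma (in finite_measure) integral_limit_le:
  fixes a :: "nat \<Rightarrow> 'a \<Rightarrow> real"
  assumes a: "\<And>n. integrable M (a n)" "\<And>n. AE x in M. 0 \<le> a n x" "\<And>n. integral\<^sup>L M (a n) \<le> K"
    and lim: "AE x in M. (\<lambda>n. a n x) \<longlonglongrightarrow> b x" and b: "b \<in> borel_measurable M"
  shows "integrable M b" "integral\<^sup>L M b \<le> K"
proof -
  have "AE x in M. \<forall>n. 0 \<le> a n x" using a(2) by (simp add: AE_all_countable)
  with lim have b0: "AE x in M. 0 \<le> b x"
    by eventually_elim (blast intro: LIMSEQ_le_const)
  have [measurable]: "a n \<in> borel_measurable M" for n using a(1) by auto
  note b[measurable]
  have le: "(\<integral>\<^sup>+x. ennreal (a n x) \<partial>M) \<le> ennreal K" for n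
    using nn_integral_eq_integral[OF a(1,2)] a(3) by (simp add: ennreal_leI)
  have K0: "0 \<le> K"
    using integral_nonneg_AE[OF a(2)[of 0]] a(3)[of 0] by linarith
  have "(\<integral>\<^sup>+x. ennreal (b x) \<partial>M) = (\<integral>\<^sup>+x. liminf (\<lambda>n. ennreal (a n x)) \<partial>M)"
  proof (rule nn_integral_cong_AE)
    show "AE x in M. ennreal (b x) = liminf (\<lambda>n. ennreal (a n x))"
      using lim
    proof eventually_elim
      case (elim x)
      then have "(\<lambda>n. ennreal (a n x)) \<longlonglongrightarrow> ennreal (b x)" by (rule tendsto_ennrealI)
      then show ?case by (rule lim_imp_Liminf[OF sequentially_bot, symmetric])
    qed
  qed
  also have "\<dots> \<le> liminf (\<lambda>n. \<integral>\<^sup>+x. ennreal (a n x) \<partial>M)"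
    by (rule nn_integral_liminf) simp
  also have "\<dots> \<le> ennreal K"
    by (rule Liminf_le) (auto intro!: always_eventually le)
  finally have *: "(\<integral>\<^sup>+x. ennreal (b x) \<partial>M) \<le> ennreal K" .
  then show ib: "integrable M b"
    by (intro integrableI_nonneg b b0) (auto simp: less_top[symmetric] top_unique)
  have "ennreal (integral\<^sup>L M b) \<le> ennreal K"
    using * nn_integral_eq_integral[OF ib b0] by simp
  then show "integral\<^sup>L M b \<le> K" using K0 by simp
qed

lemma abs_ln_max_le:
  fixes x d :: real
  assumes "0 < d" "0 \<le> x"
  shows "\<bar>ln (max x d)\<bar> \<le> \<bar>ln d\<bar> + x"
proof -
  have "ln d \<le> ln (max x d)" using assms by simp
  moreover have "ln (max x d) \<le> \<bar>ln d\<bar> + x"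
    using ln_bound[of x] assms by (auto simp: max_def)
  ultimately show ?thesis using assms by linarith
qed

lemma (in finite_measure) integrable_ln_max:
  fixes a :: "'a \<Rightarrow> real"
  assumes a: "integrable M a" "AE x in M. 0 \<le> a x" and d: "0 < d"
  shows "integrable M (\<lambda>x. ln (max (a x) d))"
proof (rule Bochner_Integration.integrable_bound)
  show "integrable M (\<lambda>x. \<bar>ln d\<bar> + a x)" using a(1) by simp
  have [measurable]: "a \<in> borel_measurable M" using a(1) by auto
  show "(\<lambda>x. ln (max (a x) d)) \<in> borel_measurable M" by measurable
  show "AE x in M. norm (ln (max (a x) d)) \<le> norm (\<bar>ln d\<bar> + a x)"
    using a(2) by eventually_elim (use abs_ln_max_le[OF d] in auto)
qed

text \<open>The logarithm grows more slowly than the identity, so bounded integrals make the upper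
  tails of \<open>ln (max a d)\<close> uniformly small, while \<open>d\<close> bounds it from below.
  Cutting at height \<open>T\<close> leaves bounded functions, to which dominated convergence
  applies.\<close>

lemma (in finite_measure) integral_ln_max_tendsto:
  fixes a :: "nat \<Rightarrow> 'a \<Rightarrow> real"
  assumes a: "\<And>n. integrable M (a n)" "\<And>n. AE x in M. 0 \<le> a n x" "\<And>n. integral\<^sup>L M (a n) \<le> K"
    and lim: "AE x in M. (\<lambda>n. a n x) \<longlonglongrightarrow> b x" and b: "b \<in> borel_measurable M" and d: "0 < d"
  shows "(\<lambda>n. \<integral>x. ln (max (a n x) d) \<partial>M) \<longlonglongrightarrow> (\<integral>x. ln (max (b x) d) \<partial>M)"
proof (rule LIMSEQ_I)
  fix e :: real assume e: "e > 0"
  have ib: "integrable M b" "integral\<^sup>L M b \<le> K"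
    using integral_limit_le[OF a lim b] by auto
  have "AE x in M. \<forall>n. 0 \<le> a n x" using a(2) by (simp add: AE_all_countable)
  with lim have b0: "AE x in M. 0 \<le> b x"
    by eventually_elim (blast intro: LIMSEQ_le_const)
  have K0: "0 \<le> K"
    using integral_nonneg_AE[OF a(2)[of 0]] a(3)[of 0] by linarith
  have [measurable]: "a n \<in> borel_measurable M" for n using a(1) by auto
  note b[measurable]
  \<comment> \<open>By \<open>ln y \<le> y\<close> at \<open>y = exp (- T) * x\<close>, the part
    above \<open>T\<close> costs at most \<open>exp (- T) * K\<close>. The \<open>+ 1\<close> keeps
    the argument of the logarithm positive when \<open>K = 0\<close>.\<close>
  define T where "T = max (ln d) (ln ((3 * K + 1) / e))"
  have T: "ln d \<le> T" "exp (- T) * K < e / 3"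
  proof -
    have "exp (- T) \<le> exp (- ln ((3 * K + 1) / e))" by (simp add: T_def)
    also have "\<dots> = e / (3 * K + 1)" using e K0 by (simp add: exp_minus)
    finally have "exp (- T) * K \<le> e / (3 * K + 1) * K" using K0 by (rule mult_right_mono)
    also have "\<dots> < e / 3" using e K0 by (simp add: field_simps)
    finally show "exp (- T) * K < e / 3" .
  qed (simp add: T_def)
  define g where "g x = min (ln (max x d)) T" for x
  have gle: "\<bar>ln (max x d) - g x\<bar> \<le> exp (- T) * x" if x: "0 \<le> x" for x
  proof (cases "ln (max x d) \<le> T")
    case False
    then have "T < ln (max x d)" by simp
    with T(1) have xd: "d < x" by (cases "x \<le> d") (auto simp: max_def)
    then have "\<bar>ln (max x d) - g x\<bar> = ln x - T"
      using False by (simp add: g_def max_def)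
    also have "\<dots> = ln (exp (- T) * x)" using xd d by (simp add: ln_mult)
    also have "\<dots> \<le> exp (- T) * x" using xd d by (intro ln_bound) auto
    finally show ?thesis .
  qed (use x in \<open>simp add: g_def\<close>)
  have gb: "\<bar>g x\<bar> \<le> \<bar>T\<bar> + \<bar>ln d\<bar>" for x
  proof -
    have "ln d \<le> ln (max x d)" using d by simp
    then have "ln d \<le> g x" "g x \<le> T" using T(1) by (auto simp: g_def)
    then show ?thesis by linarith
  qed
  have [measurable]: "g \<in> borel_measurable borel" unfolding g_def by measurable
  have ig: "integrable M (\<lambda>x. g (c x))" if [measurable]: "c \<in> borel_measurable M" for c
    by (rule integrable_const_bound[where B = "\<bar>T\<bar> + \<bar>ln d\<bar>"]) (use gb in auto)
  have "(\<lambda>n. \<integral>x. g (a n x) \<partial>M) \<longlonglongrightarrow> (\<integral>x. g (b x) \<partial>M)"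
  proof (rule integral_dominated_convergence[where w = "\<lambda>_. \<bar>T\<bar> + \<bar>ln d\<bar>"])
    have "isCont g x" for x
      unfolding g_def using d by (intro continuous_intros) (auto simp: max_def)
    then show "AE x in M. (\<lambda>n. g (a n x)) \<longlonglongrightarrow> g (b x)"
      using lim by (auto elim!: eventually_mono intro: isCont_tendsto_compose)
  qed (use gb in auto)
  then obtain N where N: "\<And>n. n \<ge> N \<Longrightarrow> \<bar>(\<integral>x. g (a n x) \<partial>M) - (\<integral>x. g (b x) \<partial>M)\<bar> < e / 3"
    using LIMSEQ_D[of _ _ "e/3"] e by (metis divide_pos_pos real_norm_def zero_less_numeral)
  have diff: "\<bar>(\<integral>x. ln (max (c x) d) \<partial>M) - (\<integral>x. g (c x) \<partial>M)\<bar> < e / 3"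
    if c: "integrable M c" "AE x in M. 0 \<le> c x" "integral\<^sup>L M c \<le> K" for c
  proof -
    have [measurable]: "c \<in> borel_measurable M" using c(1) by auto
    have i1: "integrable M (\<lambda>x. ln (max (c x) d))" by (rule integrable_ln_max[OF c(1,2) d])
    have "\<bar>(\<integral>x. ln (max (c x) d) \<partial>M) - (\<integral>x. g (c x) \<partial>M)\<bar> = \<bar>\<integral>x. ln (max (c x) d) - g (c x) \<partial>M\<bar>"
      using i1 ig by simp
    also have "\<dots> \<le> (\<integral>x. \<bar>ln (max (c x) d) - g (c x)\<bar> \<partial>M)"
      by (rule integral_abs_bound)
    also have "\<dots> \<le> (\<integral>x. exp (- T) * c x \<partial>M)"
      by (rule integral_mono_AE) (use c i1 ig gle in \<open>auto elim!: eventually_mono\<close>)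
    also have "\<dots> \<le> exp (- T) * K" using c(3) by simp
    finally show ?thesis using T(2) by linarith
  qed
  show "\<exists>no. \<forall>n\<ge>no. norm ((\<integral>x. ln (max (a n x) d) \<partial>M) - (\<integral>x. ln (max (b x) d) \<partial>M)) < e"
  proof (intro exI allI impI)
    fix n assume "N \<le> n"
    from N[OF this] diff[OF a(1,2,3), of n] diff[OF ib(1) b0 ib(2)]
    show "norm ((\<integral>x. ln (max (a n x) d) \<partial>M) - (\<integral>x. ln (max (b x) d) \<partial>M)) < e"
      unfolding real_norm_def by linarith
  qed
qed

text \<open>A zero set of positive measure would drive the truncated integrals to minus infinity,
  against the uniform bound \<open>c\<close>; the same bound yields integrability by monotone
  convergence.\<close>

lemma (in finite_measure) integral_ln_max_bounded_below:
  fixes b :: "'a \<Rightarrow> real"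
  assumes b: "integrable M b" "AE x in M. 0 \<le> b x"
    and c: "\<And>d. 0 < d \<Longrightarrow> d \<le> 1 \<Longrightarrow> c \<le> (\<integral>x. ln (max (b x) d) \<partial>M)"
  shows "AE x in M. 0 < b x" "integrable M (\<lambda>x. ln (b x))"
    "(\<lambda>k. \<integral>x. ln (max (b x) (1 / real (Suc k))) \<partial>M) \<longlonglongrightarrow> (\<integral>x. ln (b x) \<partial>M)"
proof -
  have [measurable]: "b \<in> borel_measurable M" using b(1) by auto
  define E where "E = {x \<in> space M. b x = 0}"
  have [measurable]: "E \<in> sets M" unfolding E_def by measurable
  define d where "d k = 1 / real (Suc k)" for k
  have d: "0 < d k" "d k \<le> 1" for k by (auto simp: d_def divide_simps)
  have i1: "integrable M (\<lambda>x. ln (max (b x) 1))" by (rule integrable_ln_max[OF b]) simp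
  have id: "integrable M (\<lambda>x. ln (max (b x) (d k)))" for k by (rule integrable_ln_max[OF b d(1)])
  have iE: "integrable M (indicator E :: 'a \<Rightarrow> real)" by (simp add: less_top[symmetric])
  have bnd: "- ln r * measure M E \<le> (\<integral>x. ln (max (b x) 1) \<partial>M) - c" if r: "0 < r" "r \<le> 1" for r
  proof -
    have "c \<le> (\<integral>x. ln (max (b x) r) \<partial>M)" by (rule c[OF r])
    also have "\<dots> \<le> (\<integral>x. ln (max (b x) 1) + ln r * indicator E x \<partial>M)"
    proof (rule integral_mono_AE)
      show "integrable M (\<lambda>x. ln (max (b x) r))" by (rule integrable_ln_max[OF b r(1)])
      show "integrable M (\<lambda>x. ln (max (b x) 1) + ln r * indicator E x)" using i1 iE by simp
      show "AE x in M. ln (max (b x) r) \<le> ln (max (b x) 1) + ln r * indicator E x"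
        using r by (intro AE_I2) (auto simp: E_def indicator_def max_def)
    qed
    also have "\<dots> = (\<integral>x. ln (max (b x) 1) \<partial>M) + ln r * measure M E"
      using i1 iE by simp
    finally show ?thesis by simp
  qed
  have "measure M E = 0"
  proof (rule ccontr)
    assume "measure M E \<noteq> 0"
    then have m: "measure M E > 0" using measure_nonneg[of M E] by linarith
    define C where "C = (\<integral>x. ln (max (b x) 1) \<partial>M) - c"
    \<comment> \<open>Solves \<open>- ln r * measure M E = |C| + 1\<close>, a value exceeding the
      bound \<open>C\<close> from \<open>bnd\<close>.\<close>
    define r where "r = exp (- (\<bar>C\<bar> + 1) / measure M E)"
    have "0 < r" "r \<le> 1" using m by (auto simp: r_def divide_le_0_iff)
    from bnd[OF this] have "- ln r * measure M E \<le> C" by (simp only: C_def)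
    moreover have "ln r = - (\<bar>C\<bar> + 1) / measure M E" by (simp only: r_def ln_exp)
    then have "- ln r * measure M E = \<bar>C\<bar> + 1" using m by simp
    ultimately show False by linarith
  qed
  then have "E \<in> null_sets M" by (intro null_setsI) (simp_all add: emeasure_eq_measure)
  then have "AE x in M. x \<notin> E" by (rule AE_not_in)
  with b(2) show pos: "AE x in M. 0 < b x"
    by (rule AE_mp[OF AE_conjI]) (auto simp: E_def intro!: AE_I2)
  \<comment> \<open>The truncated logarithms decrease with \<open>k\<close> and have no sign;
    subtracted from the integrable \<open>ln (max (b x) 1)\<close> they become nonnegative and
    increasing.\<close>
  define h where "h k x = ln (max (b x) 1) - ln (max (b x) (d k))" for k x
  have ih: "integrable M (h k)" for k unfolding h_def using i1 id by simp
  have dmono: "d n \<le> d m" if "m \<le> n" for m n using that by (simp add: d_def frac_le)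
  have hmono: "mono (\<lambda>k. h k x)" for x
  proof (rule monoI)
    fix m n :: nat assume "m \<le> n"
    then have "max (b x) (d n) \<le> max (b x) (d m)" using dmono by (intro max.mono) auto
    moreover have "0 < max (b x) (d n)" "0 < max (b x) (d m)" using d by (simp_all add: less_max_iff_disj)
    ultimately have "ln (max (b x) (d n)) \<le> ln (max (b x) (d m))" by (simp only: ln_le_cancel_iff)
    then show "h m x \<le> h n x" by (simp add: h_def)
  qed
  have h0: "0 \<le> h k x" for k x
  proof -
    have "max (b x) (d k) \<le> max (b x) 1" using d[of k] by (intro max.mono) auto
    moreover have "0 < max (b x) (d k)" "0 < max (b x) 1" using d[of k] by (simp_all add: less_max_iff_disj)
    ultimately have "ln (max (b x) (d k)) \<le> ln (max (b x) 1)" by (simp only: ln_le_cancel_iff)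
    then show ?thesis by (simp add: h_def)
  qed
  have "incseq (\<lambda>k. integral\<^sup>L M (h k))"
    by (intro monoI integral_mono ih) (use hmono in \<open>auto dest: monoD\<close>)
  moreover have "integral\<^sup>L M (h k) \<le> (\<integral>x. ln (max (b x) 1) \<partial>M) - c" for k
    using c[OF d, of k] i1 id[of k] unfolding h_def by simp
  ultimately obtain L where L: "(\<lambda>k. integral\<^sup>L M (h k)) \<longlonglongrightarrow> L"
    using incseq_convergent[of "\<lambda>k. integral\<^sup>L M (h k)"] by blast
  have d0: "d \<longlonglongrightarrow> 0" unfolding d_def using LIMSEQ_inverse_real_of_nat by (simp add: inverse_eq_divide)
  have hlim: "AE x in M. (\<lambda>k. h k x) \<longlonglongrightarrow> ln (max (b x) 1) - ln (b x)"
    using pos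
  proof eventually_elim
    case (elim x)
    have "(\<lambda>k. max (b x) (d k)) \<longlonglongrightarrow> max (b x) 0" by (intro tendsto_intros d0)
    then show ?case unfolding h_def using elim by (intro tendsto_intros) (auto simp: max_def)
  qed
  have ii: "integrable M (\<lambda>x. ln (max (b x) 1) - ln (b x))" "(\<integral>x. ln (max (b x) 1) - ln (b x) \<partial>M) = L"
    by (rule integral_monotone_convergence_nonneg[OF ih _ _ hlim L]; use hmono h0 in simp)+
  from Bochner_Integration.integrable_diff[OF i1 ii(1)] show il: "integrable M (\<lambda>x. ln (b x))" by simp
  have "(\<lambda>k. (\<integral>x. ln (max (b x) 1) \<partial>M) - integral\<^sup>L M (h k)) \<longlonglongrightarrow> (\<integral>x. ln (max (b x) 1) \<partial>M) - L"
    by (intro tendsto_intros L)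
  moreover have "(\<integral>x. ln (max (b x) 1) \<partial>M) - L = (\<integral>x. ln (b x) \<partial>M)"
    using ii(2) i1 il by simp
  moreover have "(\<integral>x. ln (max (b x) 1) \<partial>M) - integral\<^sup>L M (h k) = (\<integral>x. ln (max (b x) (d k)) \<partial>M)" for k
    unfolding h_def using i1 id[of k] by simp
  ultimately show "(\<lambda>k. \<integral>x. ln (max (b x) (1 / real (Suc k))) \<partial>M) \<longlonglongrightarrow> (\<integral>x. ln (b x) \<partial>M)"
    by (simp add: d_def)
qed

section \<open>Boundary values of Hardy functions\<close>

text \<open>Completeness of Lebesgue measure. It matters because \<open>boundary_function\<close>
  takes arbitrary values on the null set without limits.\<close>

lemma borel_measurable_lebesgue_on_AE:
  fixes f g :: "real \<Rightarrow> complex"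
  assumes S: "S \<in> sets lebesgue" and f: "f \<in> borel_measurable (lebesgue_on S)"
    and eq: "AE t in lebesgue_on S. g t = f t"
  shows "g \<in> borel_measurable (lebesgue_on S)"
proof -
  have "AE t in lebesgue. t \<in> S \<longrightarrow> g t = f t"
    using eq S by (subst (asm) AE_restrict_space_iff) auto
  then obtain N where N: "N \<in> null_sets lebesgue" "{t. \<not> (t \<in> S \<longrightarrow> g t = f t)} \<subseteq> N"
    by (auto simp: eventually_ae_filter)
  have "g measurable_on S"
    by (rule measurable_on_spike[of f S N])
       (use f S N in \<open>auto simp: measurable_on_iff_borel_measurable negligible_iff_null_sets\<close>)
  then show ?thesis using S by (simp add: measurable_on_iff_borel_measurable)
qed

text \<open>The shift makes every radius positive, starting from \<open>1/2\<close>, as the mean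
  value formula and dilations to radius \<open>1 / r\<close> demand.\<close>

definition radii :: "nat \<Rightarrow> real"
  where "radii n = real (Suc n) / real (Suc (Suc n))"

lemma radii: "0 < radii n" "radii n < 1" "radii \<longlonglongrightarrow> 1"
proof -
  show "radii \<longlonglongrightarrow> 1"
    unfolding radii_def using LIMSEQ_Suc[OF LIMSEQ_n_over_Suc_n[where 'a = real]] by simp
qed (auto simp: radii_def)

abbreviation circ_meas :: "real measure"
  where "circ_meas \<equiv> lebesgue_on {0..2*pi}"

lemma finite_measure_circ_meas: "finite_measure circ_meas"
  by (rule finite_measureI) (simp add: emeasure_restrict_space)

interpretation circ: finite_measure circ_meas
  by (rule finite_measure_circ_meas)

lemma circle_slice_integrable:
  fixes f :: "complex \<Rightarrow> complex"
  assumes "f holomorphic_on ball 0 1" "0 \<le> r" "r < 1"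
  shows "integrable circ_meas (\<lambda>t. f (of_real r * cis t))"
  by (intro integrable_on_circle continuous_on_circle[OF assms(1)] assms)

lemma boundary_function_measurable:
  assumes f: "f holomorphic_on ball 0 1"
    and nt: "AE t in circ_meas. \<exists>l. has_nontangential_limit f t l"
  shows "boundary_function f \<in> borel_measurable circ_meas"
proof (rule borel_measurable_lebesgue_on_AE)
  show "(\<lambda>t. lim (\<lambda>n. f (of_real (radii n) * cis t))) \<in> borel_measurable circ_meas"
    by (intro borel_measurable_lim_metric borel_measurable_integrable circle_slice_integrable[OF f])
       (use radii in \<open>auto simp: less_imp_le\<close>)
  show "AE t in circ_meas. boundary_function f t = lim (\<lambda>n. f (of_real (radii n) * cis t))"
    using nt
  proof eventually_elim
    case (elim t)
    have "(\<lambda>n. f (of_real (radii n) * cis t)) \<longlonglongrightarrow> boundary_function f t"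
      using radii by (intro nontangential_limit_radial[OF nontangential_limit_imp_boundary_function[OF elim]]) (auto simp: less_imp_le)
    then show ?case by (rule limI[symmetric])
  qed
qed simp

lemma boundary_function_radial:
  assumes nt: "AE t in circ_meas. \<exists>l. has_nontangential_limit f t l"
    and r: "\<And>n. 0 \<le> r n" "\<And>n. r n < 1" "r \<longlonglongrightarrow> (1::real)"
  shows "AE t in circ_meas. (\<lambda>n. f (of_real (r n) * cis t)) \<longlonglongrightarrow> boundary_function f t"
  using nt by eventually_elim (rule nontangential_limit_radial[OF nontangential_limit_imp_boundary_function r])

text \<open>Jensen's inequality for the dilate of \<open>F\<close> by \<open>r\<close>. The floor
  \<open>d\<close> keeps the logarithm continuous across common zeros.\<close>

lemma ln_cmod_le_cmean_ln_max:
  fixes F :: "complex \<Rightarrow> complex"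
  assumes F: "F holomorphic_on ball 0 1" and F0: "F 0 \<noteq> 0" and H: "H holomorphic_on ball 0 1"
    and r: "0 < r" "r < 1" and d: "d > 0"
  shows "ln (cmod (F 0)) \<le> cmean (\<lambda>t. ln (max (max (cmod (F (of_real r * cis t))) (cmod (H (of_real r * cis t)))) d))"
proof -
  define u where "u z = ln (max (max (cmod (F (of_real r * z))) (cmod (H (of_real r * z)))) d)" for z
  have c: "continuous_on (sphere 0 1) (\<lambda>z. f (of_real r * z))" if "f holomorphic_on ball 0 1" for f
    by (intro continuous_on_compose2[OF holomorphic_on_imp_continuous_on[OF that]] continuous_intros)
       (use r in \<open>auto simp: norm_mult\<close>)
  have cu: "continuous_on (sphere 0 1) u"
    unfolding u_def using d by (intro continuous_intros c[OF F] c[OF H]) (auto simp: max_def)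
  have "cmod (F (of_real r * 0)) \<le> exp (cmean (\<lambda>t. u (cis t)))"
  proof (rule cmod_at_0_le_exp_circle_mean[where R = "1 / r" and f = "\<lambda>z. F (of_real r * z)"])
    show "(\<lambda>z. F (of_real r * z)) holomorphic_on ball 0 (1 / r)"
      by (rule holomorphic_on_compose_gen[OF _ F, unfolded o_def])
         (use r in \<open>auto intro!: holomorphic_intros simp: norm_mult field_simps\<close>)
    show "1 < 1 / r" using r by simp
    show "cmod (F (of_real r * z)) \<le> exp (u z)" for z
      unfolding u_def using d by (subst exp_ln) (auto simp: less_max_iff_disj)
  qed (rule cu)
  then have "cmod (F 0) \<le> exp (cmean (\<lambda>t. u (cis t)))" by simp
  then have "ln (cmod (F 0)) \<le> cmean (\<lambda>t. u (cis t))"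
    using F0 by (metis ln_exp ln_le_cancel_iff exp_gt_zero zero_less_norm_iff)
  then show ?thesis by (simp add: u_def)
qed

text \<open>Two limits in a fixed order: first the radius tends to \<open>1\<close> at constant
  cut-off \<open>d\<close>, where truncated log means converge; then \<open>d\<close> tends to
  \<open>0\<close>, where Jensen's lower bound \<open>ln |F 0|\<close>, independent of
  \<open>d\<close>, prevents any loss. \<open>H = F\<close> gives the statement for a single
  function.\<close>

lemma boundary_function_log_mean:
  fixes F H :: "complex \<Rightarrow> complex"
  assumes F: "F holomorphic_on ball 0 1" and F0: "F 0 \<noteq> 0" and H: "H holomorphic_on ball 0 1"
    and ntF: "AE t in circ_meas. \<exists>l. has_nontangential_limit F t l"
    and ntH: "AE t in circ_meas. \<exists>l. has_nontangential_limit H t l"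
    and K: "\<And>r. 0 \<le> r \<Longrightarrow> r < 1 \<Longrightarrow> cmean (\<lambda>t. max (cmod (F (of_real r * cis t))) (cmod (H (of_real r * cis t)))) \<le> K"
  defines "a \<equiv> \<lambda>r t. max (cmod (F (of_real r * cis t))) (cmod (H (of_real r * cis t)))"
    and "b \<equiv> \<lambda>t. max (cmod (boundary_function F t)) (cmod (boundary_function H t))"
  shows "integrable circ_meas b" "cmean b \<le> K" "AE t in circ_meas. 0 < b t"
    "integrable circ_meas (\<lambda>t. ln (b t))"
    "\<And>d. d > 0 \<Longrightarrow> (\<lambda>n. cmean (\<lambda>t. ln (max (a (radii n) t) d))) \<longlonglongrightarrow> cmean (\<lambda>t. ln (max (b t) d))"
    "(\<lambda>k. cmean (\<lambda>t. ln (max (b t) (1 / real (Suc k))))) \<longlonglongrightarrow> cmean (\<lambda>t. ln (b t))"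
    "ln (cmod (F 0)) \<le> cmean (\<lambda>t. ln (b t))"
proof -
  have r: "0 \<le> radii n" "radii n < 1" for n using radii by (auto simp: less_imp_le)
  have ia: "integrable circ_meas (a (radii n))" for n
    unfolding a_def by (intro Bochner_Integration.integrable_max integrable_norm circle_slice_integrable F H r)
  have a0: "AE t in circ_meas. 0 \<le> a (radii n) t" for n
    unfolding a_def by (auto simp: le_max_iff_disj)
  have aK: "integral\<^sup>L circ_meas (a (radii n)) \<le> 2*pi*K" for n
    using K[OF r, of n] unfolding cmean_def a_def by (simp add: field_simps)
  have alim: "AE t in circ_meas. (\<lambda>n. a (radii n) t) \<longlonglongrightarrow> b t"
    using boundary_function_radial[OF ntF r radii(3)] boundary_function_radial[OF ntH r radii(3)]
    unfolding a_def b_def by eventually_elim (intro tendsto_intros)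
  have [measurable]: "boundary_function F \<in> borel_measurable circ_meas" "boundary_function H \<in> borel_measurable circ_meas"
    using boundary_function_measurable F H ntF ntH by auto
  have bm: "b \<in> borel_measurable circ_meas" unfolding b_def by measurable
  note lims = circ.integral_limit_le[OF ia a0 aK alim bm]
  show ib: "integrable circ_meas b" by (rule lims)
  show "cmean b \<le> K" using lims(2) by (simp add: cmean_def field_simps)
  have b0: "AE t in circ_meas. 0 \<le> b t" unfolding b_def by (auto simp: le_max_iff_disj)
  show lim1: "(\<lambda>n. cmean (\<lambda>t. ln (max (a (radii n) t) d))) \<longlonglongrightarrow> cmean (\<lambda>t. ln (max (b t) d))" if "d > 0" for d
    unfolding cmean_def by (intro tendsto_divide circ.integral_ln_max_tendsto[OF ia a0 aK alim bm that]) auto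
  have low: "ln (cmod (F 0)) \<le> cmean (\<lambda>t. ln (max (b t) d))" if "d > 0" for d
    by (rule LIMSEQ_le_const[OF lim1[OF that]])
       (use ln_cmod_le_cmean_ln_max[OF F F0 H radii(1,2) that] in \<open>auto simp: a_def\<close>)
  have low': "2*pi * ln (cmod (F 0)) \<le> (LINT t|circ_meas. ln (max (b t) d))" if "d > 0" "d \<le> 1" for d
    using low[OF that(1)] by (simp add: cmean_def field_simps)
  note bb = circ.integral_ln_max_bounded_below[OF ib b0 low']
  show "AE t in circ_meas. 0 < b t" "integrable circ_meas (\<lambda>t. ln (b t))" by (rule bb; assumption)+
  show lim2: "(\<lambda>k. cmean (\<lambda>t. ln (max (b t) (1 / real (Suc k))))) \<longlonglongrightarrow> cmean (\<lambda>t. ln (b t))"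
    unfolding cmean_def by (intro tendsto_divide bb(3)) auto
  show "ln (cmod (F 0)) \<le> cmean (\<lambda>t. ln (b t))"
    by (rule LIMSEQ_le_const[OF lim2]) (auto intro!: low exI[of _ 0])
qed

text \<open>A holomorphic \<open>G\<close> with \<open>|G| \<ge> 1\<close> and
  \<open>|G| \<ge> |f|\<close> makes \<open>f\<close> the quotient of the bounded functions
  \<open>f / G\<close> and \<open>1 / G\<close>. Both have boundary values, and those of
  \<open>1 / G\<close> vanish almost nowhere because \<open>1 / G\<close> is not zero at
  \<open>0\<close>.\<close>

lemma Fatou_hardy1:
  fixes f :: "complex \<Rightarrow> complex"
  assumes f: "f holomorphic_on ball 0 1"
    and K: "\<And>r. 0 \<le> r \<Longrightarrow> r < 1 \<Longrightarrow> circle_mean f r \<le> K"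
  shows "AE t in circ_meas. \<exists>l. has_nontangential_limit f t l"
proof -
  \<comment> \<open>The floor \<open>1\<close> makes \<open>u\<close> continuous and nonnegative,
    and forces \<open>|G| \<ge> 1\<close> through domination of the constant function
    \<open>1\<close>.\<close>
  define u where "u n z = ln (max 1 (cmod (f (of_real (radii n) * z))))" for n z
  have r: "0 \<le> radii n" "radii n < 1" for n using radii by (auto simp: less_imp_le)
  have c: "continuous_on (sphere 0 1) (\<lambda>z. f (of_real (radii n) * z))" for n
    by (intro continuous_on_compose2[OF holomorphic_on_imp_continuous_on[OF f]] continuous_intros)
       (use r in \<open>auto simp: norm_mult\<close>)
  have cu: "continuous_on (sphere 0 1) (u n)" for n
    unfolding u_def by (intro continuous_intros c) (auto simp: max_def)
  note cu' = continuous_on_compose_cis[OF cu]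
  have cf: "continuous_on {0..2*pi} (\<lambda>t. cmod (f (of_real (radii n) * cis t)))" for n
    by (intro continuous_intros continuous_on_circle[OF f] r)
  have exp_u: "exp (u n z) = max 1 (cmod (f (of_real (radii n) * z)))" for n z
    unfolding u_def by (rule exp_ln) (simp add: less_max_iff_disj)
  have m1: "cmean (\<lambda>t. exp (u n (cis t))) \<le> 1 + K" for n
  proof -
    have "cmean (\<lambda>t. exp (u n (cis t))) \<le> cmean (\<lambda>t. 1 + cmod (f (of_real (radii n) * cis t)))"
      by (intro cmean_mono continuous_intros cu' cf) (auto simp: exp_u)
    also have "\<dots> = 1 + circle_mean f (radii n)"
      by (simp add: cmean_add cf)
    finally show ?thesis using K[OF r, of n] by linarith
  qed
  have m2: "\<bar>cmean (\<lambda>t. u n (cis t))\<bar> \<le> 1 + K" for n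
  proof -
    have "0 \<le> cmean (\<lambda>t. u n (cis t))"
      using cmean_mono[of "\<lambda>_. 0", OF _ cu'] by (simp add: u_def)
    moreover have "cmean (\<lambda>t. u n (cis t)) \<le> cmean (\<lambda>t. exp (u n (cis t)))"
      by (intro cmean_mono continuous_intros cu') (use exp_ge_add_one_self in \<open>smt (verit)\<close>)
    ultimately show ?thesis using m1[of n] by linarith
  qed
  \<comment> \<open>Boundary values of \<open>f\<close> are not yet available, so the log means on
    the circles are only known to be bounded; a subsequence of radii makes them converge.\<close>
  have "bounded (range (\<lambda>n. cmean (\<lambda>t. u n (cis t))))"
    unfolding bounded_iff using m2 by auto
  then obtain L \<sigma> where \<sigma>: "strict_mono \<sigma>" "((\<lambda>n. cmean (\<lambda>t. u n (cis t))) \<circ> \<sigma>) \<longlonglongrightarrow> L"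
    using bounded_imp_convergent_subsequence by blast
  have r\<sigma>: "(\<lambda>n. radii (\<sigma> n)) \<longlonglongrightarrow> 1"
    using LIMSEQ_subseq_LIMSEQ[OF radii(3) \<sigma>(1)] by (simp add: o_def)
  obtain G where G: "G holomorphic_on ball 0 1" "\<And>z. z \<in> ball 0 1 \<Longrightarrow> G z \<noteq> 0"
    and dom: "\<And>F z. F holomorphic_on ball 0 1 \<Longrightarrow>
        (\<And>n w. w \<in> sphere 0 1 \<Longrightarrow> cmod (F (of_real (radii (\<sigma> n)) * w)) \<le> exp (u (\<sigma> n) w)) \<Longrightarrow>
        z \<in> ball 0 1 \<Longrightarrow> cmod (F z) \<le> cmod (G z)"
  proof (rule holomorphic_majorant[of "\<lambda>n. u (\<sigma> n)" "\<lambda>_. 1 + K" "1 + K" L "\<lambda>n. radii (\<sigma> n)"])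
    show "(\<lambda>n. cmean (\<lambda>t. u (\<sigma> n) (cis t))) \<longlonglongrightarrow> L" using \<sigma>(2) by (simp add: o_def)
  qed (use cu m1 radii r\<sigma> in auto)
  have fG: "cmod (f z) \<le> cmod (G z)" and oneG: "1 \<le> cmod (G z)" if z: "z \<in> ball 0 1" for z
    using dom[OF f _ z] dom[of "\<lambda>_. 1", OF _ _ z] by (auto simp: exp_u)
  define h where "h z = inverse (G z)" for z
  have hol_h: "h holomorphic_on ball 0 1" unfolding h_def using G by (intro holomorphic_intros) auto
  have h1: "cmod (h z) \<le> 1" if z: "z \<in> ball 0 1" for z
    using oneG[OF z] by (simp add: h_def norm_inverse inverse_le_1_iff)
  have nth: "AE t in circ_meas. \<exists>l. has_nontangential_limit h t l"
    by (rule Fatou_bounded[OF hol_h h1])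
  have hol_q: "(\<lambda>z. f z * h z) holomorphic_on ball 0 1"
    by (intro holomorphic_intros f hol_h)
  have ntq: "AE t in circ_meas. \<exists>l. has_nontangential_limit (\<lambda>z. f z * h z) t l"
  proof (rule Fatou_bounded[OF hol_q])
    show "cmod (f z * h z) \<le> 1" if z: "z \<in> ball 0 1" for z
      using fG[OF z] G(2)[OF z] by (simp add: h_def norm_mult norm_inverse norm_divide field_simps)
  qed
  have "AE t in circ_meas. 0 < max (cmod (boundary_function h t)) (cmod (boundary_function h t))"
  proof (rule boundary_function_log_mean[OF hol_h _ hol_h nth nth])
    show "h 0 \<noteq> 0" using G(2)[of 0] by (simp add: h_def)
    show "cmean (\<lambda>t. max (cmod (h (of_real r * cis t))) (cmod (h (of_real r * cis t)))) \<le> 1" if "0 \<le> r" "r < 1" for r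
    proof -
      have "circle_mean h r \<le> cmean (\<lambda>t. 1)"
        by (intro cmean_mono continuous_intros continuous_on_circle[OF hol_h] that h1) (use that in \<open>simp add: norm_mult\<close>)
      then show ?thesis by simp
    qed
  qed
  with nth ntq show ?thesis
  proof eventually_elim
    case (elim t)
    have "has_nontangential_limit (\<lambda>z. f z * h z / h z) t
        (boundary_function (\<lambda>z. f z * h z) t / boundary_function h t)"
      by (rule has_nontangential_limit_divide[OF nontangential_limit_imp_boundary_function[OF elim(2)]
            nontangential_limit_imp_boundary_function[OF elim(1)]]) (use elim(3) in auto)
    then have "has_nontangential_limit f t (boundary_function (\<lambda>z. f z * h z) t / boundary_function h t)"
      by (rule has_nontangential_limit_cong) (use G(2) in \<open>auto simp: h_def\<close>)
    then show ?case by blast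
  qed
qed

section \<open>Extreme points of the unit ball of the Hardy space\<close>

text \<open>The value at \<open>0\<close> must be the log mean on the boundary, a double limit in
  radius and cut-off; a diagonal choice reduces it to the single sequence that
  \<open>holomorphic_majorant\<close> takes.\<close>

lemma outer_majorant:
  fixes F H :: "complex \<Rightarrow> complex"
  assumes F: "F holomorphic_on ball 0 1" and F0: "F 0 \<noteq> 0" and H: "H holomorphic_on ball 0 1"
    and ntF: "AE t in circ_meas. \<exists>l. has_nontangential_limit F t l"
    and ntH: "AE t in circ_meas. \<exists>l. has_nontangential_limit H t l"
    and K: "\<And>r. 0 \<le> r \<Longrightarrow> r < 1 \<Longrightarrow> cmean (\<lambda>t. max (cmod (F (of_real r * cis t))) (cmod (H (of_real r * cis t)))) \<le> K"
  obtains G where "G holomorphic_on ball 0 1" "\<And>z. z \<in> ball 0 1 \<Longrightarrow> G z \<noteq> 0"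
    "cmod (G 0) = exp (cmean (\<lambda>t. ln (max (cmod (boundary_function F t)) (cmod (boundary_function H t)))))"
    "\<And>\<rho>. 0 \<le> \<rho> \<Longrightarrow> \<rho> < 1 \<Longrightarrow> circle_mean G \<rho> \<le> K"
    "\<And>z. z \<in> ball 0 1 \<Longrightarrow> cmod (F z) \<le> cmod (G z)"
    "\<And>z. z \<in> ball 0 1 \<Longrightarrow> cmod (H z) \<le> cmod (G z)"
proof -
  define a where "a r t = max (cmod (F (of_real r * cis t))) (cmod (H (of_real r * cis t)))" for r t
  define b where "b t = max (cmod (boundary_function F t)) (cmod (boundary_function H t))" for t
  have lm5: "(\<lambda>n. cmean (\<lambda>t. ln (max (a (radii n) t) e))) \<longlonglongrightarrow> cmean (\<lambda>t. ln (max (b t) e))" if "e > 0" for e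
    unfolding a_def b_def by (rule boundary_function_log_mean(5)[OF F F0 H ntF ntH _ that]) (rule K)
  have lm6: "(\<lambda>k. cmean (\<lambda>t. ln (max (b t) (1 / real (Suc k))))) \<longlonglongrightarrow> cmean (\<lambda>t. ln (b t))"
    unfolding b_def by (rule boundary_function_log_mean(6)[OF F F0 H ntF ntH]) (rule K)
  define d where "d k = 1 / real (Suc k)" for k
  have d: "0 < d k" for k by (simp add: d_def)
  have d0: "d \<longlonglongrightarrow> 0" unfolding d_def using LIMSEQ_inverse_real_of_nat by (simp add: inverse_eq_divide)
  \<comment> \<open>One radius is picked for each cut-off \<open>d k\<close>; an index of at least
    \<open>k\<close> makes the chosen radii tend to \<open>1\<close>.\<close>
  have "\<exists>n\<ge>k. \<bar>cmean (\<lambda>t. ln (max (a (radii n) t) (d k))) - cmean (\<lambda>t. ln (max (b t) (d k)))\<bar> < d k" for k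
  proof -
    obtain N where N: "\<forall>n\<ge>N. norm (cmean (\<lambda>t. ln (max (a (radii n) t) (d k))) - cmean (\<lambda>t. ln (max (b t) (d k)))) < d k"
      using LIMSEQ_D[OF lm5[OF d] d] by blast
    then show ?thesis by (intro exI[of _ "max k N"]) auto
  qed
  then obtain \<nu> where \<nu>: "\<And>k. k \<le> \<nu> k"
    "\<And>k. \<bar>cmean (\<lambda>t. ln (max (a (radii (\<nu> k)) t) (d k))) - cmean (\<lambda>t. ln (max (b t) (d k)))\<bar> < d k"
    by metis
  define r where "r k = radii (\<nu> k)" for k
  have r: "0 < r k" "r k < 1" for k using radii(1,2) by (auto simp: r_def)
  have "filterlim \<nu> at_top sequentially"
    unfolding filterlim_at_top eventually_sequentially using \<nu>(1) order_trans by blast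
  from filterlim_compose[OF radii(3) this] have rlim: "r \<longlonglongrightarrow> 1" unfolding r_def .
  define u where "u k z = ln (max (max (cmod (F (of_real (r k) * z))) (cmod (H (of_real (r k) * z)))) (d k))" for k z
  have c: "continuous_on (sphere 0 1) (\<lambda>z. f (of_real (r k) * z))" if "f holomorphic_on ball 0 1" for f k
    by (intro continuous_on_compose2[OF holomorphic_on_imp_continuous_on[OF that]] continuous_intros)
       (use r[of k] in \<open>auto simp: norm_mult\<close>)
  have cu: "continuous_on (sphere 0 1) (u k)" for k
    unfolding u_def using d[of k] by (intro continuous_intros c[OF F] c[OF H]) (auto simp: max_def)
  have exp_u: "exp (u k z) = max (max (cmod (F (of_real (r k) * z))) (cmod (H (of_real (r k) * z)))) (d k)" for k z
    unfolding u_def using d[of k] by (intro exp_ln) (simp add: less_max_iff_disj)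
  have ca: "continuous_on {0..2*pi} (a (r k))" for k
    unfolding a_def using r[of k] by (intro continuous_intros continuous_on_circle[OF F] continuous_on_circle[OF H]) auto
  have m: "cmean (\<lambda>t. exp (u k (cis t))) \<le> K + d k" for k
  proof -
    have "cmean (\<lambda>t. exp (u k (cis t))) \<le> cmean (\<lambda>t. a (r k) t + d k)"
      using d[of k] by (intro cmean_mono continuous_intros continuous_on_compose_cis[OF cu] ca) (auto simp: exp_u a_def le_max_iff_disj)
    also have "\<dots> = cmean (a (r k)) + d k" by (simp add: cmean_add ca)
    also have "cmean (a (r k)) \<le> K"
      unfolding a_def[abs_def] using K[of "r k"] r[of k] by simp
    finally show ?thesis by simp
  qed
  have L: "(\<lambda>k. cmean (\<lambda>t. u k (cis t))) \<longlonglongrightarrow> cmean (\<lambda>t. ln (b t))"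
  proof -
    have "(\<lambda>k. cmean (\<lambda>t. u k (cis t)) - cmean (\<lambda>t. ln (max (b t) (d k)))) \<longlonglongrightarrow> 0"
    proof (rule Lim_null_comparison[OF _ d0])
      show "\<forall>\<^sub>F k in sequentially. norm (cmean (\<lambda>t. u k (cis t)) - cmean (\<lambda>t. ln (max (b t) (d k)))) \<le> d k"
        using \<nu>(2) by (intro always_eventually allI) (simp add: u_def a_def r_def less_imp_le)
    qed
    from tendsto_add[OF this lm6[folded d_def]] show ?thesis by simp
  qed
  have Kd: "(\<lambda>k. K + d k) \<longlonglongrightarrow> K" using tendsto_add[OF tendsto_const[of K] d0] by simp
  obtain G where G: "G holomorphic_on ball 0 1" "\<And>z. z \<in> ball 0 1 \<Longrightarrow> G z \<noteq> 0"
    "cmod (G 0) = exp (cmean (\<lambda>t. ln (b t)))"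
    "\<And>\<rho>. 0 \<le> \<rho> \<Longrightarrow> \<rho> < 1 \<Longrightarrow> circle_mean G \<rho> \<le> K"
    and dom: "\<And>f z. f holomorphic_on ball 0 1 \<Longrightarrow>
        (\<And>n w. w \<in> sphere 0 1 \<Longrightarrow> cmod (f (of_real (r n) * w)) \<le> exp (u n w)) \<Longrightarrow>
        z \<in> ball 0 1 \<Longrightarrow> cmod (f z) \<le> cmod (G z)"
    by (rule holomorphic_majorant[OF cu m Kd L r rlim]) blast
  have "cmod (F z) \<le> cmod (G z)" "cmod (H z) \<le> cmod (G z)" if "z \<in> ball 0 1" for z
    by (rule dom[OF F _ that] dom[OF H _ that]; simp add: exp_u le_max_iff_disj)+
  with G show ?thesis unfolding b_def by (intro that) auto
qed

text \<open>Phrased with real circle means so that estimates need no extended arithmetic;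
  \<open>hardy1_ball_eq\<close> identifies it with the unit ball of \<open>hardy1\<close>.\<close>

definition hardy1_ball :: "(complex \<Rightarrow> complex) set"
  where "hardy1_ball = {f \<in> disc_analytic. \<forall>r\<in>{0..<1}. circle_mean f r \<le> 1}"

lemma hardy1_ballI:
  assumes "f holomorphic_on ball 0 1" "\<And>r. 0 \<le> r \<Longrightarrow> r < 1 \<Longrightarrow> circle_mean f r \<le> 1"
  shows "(\<lambda>z. if z \<in> ball 0 1 then f z else 0) \<in> hardy1_ball"
proof -
  have "(\<lambda>z. if z \<in> ball 0 1 then f z else 0) holomorphic_on ball 0 1"
    by (rule holomorphic_transform[OF assms(1)]) auto
  moreover have "(\<lambda>t. cmod (if of_real r * cis t \<in> ball 0 1 then f (of_real r * cis t) else 0)) =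
      (\<lambda>t. cmod (f (of_real r * cis t)))" if "0 \<le> r" "r < 1" for r
    using that by (auto simp: norm_mult)
  ultimately show ?thesis
    using assms(2) unfolding hardy1_ball_def disc_analytic_def by auto
qed

lemma extreme_point_decomposition:
  fixes P Q F :: "complex \<Rightarrow> complex"
  assumes ext: "F extreme_point_of S" and "P \<in> S" "Q \<in> S"
    and u: "0 < u" "u < 1" and eq: "\<And>z. F z = of_real (1 - u) * P z + of_real u * Q z"
  shows "P = Q"
proof (rule ccontr)
  assume "P \<noteq> Q"
  moreover have "F = (1 - u) *\<^sub>R P + u *\<^sub>R Q"
    by (simp add: fun_eq_iff eq scaleR_fun_def plus_fun_def scaleR_conv_of_real)
  ultimately have "F \<in> open_segment P Q"
    using u unfolding in_segment by blast
  then show False using ext assms(2,3) by (simp add: extreme_point_of_def)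
qed

lemma disc_analytic_eqI:
  assumes "f \<in> disc_analytic" "g \<in> disc_analytic" "\<And>z. z \<in> ball 0 1 \<Longrightarrow> f z = g z"
  shows "f = g"
proof
  fix z show "f z = g z" using assms by (cases "z \<in> ball 0 1") (auto simp: disc_analytic_def)
qed

text \<open>If all means of \<open>F\<close> were at most \<open>s\<close>, adding and subtracting
  the constant \<open>1 - s\<close> would give two distinct points of the ball with midpoint
  \<open>F\<close>.\<close>

lemma extreme_point_hardy1_ball_norm:
  assumes ext: "F extreme_point_of hardy1_ball" and s: "s < 1"
  shows "\<exists>r\<in>{0..<1}. s < circle_mean F r"
proof (rule ccontr)
  assume "\<not> ?thesis"
  then have le: "circle_mean F r \<le> s" if "0 \<le> r" "r < 1" for r
    using that by (auto simp: not_less)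
  have FS: "F \<in> hardy1_ball" using ext by (simp add: extreme_point_of_def)
  then have hol: "F holomorphic_on ball 0 1" and F0: "\<And>z. z \<notin> ball 0 1 \<Longrightarrow> F z = 0"
    by (auto simp: hardy1_ball_def disc_analytic_def)
  define P where "P c z = (if z \<in> ball 0 1 then F z + c else 0)" for c z :: complex
  have P: "P c \<in> hardy1_ball" if c: "cmod c = 1 - s" for c
    unfolding P_def
  proof (rule hardy1_ballI)
    show "(\<lambda>z. F z + c) holomorphic_on ball 0 1" by (intro holomorphic_intros hol)
    fix r :: real assume r: "0 \<le> r" "r < 1"
    note cf = continuous_on_circle[OF hol r]
    have "cmean (\<lambda>t. cmod (F (of_real r * cis t) + c)) \<le> cmean (\<lambda>t. cmod (F (of_real r * cis t)) + cmod c)"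
      by (intro cmean_mono continuous_intros cf norm_triangle_ineq)
    also have "\<dots> = circle_mean F r + cmod c"
      by (simp add: cmean_add continuous_intros cf)
    finally show "cmean (\<lambda>t. cmod (F (of_real r * cis t) + c)) \<le> 1" using le[OF r] c by simp
  qed
  have n: "cmod (of_real (1 - s)) = 1 - s" "cmod (- of_real (1 - s)) = 1 - s"
    using s by (simp_all only: norm_minus_cancel norm_of_real)
  have "P (of_real (1 - s)) = P (- of_real (1 - s))"
    by (rule extreme_point_decomposition[OF ext P[OF n(1)] P[OF n(2)], of "1/2"])
       (use F0 in \<open>auto simp: P_def field_simps\<close>)
  then have "P (of_real (1 - s)) 0 = P (- of_real (1 - s)) 0" by simp
  then have "complex_of_real (2 * (1 - s)) = 0" unfolding P_def by (simp add: algebra_simps)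
  then show False using s by (simp only: of_real_eq_0_iff) simp
qed

text \<open>The de Leeuw--Rudin perturbation: with \<open>\<gamma>\<close> unimodular and \<open>J = \<gamma> I\<close>, the two functions
  \<open>\<plusminus> cnj \<gamma> * Q * (J \<plusminus> 1)\<^sup>2 / 2\<close> have average \<open>F = I * Q\<close>, and \<open>\<bar>J \<plusminus> 1\<bar>\<^sup>2 \<le> 2 \<plusminus> 2 Re J\<close>.\<close>

lemma not_extreme_point_inner_factor:
  assumes Q: "Q holomorphic_on ball 0 1" "\<And>r. 0 \<le> r \<Longrightarrow> r < 1 \<Longrightarrow> circle_mean Q r \<le> 1"
    and I: "I holomorphic_on ball 0 1" "\<And>z. z \<in> ball 0 1 \<Longrightarrow> cmod (I z) < 1"
    and F: "\<And>z. z \<in> ball 0 1 \<Longrightarrow> F z = I z * Q z"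
  shows "\<not> F extreme_point_of hardy1_ball"
proof
  assume ext: "F extreme_point_of hardy1_ball"
  have FS: "F \<in> hardy1_ball" using ext by (simp add: extreme_point_of_def)
  have r: "0 \<le> radii n" "radii n < 1" for n using radii by (auto simp: less_imp_le)
  have cQ: "continuous_on {0..2*pi} (\<lambda>t. Q (of_real s * cis t))" and cI: "continuous_on {0..2*pi} (\<lambda>t. I (of_real s * cis t))"
    if "0 \<le> s" "s < 1" for s
    using that by (intro continuous_on_circle[OF Q(1)] continuous_on_circle[OF I(1)]; simp)+
  \<comment> \<open>These averages, once rotated by \<open>\<gamma>\<close>, are the first-order
    change of the mean of \<open>|Q|\<close> under the perturbation. Only boundedness is known, so a
    subsequence \<open>\<sigma>\<close> is taken.\<close>
  define c where "c n = (LINT t|circ_meas. of_real (cmod (Q (of_real (radii n) * cis t))) * I (of_real (radii n) * cis t)) / of_real (2*pi)" for n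
  have ic: "integrable circ_meas (\<lambda>t. of_real (cmod (Q (of_real (radii n) * cis t))) * I (of_real (radii n) * cis t))" for n
    by (intro integrable_on_circle continuous_intros cQ cI r)
  have "cmod (c n) \<le> 1" for n
  proof -
    have "cmod (LINT t|circ_meas. of_real (cmod (Q (of_real (radii n) * cis t))) * I (of_real (radii n) * cis t)) \<le>
        (LINT t|circ_meas. cmod (of_real (cmod (Q (of_real (radii n) * cis t))) * I (of_real (radii n) * cis t)))"
      by (rule integral_norm_bound)
    also have "\<dots> \<le> (LINT t|circ_meas. cmod (Q (of_real (radii n) * cis t)))"
    proof (intro integral_mono integrable_on_circle continuous_intros cQ cI r)
      fix t
      have "cmod (I (of_real (radii n) * cis t)) \<le> 1" using r[of n] by (intro less_imp_le I(2)) (simp add: norm_mult)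
      then show "cmod (of_real (cmod (Q (of_real (radii n) * cis t))) * I (of_real (radii n) * cis t)) \<le> cmod (Q (of_real (radii n) * cis t))"
        by (simp add: norm_mult mult_left_le)
    qed
    also have "\<dots> \<le> 2*pi" using Q(2)[OF r, of n] by (simp add: cmean_def field_simps)
    finally show ?thesis by (simp add: c_def norm_divide norm_mult)
  qed
  then have "bounded (range c)" unfolding bounded_iff by auto
  then obtain c0 \<sigma> where \<sigma>: "strict_mono \<sigma>" "(c \<circ> \<sigma>) \<longlonglongrightarrow> c0"
    using bounded_imp_convergent_subsequence by blast
  \<comment> \<open>Rotates \<open>c0\<close> onto the imaginary axis, so that the error
    \<open>e * Re (\<gamma> * c n)\<close> disappears in the limit for both signs
    \<open>e = 1\<close> and \<open>e = -1\<close>.\<close>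
  define \<gamma> where "\<gamma> = (if c0 = 0 then 1 else \<i> * cnj (sgn c0))"
  have \<gamma>: "cmod \<gamma> = 1" by (simp add: \<gamma>_def norm_mult norm_sgn)
  have \<gamma>1: "\<gamma> * cnj \<gamma> = 1" using \<gamma> by (simp add: complex_norm_square[symmetric])
  have "Re (\<gamma> * c0) = 0"
  proof (cases "c0 = 0")
    case False
    have "cnj (sgn c0) * c0 = of_real (cmod c0)"
    proof -
      have "cnj (sgn c0) * c0 = (c0 * cnj c0) / of_real (cmod c0)" by (simp add: sgn_eq)
      then show ?thesis using False by (simp add: complex_norm_square[symmetric] power2_eq_square)
    qed
    then have "\<gamma> * c0 = \<i> * of_real (cmod c0)" using False by (simp add: \<gamma>_def mult.assoc)
    then show ?thesis by simp
  qed simp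
  then have lim0: "(\<lambda>n. Re (\<gamma> * c (\<sigma> n))) \<longlonglongrightarrow> 0"
    using tendsto_Re[OF tendsto_mult[OF tendsto_const \<sigma>(2)], of \<gamma>] by (simp add: o_def)
  have Rec: "Re (\<gamma> * c n) = cmean (\<lambda>t. cmod (Q (of_real (radii n) * cis t)) * Re (\<gamma> * I (of_real (radii n) * cis t)))" for n
  proof -
    let ?f = "\<lambda>t. of_real (cmod (Q (of_real (radii n) * cis t))) * I (of_real (radii n) * cis t)"
    have "\<gamma> * (LINT t|circ_meas. ?f t) = (LINT t|circ_meas. \<gamma> * ?f t)" by simp
    then have "Re (\<gamma> * (LINT t|circ_meas. ?f t)) = (LINT t|circ_meas. Re (\<gamma> * ?f t))"
      using integral_Re[of circ_meas "\<lambda>t. \<gamma> * ?f t"] ic[of n] by simp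
    moreover have "Re (\<gamma> * ?f t) = cmod (Q (of_real (radii n) * cis t)) * Re (\<gamma> * I (of_real (radii n) * cis t))" for t
      by (simp add: algebra_simps)
    moreover have "Re (\<gamma> * c n) = Re (\<gamma> * (LINT t|circ_meas. ?f t)) / (2*pi)"
      unfolding c_def times_divide_eq_right by (rule Re_divide_of_real)
    ultimately show ?thesis by (simp only: cmean_def)
  qed
  define P where "P e z = of_real (e / 2) * cnj \<gamma> * Q z * (\<gamma> * I z + of_real e)\<^sup>2" for e z
  have holP: "P e holomorphic_on ball 0 1" for e unfolding P_def by (intro holomorphic_intros Q I)
  have PS: "(\<lambda>z. if z \<in> ball 0 1 then P e z else 0) \<in> hardy1_ball" if e: "e\<^sup>2 = 1" for e
  proof (rule hardy1_ballI[OF holP])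
    have e1: "\<bar>e\<bar> = 1" using e by (metis abs_square_eq_1)
    fix s :: real assume s: "0 \<le> s" "s < 1"
    have est: "cmean (\<lambda>t. cmod (P e (of_real (radii n) * cis t))) \<le> 1 + e * Re (\<gamma> * c n)" for n
    proof -
      let ?q = "\<lambda>t. cmod (Q (of_real (radii n) * cis t))" and ?j = "\<lambda>t. \<gamma> * I (of_real (radii n) * cis t)"
      have "cmean (\<lambda>t. cmod (P e (of_real (radii n) * cis t))) \<le> cmean (\<lambda>t. ?q t + e * (?q t * Re (?j t)))"
      proof (intro cmean_mono continuous_intros cQ cI continuous_on_circle[OF holP] r)
        fix t
        have "cmod (I (of_real (radii n) * cis t)) < 1"
          using r[of n] by (intro I(2)) (simp add: norm_mult)
        then have j: "(cmod (?j t))\<^sup>2 \<le> 1"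
          using \<gamma> by (intro power_le_one[OF norm_ge_zero]) (simp add: norm_mult)
        have "(cmod (?j t + of_real e))\<^sup>2 = (cmod (?j t))\<^sup>2 + 2 * e * Re (?j t) + e\<^sup>2"
          by (simp only: cmod_power2) (simp add: power2_eq_square algebra_simps)
        also have "\<dots> \<le> 2 + 2 * e * Re (?j t)" using j e by simp
        finally have "?q t / 2 * (cmod (?j t + of_real e))\<^sup>2 \<le> ?q t / 2 * (2 + 2 * e * Re (?j t))"
          by (intro mult_left_mono) auto
        then show "cmod (P e (of_real (radii n) * cis t)) \<le> ?q t + e * (?q t * Re (?j t))"
          unfolding P_def norm_mult norm_power complex_mod_cnj norm_of_real \<gamma> using e1 by (simp add: algebra_simps)
      qed
      also have "\<dots> = cmean ?q + e * cmean (\<lambda>t. ?q t * Re (?j t))"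
        by (subst cmean_add) (auto intro!: continuous_intros cQ cI r simp: cmean_mult_left)
      finally show ?thesis using Q(2)[OF r, of n] Rec[of n] by simp
    qed
    \<comment> \<open>\<open>est\<close> holds along \<open>radii\<close> and with an error;
      monotonicity bounds the mean at \<open>s\<close> by means at larger radii, along which the
      error vanishes.\<close>
    show "cmean (\<lambda>t. cmod (P e (of_real s * cis t))) \<le> 1"
    proof (rule LIMSEQ_le_const)
      show "(\<lambda>n. 1 + e * Re (\<gamma> * c (\<sigma> n))) \<longlonglongrightarrow> 1"
        using tendsto_add[OF tendsto_const[of 1] tendsto_mult[OF tendsto_const[of e] lim0]] by simp
      have "(\<lambda>n. radii (\<sigma> n)) \<longlonglongrightarrow> 1"
        using LIMSEQ_subseq_LIMSEQ[OF radii(3) \<sigma>(1)] by (simp add: o_def)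
      then have "\<forall>\<^sub>F n in sequentially. s < radii (\<sigma> n)" by (rule order_tendstoD(1)) (rule s)
      then obtain N where N: "\<And>n. n \<ge> N \<Longrightarrow> s < radii (\<sigma> n)" unfolding eventually_sequentially by blast
      have "cmean (\<lambda>t. cmod (P e (of_real s * cis t))) \<le> 1 + e * Re (\<gamma> * c (\<sigma> n))" if n: "n \<ge> N" for n
        using circle_mean_cmod_mono[OF holP s(1) less_imp_le[OF N[OF n]] r(2), of e] est[of "\<sigma> n"] by linarith
      then show "\<exists>N. \<forall>n\<ge>N. cmean (\<lambda>t. cmod (P e (of_real s * cis t))) \<le> 1 + e * Re (\<gamma> * c (\<sigma> n))" by blast
    qed
  qed
  have avg: "F z = (P 1 z + P (-1) z) / 2" if z: "z \<in> ball 0 1" for z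
  proof -
    have "P 1 z + P (-1) z = 2 * (\<gamma> * cnj \<gamma>) * (I z * Q z)"
      by (simp add: P_def power2_eq_square algebra_simps)
    then show ?thesis using \<gamma>1 F[OF z] by simp
  qed
  have "(\<lambda>z. if z \<in> ball 0 1 then P 1 z else 0) = (\<lambda>z. if z \<in> ball 0 1 then P (-1) z else 0)"
  proof (rule extreme_point_decomposition[OF ext PS PS, of _ _ "1/2"])
    show "F z = of_real (1 - 1/2) * (if z \<in> ball 0 1 then P 1 z else 0) + of_real (1/2) * (if z \<in> ball 0 1 then P (-1) z else 0)" for z
      using avg[of z] FS by (auto simp: hardy1_ball_def disc_analytic_def field_simps)
  qed auto
  then have eqP: "P 1 z = P (-1) z" if "z \<in> ball 0 1" for z
    using that by (metis (mono_tags, lifting))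
  \<comment> \<open>The two perturbations differ by
    \<open>cnj \<gamma> * Q z * ((\<gamma> * I z)^2 + 1)\<close>. As \<open>|I| < 1\<close> the last
    factor has no zeros, so equality forces \<open>F = 0\<close>, which is not of norm
    \<open>1\<close>.\<close>
  have "F z = 0" if z: "z \<in> ball 0 1" for z
  proof -
    have "P 1 z - P (-1) z = cnj \<gamma> * Q z * ((\<gamma> * I z)\<^sup>2 + 1)"
      by (simp add: P_def power2_eq_square algebra_simps)
    then have "cnj \<gamma> * Q z * ((\<gamma> * I z)\<^sup>2 + 1) = 0" using eqP[OF z] by simp
    moreover have "cnj \<gamma> \<noteq> 0" using \<gamma> by auto
    moreover have "(\<gamma> * I z)\<^sup>2 + 1 \<noteq> 0"
    proof
      assume "(\<gamma> * I z)\<^sup>2 + 1 = 0"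
      then have "(\<gamma> * I z)\<^sup>2 = - 1" by (simp only: add_eq_0_iff2)
      then have "cmod ((\<gamma> * I z)\<^sup>2) = 1" by simp
      then have "(cmod (I z))\<^sup>2 = 1" using \<gamma> by (simp add: norm_power norm_mult)
      then have "cmod (I z) = 1 \<or> cmod (I z) = - 1" by (simp only: power2_eq_1_iff)
      then show False using I(2)[OF z] norm_ge_zero[of "I z"] by linarith
    qed
    ultimately show ?thesis using F[OF z] by simp
  qed
  then have "circle_mean F s = 0" if "s \<in> {0..<1}" for s
    using that by (simp add: norm_mult)
  then show False using extreme_point_hardy1_ball_norm[OF ext, of 0] by auto
qed

lemma nn_integral_circle_eq_cmean:
  assumes f: "f holomorphic_on ball 0 1" and r: "0 \<le> r" "r < 1"
  shows "ennreal (1 / (2*pi)) * (\<integral>\<^sup>+t. ennreal (cmod (circle_slice f r t)) \<partial>circ_meas) =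
    ennreal (circle_mean f r)"
proof -
  have "(\<integral>\<^sup>+t. ennreal (cmod (circle_slice f r t)) \<partial>circ_meas) =
      ennreal (LINT t|circ_meas. cmod (f (of_real r * cis t)))"
    unfolding circle_slice_def
    by (intro nn_integral_eq_integral integrable_norm circle_slice_integrable[OF f r]) auto
  then show ?thesis by (simp add: cmean_def ennreal_mult[symmetric] integral_nonneg_AE)
qed

lemma hardy1_norm_eq:
  assumes "f holomorphic_on ball 0 1"
  shows "hardy1_norm f = (SUP r\<in>{0..<1}. ennreal (circle_mean f r))"
  unfolding hardy1_norm_def by (intro SUP_cong refl nn_integral_circle_eq_cmean[OF assms]) auto

lemma hardy1_norm_le_1_iff:
  assumes "f holomorphic_on ball 0 1"
  shows "hardy1_norm f \<le> 1 \<longleftrightarrow> (\<forall>r\<in>{0..<1}. circle_mean f r \<le> 1)"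
  unfolding hardy1_norm_eq[OF assms] SUP_le_iff by simp

lemma hardy1_ball_eq: "hardy1_ball = {f \<in> hardy1. hardy1_norm f \<le> 1}"
proof -
  have "hardy1_norm f < \<infinity>" if "hardy1_norm f \<le> 1" for f
    using order_le_less_trans[OF that ennreal_one_less_top] by simp
  then show ?thesis
    unfolding hardy1_ball_def hardy1_def by (auto simp: disc_analytic_def hardy1_norm_le_1_iff)
qed

lemma hardy1_norm_eq_1_iff:
  assumes F: "F \<in> hardy1_ball"
  shows "hardy1_norm F = 1 \<longleftrightarrow> (\<forall>s<1. \<exists>r\<in>{0..<1}. s < circle_mean F r)"
proof -
  have hol: "F holomorphic_on ball 0 1" and le: "hardy1_norm F \<le> 1"
    using F by (auto simp: hardy1_ball_eq hardy1_def disc_analytic_def)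
  have nn: "0 \<le> circle_mean F r" for r
    by (simp add: cmean_def integral_nonneg_AE)
  show ?thesis
  proof
    assume eq: "hardy1_norm F = 1"
    show "\<forall>s<1. \<exists>r\<in>{0..<1}. s < circle_mean F r"
    proof (intro allI impI)
      fix s :: real assume s: "s < 1"
      then have "ennreal (max s 0) < hardy1_norm F" using eq by (simp add: ennreal_less_one_iff)
      then obtain r where "r \<in> {0..<1}" "ennreal (max s 0) < ennreal (circle_mean F r)"
        unfolding hardy1_norm_eq[OF hol] less_SUP_iff by blast
      then show "\<exists>r\<in>{0..<1}. s < circle_mean F r"
        using nn by (intro bexI[of _ r]) (auto simp: ennreal_less_iff)
    qed
  next
    assume R: "\<forall>s<1. \<exists>r\<in>{0..<1}. s < circle_mean F r"
    show "hardy1_norm F = 1"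
    proof (rule antisym[OF le], rule ccontr)
      assume "\<not> 1 \<le> hardy1_norm F"
      then have lt: "hardy1_norm F < 1" by simp
      define s where "s = enn2real (hardy1_norm F)"
      have s: "ennreal s = hardy1_norm F" unfolding s_def using lt by (intro ennreal_enn2real) (auto intro: less_trans)
      have s1: "s < 1" "0 \<le> s" using lt unfolding s[symmetric] by (auto simp: s_def ennreal_less_one_iff)
      with R obtain r where r: "r \<in> {0..<1}" "s < circle_mean F r" by blast
      have "ennreal (circle_mean F r) \<le> hardy1_norm F"
        unfolding hardy1_norm_eq[OF hol] by (rule SUP_upper[OF r(1)])
      then show False using r(2) s1 unfolding s[symmetric] by simp
    qed
  qed
qed

section \<open>Extreme points are outer\<close>

lemma unimodular_quotient_constant:
  assumes F: "F holomorphic_on ball 0 1" and G: "G holomorphic_on ball 0 1" "\<And>z. z \<in> ball 0 1 \<Longrightarrow> G z \<noteq> 0"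
    and le: "\<And>z. z \<in> ball 0 1 \<Longrightarrow> cmod (F z) \<le> cmod (G z)"
    and z0: "z0 \<in> ball 0 1" "cmod (F z0) = cmod (G z0)"
  obtains c where "cmod c = 1" "\<And>z. z \<in> ball 0 1 \<Longrightarrow> F z = c * G z"
proof -
  have "(\<lambda>z. F z / G z) constant_on ball 0 1"
  proof (rule maximum_modulus_principle[of _ _ "ball 0 1"])
    show "(\<lambda>z. F z / G z) holomorphic_on ball 0 1" by (intro holomorphic_intros F G)
    fix z :: complex assume z: "z \<in> ball 0 1"
    have "cmod (F z / G z) \<le> 1" using le[OF z] G(2)[OF z] by (simp add: norm_divide)
    also have "1 = cmod (F z0 / G z0)" using z0 G(2)[OF z0(1)] by (simp add: norm_divide)
    finally show "cmod (F z / G z) \<le> cmod (F z0 / G z0)" .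
  qed (use z0 in auto)
  then obtain c where c: "\<And>z. z \<in> ball 0 1 \<Longrightarrow> F z / G z = c" by (auto simp: constant_on_def)
  show ?thesis
  proof (rule that[of c])
    have "F z0 / G z0 = c" by (rule c[OF z0(1)])
    then show "cmod c = 1" using z0 G(2)[OF z0(1)] by (auto simp: norm_divide)
    show "F z = c * G z" if "z \<in> ball 0 1" for z
      using c[OF that] G(2)[OF that] by (auto simp: field_simps)
  qed
qed

lemma hardy1_ball_nontangential:
  assumes "f \<in> hardy1_ball"
  shows "AE t in circ_meas. \<exists>l. has_nontangential_limit f t l"
  by (rule Fatou_hardy1[where K = 1]) (use assms in \<open>auto simp: hardy1_ball_def disc_analytic_def\<close>)

text \<open>A zero at the origin makes \<open>z\<close> an inner factor: \<open>F = z * Q\<close>,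
  and the mean of \<open>Q\<close> at radius \<open>r\<close> is \<open>1 / r\<close> times that of
  \<open>F\<close>, so letting \<open>r\<close> tend to \<open>1\<close> puts \<open>Q\<close> in
  the ball. This settles the one case in which the log means have no lower bound from
  \<open>F 0\<close>.\<close>

lemma extreme_point_hardy1_ball_imp_nonzero:
  assumes ext: "F extreme_point_of hardy1_ball"
  shows "F 0 \<noteq> 0"
proof
  assume F0: "F 0 = 0"
  have "F \<in> hardy1_ball" using ext by (simp add: extreme_point_of_def)
  then have hol: "F holomorphic_on ball 0 1" and cF: "\<And>r. 0 \<le> r \<Longrightarrow> r < 1 \<Longrightarrow> circle_mean F r \<le> 1"
    by (auto simp: hardy1_ball_def disc_analytic_def)
  define Q where "Q z = (if z = 0 then deriv F 0 else (F z - F 0) / (z - 0))" for z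
  have holQ: "Q holomorphic_on ball 0 1"
    unfolding Q_def by (rule pole_lemma_open[OF hol]) auto
  have FQ: "F z = z * Q z" for z using F0 by (simp add: Q_def)
  have "\<not> F extreme_point_of hardy1_ball"
  proof (rule not_extreme_point_inner_factor[OF holQ _ holomorphic_on_ident])
    fix s :: real assume s: "0 \<le> s" "s < 1"
    have "circle_mean Q s \<le> 1 / r" if r: "s < r" "r < 1" for r
    proof -
      have r0: "0 < r" using r s by linarith
      have "circle_mean Q s \<le> circle_mean Q r"
        by (rule circle_mean_cmod_mono[OF holQ]) (use s r in auto)
      also have "\<dots> = cmean (\<lambda>t. 1 / r * cmod (F (of_real r * cis t)))"
        using r0 by (simp add: FQ norm_mult)
      also have "\<dots> \<le> 1 / r" unfolding cmean_mult_left using cF[of r] r0 r by (simp add: field_simps)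
      finally show ?thesis .
    qed
    then have ev: "\<forall>\<^sub>F r in at_left 1. circle_mean Q s \<le> 1 / r"
      using s eventually_at_left_real[of s 1] by (auto elim!: eventually_mono)
    have "((\<lambda>r. 1 / r) \<longlongrightarrow> 1 / 1) (at_left (1::real))"
      by (intro tendsto_intros) auto
    then show "circle_mean Q s \<le> 1"
      using tendsto_lowerbound[OF _ ev] by simp
  qed (use FQ in auto)
  then show False using ext by simp
qed

text \<open>Let \<open>G\<close> be the majorant with the boundary log mean of \<open>F\<close>. If
  \<open>|F| < |G|\<close> throughout, \<open>F / G\<close> is a factor of modulus below
  \<open>1\<close> and \<open>F\<close> is not extreme; if equality holds at one point,
  \<open>F\<close> is a unimodular multiple of \<open>G\<close> and inherits its value at
  \<open>0\<close>.\<close>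

theorem extreme_point_hardy1_ball_imp_outer:
  assumes ext: "F extreme_point_of hardy1_ball"
  shows "outer_function F"
proof -
  have FS: "F \<in> hardy1_ball" using ext by (simp add: extreme_point_of_def)
  then have hol: "F holomorphic_on ball 0 1" and cF: "\<And>r. 0 \<le> r \<Longrightarrow> r < 1 \<Longrightarrow> circle_mean F r \<le> 1"
    by (auto simp: hardy1_ball_def disc_analytic_def)
  have F0: "F 0 \<noteq> 0" by (rule extreme_point_hardy1_ball_imp_nonzero[OF ext])
  note nt = hardy1_ball_nontangential[OF FS]
  have cFF: "cmean (\<lambda>t. max (cmod (F (of_real r * cis t))) (cmod (F (of_real r * cis t)))) \<le> 1" if "0 \<le> r" "r < 1" for r
    using cF[OF that] by simp
  have int: "integrable circ_meas (\<lambda>t. ln (cmod (boundary_function F t)))"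
    using boundary_function_log_mean(4)[OF hol F0 hol nt nt, of 1] cFF by simp
  obtain G where G: "G holomorphic_on ball 0 1" "\<And>z. z \<in> ball 0 1 \<Longrightarrow> G z \<noteq> 0"
    "cmod (G 0) = exp (cmean (\<lambda>t. ln (max (cmod (boundary_function F t)) (cmod (boundary_function F t)))))"
    "\<And>\<rho>. 0 \<le> \<rho> \<Longrightarrow> \<rho> < 1 \<Longrightarrow> circle_mean G \<rho> \<le> 1"
    "\<And>z. z \<in> ball 0 1 \<Longrightarrow> cmod (F z) \<le> cmod (G z)"
    "\<And>z. z \<in> ball 0 1 \<Longrightarrow> cmod (F z) \<le> cmod (G z)"
  proof (rule outer_majorant[OF hol F0 hol nt nt, where K = 1])
    show "cmean (\<lambda>t. max (cmod (F (of_real r * cis t))) (cmod (F (of_real r * cis t)))) \<le> 1" if "0 \<le> r" "r < 1" for r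
      by (rule cFF[OF that])
  qed blast
  have "\<exists>z0\<in>ball 0 1. cmod (F z0) = cmod (G z0)"
  proof (rule ccontr)
    assume "\<not> ?thesis"
    then have lt: "cmod (F z) < cmod (G z)" if "z \<in> ball 0 1" for z
      using that G(5)[OF that] by (meson order_le_less)
    have "\<not> F extreme_point_of hardy1_ball"
    proof (rule not_extreme_point_inner_factor[OF G(1,4)])
      show "(\<lambda>z. F z / G z) holomorphic_on ball 0 1" by (intro holomorphic_intros hol G)
      show "cmod (F z / G z) < 1" if "z \<in> ball 0 1" for z
        using lt[OF that] G(2)[OF that] by (simp add: norm_divide)
      show "F z = F z / G z * G z" if "z \<in> ball 0 1" for z
        using G(2)[OF that] by simp
    qed
    then show False using ext by simp
  qed
  then obtain z0 where z0: "z0 \<in> ball 0 1" "cmod (F z0) = cmod (G z0)" by blast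
  obtain c where c: "cmod c = 1" "\<And>z. z \<in> ball 0 1 \<Longrightarrow> F z = c * G z"
    by (rule unimodular_quotient_constant[OF hol G(1) _ _ z0]) (use G(2,5) in blast)+
  have "cmod (F 0) = exp (cmean (\<lambda>t. ln (cmod (boundary_function F t))))"
    using c(2)[of 0] c(1) G(3) by (simp add: norm_mult)
  then have "ln (cmod (F 0)) = cmean (\<lambda>t. ln (cmod (boundary_function F t)))" by simp
  moreover have "F \<in> hardy1" using FS by (simp add: hardy1_ball_eq)
  ultimately show ?thesis
    using F0 int unfolding outer_function_def by (simp add: cmean_def)
qed

section \<open>Outer functions of norm one are extreme\<close>

text \<open>If \<open>q\<close> has real boundary values, the means of \<open>(q - q 0)\<^sup>2\<close> force \<open>q = q 0\<close>.\<close>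

lemma bounded_real_boundary_constant:
  fixes q :: "complex \<Rightarrow> complex"
  assumes q: "q holomorphic_on ball 0 1" and B: "\<And>z. z \<in> ball 0 1 \<Longrightarrow> cmod (q z) \<le> B"
    and b: "AE t in circ_meas. (\<lambda>n. q (of_real (radii n) * cis t)) \<longlonglongrightarrow> b t"
    and bm: "b \<in> borel_measurable circ_meas" and re: "AE t in circ_meas. Im (b t) = 0"
    and z: "z \<in> ball 0 1"
  shows "q z = q 0"
proof -
  have r: "0 \<le> radii n" "radii n < 1" "0 < radii n" for n using radii by (auto simp: less_imp_le)
  have inb: "of_real (radii n) * cis t \<in> ball 0 1" for n t using r[of n] by (simp add: norm_mult)
  have meas: "(\<lambda>t. f (of_real (radii n) * cis t)) \<in> borel_measurable circ_meas" if "f holomorphic_on ball 0 1" for f n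
    by (intro borel_measurable_integrable circle_slice_integrable[OF that] r)
  have mean: "(LINT t|circ_meas. f (of_real (radii n) * cis t)) = 2 * pi * f 0" if f: "f holomorphic_on ball 0 1" for f :: "complex \<Rightarrow> complex" and n
  proof -
    have "(LINT t|circ_meas. f (of_real (radii n) * cis t)) = integral {0..2*pi} (\<lambda>t. f (of_real (radii n) * cis t))"
      by (rule lebesgue_integral_eq_integral[OF circle_slice_integrable[OF f r(1,2)]]) simp
    then show ?thesis using circle_mean_value[OF f r(3,2)] by simp
  qed
  define p where "p z = q z - q 0" for z
  have holp: "p holomorphic_on ball 0 1" unfolding p_def by (intro holomorphic_intros q)
  have B0: "0 \<le> B" using B[of 0] norm_ge_zero[of "q 0"] by (simp del: norm_ge_zero)
  have pB: "cmod (p z) \<le> 2 * B" if "z \<in> ball 0 1" for z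
    using norm_triangle_ineq4[of "q z" "q 0"] B[OF that] B[of 0] by (simp add: p_def)
  \<comment> \<open>The mean value property passes to the boundary, so \<open>q 0\<close> is a mean
    of real numbers and itself real.\<close>
  have "(\<lambda>n. LINT t|circ_meas. q (of_real (radii n) * cis t)) \<longlonglongrightarrow> (LINT t|circ_meas. b t)"
    by (rule integral_dominated_convergence[where w = "\<lambda>_. B"]) (use bm meas[OF q] b B inb in auto)
  then have q0: "2 * pi * q 0 = (LINT t|circ_meas. b t)"
    unfolding mean[OF q] by (rule LIMSEQ_unique[OF tendsto_const])
  have "(LINT t|circ_meas. b t) = (LINT t|circ_meas. of_real (Re (b t)))"
    by (rule integral_cong_AE) (use bm re in \<open>auto simp: complex_eq_iff elim!: eventually_mono\<close>)
  then have "Im (2 * pi * q 0) = 0"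
    unfolding q0 by simp
  then have Imq0: "Im (q 0) = 0" by simp
  have hp2: "(\<lambda>z. (p z)\<^sup>2) holomorphic_on ball 0 1" by (intro holomorphic_intros holp)
  have plim: "AE t in circ_meas. (\<lambda>n. p (of_real (radii n) * cis t)) \<longlonglongrightarrow> b t - q 0"
    using b unfolding p_def by eventually_elim (intro tendsto_intros)
  \<comment> \<open>The square itself, without modulus, is holomorphic and has mean
    \<open>(p 0)^2 = 0\<close>; on the boundary it is the square of a real number, so a zero
    integral forces it to vanish.\<close>
  have "(\<lambda>n. LINT t|circ_meas. (p (of_real (radii n) * cis t))\<^sup>2) \<longlonglongrightarrow> (LINT t|circ_meas. (b t - q 0)\<^sup>2)"
  proof (rule integral_dominated_convergence[where w = "\<lambda>_. (2 * B)\<^sup>2"])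
    show "AE t in circ_meas. (\<lambda>n. (p (of_real (radii n) * cis t))\<^sup>2) \<longlonglongrightarrow> (b t - q 0)\<^sup>2"
      using plim by eventually_elim (intro tendsto_intros)
    show "AE t in circ_meas. norm ((p (of_real (radii n) * cis t))\<^sup>2) \<le> (2 * B)\<^sup>2" for n
      using pB[OF inb] by (intro AE_I2) (simp only: norm_power, intro power_mono, auto)
  qed (use bm meas[OF hp2] in auto)
  then have i0: "(LINT t|circ_meas. (b t - q 0)\<^sup>2) = 0"
    unfolding mean[OF hp2] by (simp add: p_def LIMSEQ_const_iff)
  define v where "v t = Re (b t) - Re (q 0)" for t
  have v: "AE t in circ_meas. b t - q 0 = of_real (v t)"
    using re by eventually_elim (simp add: v_def complex_eq_iff Imq0)
  have vm: "v \<in> borel_measurable circ_meas" unfolding v_def using bm by measurable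
  have "(LINT t|circ_meas. (b t - q 0)\<^sup>2) = (LINT t|circ_meas. of_real ((v t)\<^sup>2))"
    by (rule integral_cong_AE) (use bm vm v in \<open>auto elim!: eventually_mono\<close>)
  then have v2: "(LINT t|circ_meas. (v t)\<^sup>2) = 0"
    using i0 by (metis integral_complex_of_real of_real_eq_0_iff)
  have bB: "AE t in circ_meas. cmod (b t - q 0) \<le> 2 * B"
    using plim
  proof eventually_elim
    case (elim t)
    show ?case by (rule LIMSEQ_le_const2[OF tendsto_norm[OF elim]]) (use pB[OF inb] in auto)
  qed
  have vi: "integrable circ_meas (\<lambda>t. (v t)\<^sup>2)"
  proof (rule circ.integrable_const_bound[where B = "(2 * B)\<^sup>2"])
    show "AE t in circ_meas. norm ((v t)\<^sup>2) \<le> (2 * B)\<^sup>2"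
      using bB v
    proof eventually_elim
      case (elim t)
      then have "\<bar>v t\<bar> \<le> 2 * B" by simp
      from power_mono[OF this abs_ge_zero, of 2] show ?case by simp
    qed
  qed (use vm in measurable)
  have "AE t in circ_meas. (v t)\<^sup>2 = 0"
    using integral_nonneg_eq_0_iff_AE[OF vi] v2 by simp
  with v have bq: "AE t in circ_meas. b t - q 0 = 0" by eventually_elim simp
  have "(\<lambda>n. LINT t|circ_meas. cmod (p (of_real (radii n) * cis t))) \<longlonglongrightarrow> (LINT t|circ_meas. 0)"
  proof (rule integral_dominated_convergence[where w = "\<lambda>_. 2 * B"])
    show "AE t in circ_meas. (\<lambda>n. cmod (p (of_real (radii n) * cis t))) \<longlonglongrightarrow> 0"
      using plim bq
    proof eventually_elim
      case (elim t)
      show ?case using tendsto_norm[OF elim(1)] elim(2) by simp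
    qed
  qed (use meas[OF holp] pB[OF inb] in auto)
  then have cl: "(\<lambda>n. circle_mean p (radii n)) \<longlonglongrightarrow> 0"
    unfolding cmean_def by (auto intro: tendsto_divide_zero)
  \<comment> \<open>Circle means increase with the radius, so means tending to \<open>0\<close>
    cannot be positive anywhere.\<close>
  have s0: "circle_mean p s \<le> 0" if s: "0 \<le> s" "s < 1" for s
  proof (rule LIMSEQ_le_const[OF cl])
    have "\<forall>\<^sub>F n in sequentially. s < radii n" using radii(3) s by (intro order_tendstoD(1)) auto
    then obtain N where N: "\<And>n. n \<ge> N \<Longrightarrow> s < radii n" unfolding eventually_sequentially by blast
    have "circle_mean p s \<le> circle_mean p (radii n)" if "n \<ge> N" for n
      by (rule circle_mean_cmod_mono[OF holp s(1) less_imp_le[OF N[OF that]] r(2)])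
    then show "\<exists>N. \<forall>n\<ge>N. circle_mean p s \<le> circle_mean p (radii n)" by blast
  qed
  define s where "s = (1 + cmod z) / 2"
  have s: "cmod z < s" "s < 1" "0 \<le> s" using z norm_ge_zero[of z] by (auto simp: s_def simp del: norm_ge_zero)
  have "cmod (p z) \<le> s / (s - cmod z) * circle_mean p s"
    by (rule cmod_le_circle_mean[OF holp s(1,2)])
  also have "\<dots> \<le> s / (s - cmod z) * 0"
    using s by (intro mult_left_mono s0) auto
  finally show ?thesis by (simp add: p_def)
qed

lemma nontangential_limit_cmult:
  assumes "has_nontangential_limit f t l"
  shows "has_nontangential_limit (\<lambda>z. c * f z) t (c * l)"
  using assms unfolding has_nontangential_limit_def by (auto intro!: tendsto_mult)

text \<open>The means of \<open>F\<close> exceed every number below \<open>1\<close>, so a bound on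
  the means of \<open>a * F\<close> is a bound on \<open>|a|\<close>.\<close>

lemma norm_one_multiple_le:
  assumes F: "F holomorphic_on ball 0 1" and n1: "\<And>s. s < 1 \<Longrightarrow> \<exists>r\<in>{0..<1}. s < circle_mean F r"
    and H: "\<And>z. z \<in> ball 0 1 \<Longrightarrow> H z = a * F z" and L: "0 \<le> L"
    and le: "\<And>r. 0 \<le> r \<Longrightarrow> r < 1 \<Longrightarrow> circle_mean H r \<le> L"
  shows "cmod a \<le> L"
proof (rule ccontr)
  assume gt: "\<not> cmod a \<le> L"
  then have a0: "0 < cmod a" using L by linarith
  then have "L / cmod a < 1" using gt by (simp add: pos_divide_less_eq)
  then obtain r where r: "r \<in> {0..<1}" "L / cmod a < circle_mean F r"
    using n1 by blast
  have "circle_mean H r = cmod a * circle_mean F r"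
    unfolding cmean_mult_left[symmetric] using r(1) by (simp add: H norm_mult)
  then have "cmod a * circle_mean F r \<le> L" using le[of r] r(1) by simp
  moreover have "L < circle_mean F r * cmod a"
    using r(2) a0 by (simp add: pos_divide_less_eq)
  ultimately show False by (simp add: mult.commute)
qed

text \<open>Norm one forces equality in \<open>|F| \<le> (1 - u) |P| + u |Q|\<close> almost
  everywhere on the boundary, so \<open>P / F\<close> is real there. Outerness of \<open>F\<close>
  bounds this quotient in the disc, a bounded function with real boundary values is constant, and
  the norms leave \<open>1\<close> as the only constant.\<close>

lemma outer_function_segment:
  assumes FS: "F \<in> hardy1_ball" and outer: "outer_function F"
    and n1: "\<And>s. s < 1 \<Longrightarrow> \<exists>r\<in>{0..<1}. s < circle_mean F r"
    and PS: "P \<in> hardy1_ball" and QS: "Q \<in> hardy1_ball" and u: "0 < u" "u < 1"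
    and eq: "\<And>z. F z = of_real (1 - u) * P z + of_real u * Q z"
    and z: "z \<in> ball 0 1"
  shows "P z = F z"
proof -
  have hol: "f holomorphic_on ball 0 1" and cm: "\<And>r. 0 \<le> r \<Longrightarrow> r < 1 \<Longrightarrow> circle_mean f r \<le> 1"
    if "f \<in> hardy1_ball" for f
    using that by (auto simp: hardy1_ball_def disc_analytic_def)
  note holF = hol[OF FS] and holP = hol[OF PS] and holQ = hol[OF QS]
  note nt = hardy1_ball_nontangential
  have r: "0 \<le> radii n" "radii n < 1" for n using radii by (auto simp: less_imp_le)
  note rad = boundary_function_radial[OF nt r radii(3)]
  have [measurable]: "boundary_function F \<in> borel_measurable circ_meas" "boundary_function P \<in> borel_measurable circ_meas"
     "boundary_function Q \<in> borel_measurable circ_meas"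
    using boundary_function_measurable[OF hol nt] FS PS QS by auto
  \<comment> \<open>The defect in the triangle inequality: nonnegative, with integral at most
    \<open>2*pi\<close> times \<open>1\<close> minus the mean of \<open>|F|\<close>, which becomes
    arbitrarily small.\<close>
  define w where "w n t = (1 - u) * cmod (P (of_real (radii n) * cis t)) + u * cmod (Q (of_real (radii n) * cis t))
      - cmod (F (of_real (radii n) * cis t))" for n t
  define wb where "wb t = (1 - u) * cmod (boundary_function P t) + u * cmod (boundary_function Q t)
      - cmod (boundary_function F t)" for t
  have isl: "integrable circ_meas (\<lambda>t. cmod (f (of_real (radii n) * cis t)))" if "f \<in> hardy1_ball" for f n
    by (intro integrable_norm circle_slice_integrable[OF hol[OF that]] r)
  have iw: "integrable circ_meas (w n)" for n
    unfolding w_def by (intro Bochner_Integration.integrable_add Bochner_Integration.integrable_diff integrable_mult_right isl FS PS QS)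
  have w0: "0 \<le> w n t" for n t
    using norm_triangle_ineq[of "of_real (1 - u) * P (of_real (radii n) * cis t)" "of_real u * Q (of_real (radii n) * cis t)"] u
    unfolding w_def eq norm_mult norm_of_real by simp
  have wlim: "AE t in circ_meas. (\<lambda>n. w n t) \<longlonglongrightarrow> wb t"
    using rad[OF FS] rad[OF PS] rad[OF QS] unfolding w_def wb_def
    by eventually_elim (intro tendsto_intros)
  have wbm: "wb \<in> borel_measurable circ_meas" unfolding wb_def by measurable
  have Iw: "integral\<^sup>L circ_meas (w n) \<le> 2*pi * (1 - circle_mean F (radii n))" for n
  proof -
    have "integral\<^sup>L circ_meas (w n) = 2*pi * ((1 - u) * circle_mean P (radii n)
        + u * circle_mean Q (radii n) - circle_mean F (radii n))"
      unfolding w_def cmean_def using isl[OF FS] isl[OF PS] isl[OF QS] by (simp add: field_simps)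
    also have "\<dots> \<le> 2*pi * ((1 - u) * 1 + u * 1 - circle_mean F (radii n))"
      using u cm[OF PS r, of n] cm[OF QS r, of n]
      by (intro mult_left_mono diff_right_mono add_mono) auto
    finally show ?thesis by simp
  qed
  have Iwb: "integrable circ_meas wb \<and> integral\<^sup>L circ_meas wb \<le> e" if e: "e > 0" for e
  proof -
    obtain s where s: "s \<in> {0..<1}" "1 - e / (2*pi) < circle_mean F s"
      using n1[of "1 - e / (2*pi)"] e by auto
    have "\<forall>\<^sub>F n in sequentially. s < radii n" using radii(3) s by (intro order_tendstoD(1)) auto
    then obtain N where N: "\<And>n. n \<ge> N \<Longrightarrow> s < radii n" unfolding eventually_sequentially by blast
    \<comment> \<open>Dropping the first \<open>N\<close> radii makes the bound valid for the entire
      sequence, as the limit lemma wants it.\<close>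
    have small: "integral\<^sup>L circ_meas (w (n + N)) \<le> e" for n
    proof -
      have "circle_mean F s \<le> circle_mean F (radii (n + N))"
        by (rule circle_mean_cmod_mono[OF holF _ less_imp_le[OF N] r(2)]) (use s(1) in auto)
      then have "1 - circle_mean F (radii (n + N)) \<le> e / (2*pi)" using s(2) by linarith
      then have "2*pi * (1 - circle_mean F (radii (n + N))) \<le> 2*pi * (e / (2*pi))"
        by (intro mult_left_mono) auto
      then show ?thesis using Iw[of "n + N"] by simp
    qed
    have lim': "AE t in circ_meas. (\<lambda>n. w (n + N) t) \<longlonglongrightarrow> wb t"
      using wlim by eventually_elim (rule LIMSEQ_ignore_initial_segment)
    show ?thesis
      using circ.integral_limit_le[of "\<lambda>n. w (n + N)" e wb, OF iw _ small lim' wbm] w0 by simp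
  qed
  have "integral\<^sup>L circ_meas wb \<le> 0" by (rule field_le_epsilon) (use Iwb in simp)
  moreover have wb0: "AE t in circ_meas. 0 \<le> wb t"
    using wlim by eventually_elim (use w0 in \<open>auto intro: LIMSEQ_le_const\<close>)
  ultimately have "integral\<^sup>L circ_meas wb = 0" using integral_nonneg_AE[OF wb0] by simp
  then have wbz: "AE t in circ_meas. wb t = 0"
    using integral_nonneg_eq_0_iff_AE[OF _ wb0] Iwb[of 1] by simp
  have Fb: "AE t in circ_meas. boundary_function F t = of_real (1 - u) * boundary_function P t + of_real u * boundary_function Q t"
    using rad[OF FS] rad[OF PS] rad[OF QS]
  proof eventually_elim
    case (elim t)
    have "(\<lambda>n. F (of_real (radii n) * cis t)) \<longlonglongrightarrow> of_real (1 - u) * boundary_function P t + of_real u * boundary_function Q t"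
      unfolding eq by (intro tendsto_intros elim)
    then show ?case using elim(1) by (rule LIMSEQ_unique[symmetric])
  qed
  \<comment> \<open>With the factor \<open>1 - u\<close> the boundary modulus of \<open>H\<close> is
    at most that of \<open>F\<close>, since the remaining term \<open>u |Q|\<close> of the equality
    is nonnegative.\<close>
  define H where "H z = of_real (1 - u) * P z" for z
  have holH: "H holomorphic_on ball 0 1" unfolding H_def by (intro holomorphic_intros holP)
  have ntH': "AE t in circ_meas. has_nontangential_limit H t (of_real (1 - u) * boundary_function P t)"
    using nt[OF PS] unfolding H_def
    by eventually_elim (intro nontangential_limit_cmult nontangential_limit_imp_boundary_function)
  then have ntH: "AE t in circ_meas. \<exists>l. has_nontangential_limit H t l" by eventually_elim blast
  have Hb: "AE t in circ_meas. boundary_function H t = of_real (1 - u) * boundary_function P t"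
    using ntH' by eventually_elim (rule boundary_function_eq)
  have [measurable]: "boundary_function H \<in> borel_measurable circ_meas"
    by (rule boundary_function_measurable[OF holH ntH])
  have F0: "F 0 \<noteq> 0" using outer by (simp add: outer_function_def)
  have K: "cmean (\<lambda>t. max (cmod (F (of_real s * cis t))) (cmod (H (of_real s * cis t)))) \<le> 2" if s: "0 \<le> s" "s < 1" for s
  proof -
    note c = continuous_on_circle[OF holF s] continuous_on_circle[OF holP s] continuous_on_circle[OF holH s]
    have "cmean (\<lambda>t. max (cmod (F (of_real s * cis t))) (cmod (H (of_real s * cis t))))
        \<le> cmean (\<lambda>t. cmod (F (of_real s * cis t)) + cmod (P (of_real s * cis t)))"
    proof (intro cmean_mono continuous_intros c)
      fix t
      have "cmod (H (of_real s * cis t)) = (1 - u) * cmod (P (of_real s * cis t))"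
        using u unfolding H_def norm_mult norm_of_real by simp
      also have "\<dots> \<le> cmod (P (of_real s * cis t))"
        using u by (intro mult_left_le_one_le) auto
      finally show "max (cmod (F (of_real s * cis t))) (cmod (H (of_real s * cis t)))
          \<le> cmod (F (of_real s * cis t)) + cmod (P (of_real s * cis t))"
        by (simp add: add_increasing add_increasing2)
    qed
    also have "\<dots> \<le> 1 + 1"
      using cm[OF FS s] cm[OF PS s] by (subst cmean_add) (auto intro!: continuous_intros c)
    finally show ?thesis by simp
  qed
  have Fpos: "AE t in circ_meas. 0 < max (cmod (boundary_function F t)) (cmod (boundary_function H t))"
    by (rule boundary_function_log_mean(3)[OF holF F0 holH nt[OF FS] ntH]) (rule K)
  have maxF: "AE t in circ_meas. max (cmod (boundary_function F t)) (cmod (boundary_function H t)) = cmod (boundary_function F t)"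
    using Hb wbz
  proof eventually_elim
    case (elim t)
    have "cmod (boundary_function H t) = (1 - u) * cmod (boundary_function P t)"
      unfolding elim(1) norm_mult norm_of_real using u by simp
    also have "\<dots> \<le> cmod (boundary_function F t)"
    proof -
      have "0 \<le> u * cmod (boundary_function Q t)" using u by simp
      then show ?thesis using elim(2) unfolding wb_def by linarith
    qed
    finally show ?case by simp
  qed
  obtain G where G: "G holomorphic_on ball 0 1" "\<And>z. z \<in> ball 0 1 \<Longrightarrow> G z \<noteq> 0"
    "cmod (G 0) = exp (cmean (\<lambda>t. ln (max (cmod (boundary_function F t)) (cmod (boundary_function H t)))))"
    "\<And>z. z \<in> ball 0 1 \<Longrightarrow> cmod (F z) \<le> cmod (G z)"
    "\<And>z. z \<in> ball 0 1 \<Longrightarrow> cmod (H z) \<le> cmod (G z)"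
  proof (rule outer_majorant[OF holF F0 holH nt[OF FS] ntH, where K = 2])
    show "cmean (\<lambda>t. max (cmod (F (of_real r * cis t))) (cmod (H (of_real r * cis t)))) \<le> 2" if "0 \<le> r" "r < 1" for r
      by (rule K[OF that])
  qed blast
  have "cmean (\<lambda>t. ln (max (cmod (boundary_function F t)) (cmod (boundary_function H t)))) = cmean (\<lambda>t. ln (cmod (boundary_function F t)))"
  proof -
    have "(LINT t|circ_meas. ln (max (cmod (boundary_function F t)) (cmod (boundary_function H t)))) =
        (LINT t|circ_meas. ln (cmod (boundary_function F t)))"
      by (rule integral_cong_AE) (use maxF in \<open>measurable, auto elim!: eventually_mono\<close>)
    then show ?thesis by (simp only: cmean_def)
  qed
  also have "\<dots> = ln (cmod (F 0))" using outer by (simp add: outer_function_def cmean_def)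
  \<comment> \<open>Equality of moduli at the single point \<open>0\<close> lets the maximum
    principle identify \<open>F\<close> with a unimodular multiple of \<open>G\<close>;
    \<open>|H| \<le> |F|\<close> in the disc follows.\<close>
  finally have FG: "cmod (F 0) = cmod (G 0)" using G(3) F0 by simp
  obtain c where c: "cmod c = 1" "\<And>z. z \<in> ball 0 1 \<Longrightarrow> F z = c * G z"
    by (rule unimodular_quotient_constant[OF holF G(1) _ _ centre_in_ball[THEN iffD2, OF zero_less_one] FG]) (use G(2,4) in blast)+
  have Fnz: "F z \<noteq> 0" if "z \<in> ball 0 1" for z
    using c(2)[OF that] c(1) G(2)[OF that] by auto
  have HF: "cmod (H z) \<le> cmod (F z)" if "z \<in> ball 0 1" for z
    using G(5)[OF that] c(2)[OF that] c(1) by (simp add: norm_mult)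
  define q where "q z = P z / F z" for z
  have holq: "q holomorphic_on ball 0 1" unfolding q_def by (intro holomorphic_intros holP holF Fnz)
  have qB: "cmod (q z) \<le> 1 / (1 - u)" if z: "z \<in> ball 0 1" for z
  proof -
    have "(1 - u) * cmod (P z) \<le> cmod (F z)"
      using HF[OF z] u unfolding H_def norm_mult norm_of_real by simp
    then show ?thesis using Fnz[OF z] u by (simp add: q_def norm_divide field_simps)
  qed
  define b where "b t = boundary_function P t / boundary_function F t" for t
  have Fbnz: "AE t in circ_meas. boundary_function F t \<noteq> 0"
    using Fpos maxF by eventually_elim auto
  have qlim: "AE t in circ_meas. (\<lambda>n. q (of_real (radii n) * cis t)) \<longlonglongrightarrow> b t"
    using rad[OF PS] rad[OF FS] Fbnz unfolding q_def b_def by eventually_elim (intro tendsto_intros)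
  have bm: "b \<in> borel_measurable circ_meas" unfolding b_def by measurable
  have re: "AE t in circ_meas. Im (b t) = 0"
    using wbz Fb Fbnz
  proof eventually_elim
    case (elim t)
    \<comment> \<open>\<open>p\<close> and \<open>s\<close> add up to \<open>1\<close>, and so do
      their moduli; each real part then has to equal the modulus.\<close>
    define p where "p = of_real (1 - u) * b t"
    define s where "s = of_real u * boundary_function Q t / boundary_function F t"
    have ps: "p + s = 1"
      using elim(2,3) by (simp add: p_def s_def b_def add_divide_distrib[symmetric])
    have "cmod p + cmod s = ((1 - u) * cmod (boundary_function P t) + u * cmod (boundary_function Q t)) / cmod (boundary_function F t)"
      using u unfolding p_def s_def b_def norm_mult norm_divide norm_of_real by (simp add: add_divide_distrib)
    also have "\<dots> = 1" using elim(1,3) by (simp add: wb_def)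
    finally have n: "cmod p + cmod s = 1" .
    have "Re p + Re s = 1" using arg_cong[OF ps, of Re] by simp
    with n complex_Re_le_cmod[of p] complex_Re_le_cmod[of s] have "Re p = cmod p" by linarith
    then have "Im p = 0" using cmod_power2[of p] by simp
    then show ?case using u by (simp add: p_def)
  qed
  have qc: "q z = q 0" if "z \<in> ball 0 1" for z
    by (rule bounded_real_boundary_constant[OF holq qB qlim bm re that])
  have PF: "P z = q 0 * F z" if "z \<in> ball 0 1" for z
    using qc[OF that] Fnz[OF that] by (simp add: q_def field_simps)
  \<comment> \<open>The norms of \<open>P = q 0 * F\<close> and
    \<open>u * Q = (1 - (1 - u) * q 0) * F\<close> confine \<open>q 0\<close> to the two discs
    \<open>|q| \<le> 1\<close> and \<open>|1 - (1 - u) q| \<le> u\<close>, which touch only at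
    \<open>1\<close>.\<close>
  have q1: "cmod (q 0) \<le> 1"
    by (rule norm_one_multiple_le[OF holF n1 PF]) (use cm[OF PS] in auto)
  have uQ: "of_real u * Q z = (1 - of_real (1 - u) * q 0) * F z" if "z \<in> ball 0 1" for z
    using eq[of z] PF[OF that] by (simp add: algebra_simps)
  have "cmod (1 - of_real (1 - u) * q 0) \<le> u"
  proof (rule norm_one_multiple_le[OF holF n1 uQ])
    fix s :: real assume s: "0 \<le> s" "s < 1"
    have "cmean (\<lambda>t. cmod (of_real u * Q (of_real s * cis t))) = u * circle_mean Q s"
      unfolding cmean_mult_left[symmetric] using u by (simp add: norm_mult)
    also have "\<dots> \<le> u" using cm[OF QS s] u by simp
    finally show "cmean (\<lambda>t. cmod (of_real u * Q (of_real s * cis t))) \<le> u" .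
  qed (use u in auto)
  then have "1 - (1 - u) * Re (q 0) \<le> u"
    using complex_Re_le_cmod[of "1 - of_real (1 - u) * q 0"] by simp
  then have "(1 - u) * 1 \<le> (1 - u) * Re (q 0)" by simp
  then have R1: "1 \<le> Re (q 0)" using u by (simp only: mult_le_cancel_left_pos diff_gt_0_iff_gt)
  have "(Re (q 0))\<^sup>2 + (Im (q 0))\<^sup>2 \<le> 1"
    using power_mono[OF q1 norm_ge_zero, of 2] by (simp add: cmod_power2)
  moreover have "1 \<le> (Re (q 0))\<^sup>2" using power_mono[OF R1, of 2] by simp
  ultimately have "Im (q 0) = 0" by (smt (verit) zero_le_power2 power2_eq_iff_nonneg zero_eq_power2)
  moreover have "Re (q 0) = 1" using R1 q1 complex_Re_le_cmod[of "q 0"] by linarith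
  ultimately have "q 0 = 1" by (simp add: complex_eq_iff)
  then show ?thesis using PF[OF z] by simp
qed

theorem outer_function_imp_extreme_point:
  assumes FS: "F \<in> hardy1_ball" and outer: "outer_function F"
    and n1: "\<And>s. s < 1 \<Longrightarrow> \<exists>r\<in>{0..<1}. s < circle_mean F r"
  shows "F extreme_point_of hardy1_ball"
  unfolding extreme_point_of_def
proof (intro conjI ballI notI)
  fix P Q assume PS: "P \<in> hardy1_ball" and QS: "Q \<in> hardy1_ball" and seg: "F \<in> open_segment P Q"
  then obtain u where u: "P \<noteq> Q" "0 < u" "u < 1" "F = (1 - u) *\<^sub>R P + u *\<^sub>R Q"
    unfolding in_segment by blast
  have eq: "F z = of_real (1 - u) * P z + of_real u * Q z" for z
    unfolding u(4) by (simp add: scaleR_fun_def plus_fun_def scaleR_conv_of_real)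
  have PF: "P z = F z" if "z \<in> ball 0 1" for z
    by (rule outer_function_segment[OF FS outer n1 PS QS u(2,3) eq that])
  have "P = Q"
  proof (rule disc_analytic_eqI)
    show "P z = Q z" if "z \<in> ball 0 1" for z
      using eq[of z] PF[OF that] u(2) by (simp add: algebra_simps)
  qed (use PS QS in \<open>auto simp: hardy1_ball_def\<close>)
  with u(1) show False by simp
qed (rule FS)

section \<open>The Lorentz norm by layers\<close>

definition distribution :: "(real \<Rightarrow> complex) \<Rightarrow> real \<Rightarrow> real"
  where "distribution x \<tau> = measure circ_meas {s \<in> {0..2*pi}. cmod (x s) > \<tau>}"

lemma space_circ_meas: "space circ_meas = {0..2*pi}"
  by simp

lemma measure_circ_meas: "measure circ_meas {0..2*pi} = 2*pi"
  by (simp add: measure_restrict_space)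

lemma distribution_set:
  assumes [measurable]: "x \<in> borel_measurable circ_meas"
  shows "{s \<in> {0..2*pi}. cmod (x s) > \<tau>} \<in> sets circ_meas"
proof -
  have "{s \<in> space circ_meas. cmod (x s) > \<tau>} \<in> sets circ_meas" by measurable
  then show ?thesis by (simp only: space_circ_meas)
qed

lemma distribution_nonneg: "0 \<le> distribution x \<tau>"
  by (simp add: distribution_def)

lemma distribution_le: "distribution x \<tau> \<le> 2*pi"
  using circ.bounded_measure[of "{s \<in> {0..2*pi}. cmod (x s) > \<tau>}"]
  unfolding distribution_def space_circ_meas measure_circ_meas .

lemma distribution_antimono:
  assumes "x \<in> borel_measurable circ_meas" "\<sigma> \<le> \<tau>"
  shows "distribution x \<tau> \<le> distribution x \<sigma>"
  unfolding distribution_def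
  by (rule circ.finite_measure_mono[OF _ distribution_set[OF assms(1)]]) (use assms in auto)

lemma distribution_measurable [measurable]:
  assumes x: "x \<in> borel_measurable circ_meas"
  shows "distribution x \<in> borel_measurable borel"
proof -
  have "(\<lambda>\<tau>. - distribution x \<tau>) \<in> borel_measurable borel"
    by (intro borel_measurable_mono monoI) (simp add: distribution_antimono[OF x])
  from borel_measurable_uminus[OF this] show ?thesis by simp
qed

lemma distribution_tendsto_0:
  assumes x: "x \<in> borel_measurable circ_meas"
  shows "(\<lambda>n. distribution x (real n)) \<longlonglongrightarrow> 0"
proof -
  have "(\<lambda>n. measure circ_meas {s \<in> {0..2*pi}. cmod (x s) > real n}) \<longlonglongrightarrow>
      measure circ_meas (\<Inter>n. {s \<in> {0..2*pi}. cmod (x s) > real n})"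
    by (rule circ.finite_Lim_measure_decseq)
       (use distribution_set[OF x] in \<open>auto simp: decseq_def\<close>)
  moreover have "(\<Inter>n. {s \<in> {0..2*pi}. cmod (x s) > real n}) = {}"
  proof (intro equals0I)
    fix s assume s: "s \<in> (\<Inter>n. {s \<in> {0..2*pi}. cmod (x s) > real n})"
    obtain n where "cmod (x s) \<le> real n" using real_arch_simple by auto
    moreover have "cmod (x s) > real n" using s by blast
    ultimately show False by simp
  qed
  ultimately show ?thesis by (simp add: distribution_def)
qed

text \<open>The superlevel sets at \<open>\<tau> + 1 / (n + 1)\<close> increase to the one at
  \<open>\<tau>\<close>, because the latter is defined by a strict inequality.\<close>

lemma distribution_right_continuous:
  assumes x: "x \<in> borel_measurable circ_meas" and t: "t < distribution x \<tau>"
  shows "\<exists>\<sigma>>\<tau>. t < distribution x \<sigma>"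
proof -
  define S where "S n = {s \<in> {0..2*pi}. cmod (x s) > \<tau> + 1 / real (Suc n)}" for n
  have "(\<lambda>n. measure circ_meas (S n)) \<longlonglongrightarrow> measure circ_meas (\<Union>n. S n)"
  proof (rule circ.finite_Lim_measure_incseq)
    show "range S \<subseteq> sets circ_meas" using distribution_set[OF x] by (auto simp: S_def)
    have "1 / real (Suc n) \<le> 1 / real (Suc m)" if "m \<le> n" for m n
      using that by (intro frac_le) auto
    then show "incseq S" unfolding incseq_def S_def by (force intro: le_less_trans)
  qed
  moreover have "(\<Union>n. S n) = {s \<in> {0..2*pi}. cmod (x s) > \<tau>}"
  proof (intro set_eqI iffI)
    fix s assume s: "s \<in> {s \<in> {0..2*pi}. cmod (x s) > \<tau>}"
    then have "0 < cmod (x s) - \<tau>" by simp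
    then obtain n where "1 / real (Suc n) < cmod (x s) - \<tau>" by (rule nat_approx_posE)
    then have "s \<in> S n" using s by (simp add: S_def)
    then show "s \<in> (\<Union>n. S n)" by blast
  next
    fix s assume "s \<in> (\<Union>n. S n)"
    then obtain n where n: "s \<in> S n" by blast
    then have s: "s \<in> {0..2*pi}" "\<tau> + 1 / real (Suc n) < cmod (x s)" by (simp_all add: S_def)
    have "0 < 1 / real (Suc n)" by simp
    with s(2) have "\<tau> < cmod (x s)" by linarith
    with s(1) show "s \<in> {s \<in> {0..2*pi}. cmod (x s) > \<tau>}" by simp
  qed
  ultimately have "(\<lambda>n. measure circ_meas (S n)) \<longlonglongrightarrow> distribution x \<tau>"
    by (simp add: distribution_def)
  then have "\<forall>\<^sub>F n in sequentially. t < measure circ_meas (S n)"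
    using t by (rule order_tendstoD(1))
  then obtain n where n: "t < measure circ_meas (S n)"
    using eventually_happens'[OF sequentially_bot] by blast
  show ?thesis
    by (rule exI[of _ "\<tau> + 1 / real (Suc n)"]) (use n in \<open>simp add: distribution_def S_def\<close>)
qed

text \<open>Right continuity of the distribution function makes this inversion exact at every level.
  For \<open>0 < t\<close> the set under \<open>Inf\<close> is nonempty because the distribution
  function tends to \<open>0\<close>, so the infimum is genuine.\<close>

lemma decreasing_rearrangement_greater_iff:
  assumes x: "x \<in> borel_measurable circ_meas" and t: "0 < t" and \<tau>: "0 \<le> \<tau>"
  shows "\<tau> < decreasing_rearrangement x t \<longleftrightarrow> t < distribution x \<tau>"
    and decreasing_rearrangement_nonneg: "0 \<le> decreasing_rearrangement x t"
proof -
  define A where "A = {\<tau>. 0 \<le> \<tau> \<and> distribution x \<tau> \<le> t}"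
  have dr: "decreasing_rearrangement x t = Inf A"
    by (simp add: decreasing_rearrangement_def A_def distribution_def)
  have "\<forall>\<^sub>F n in sequentially. distribution x (real n) < t"
    using distribution_tendsto_0[OF x] t by (rule order_tendstoD(2))
  then obtain n where "distribution x (real n) < t"
    using eventually_happens'[OF sequentially_bot] by blast
  then have "real n \<in> A" by (simp add: A_def)
  then have ne: "A \<noteq> {}" by blast
  have bdd: "bdd_below A" by (intro bdd_belowI[of _ 0]) (simp add: A_def)
  show "0 \<le> decreasing_rearrangement x t"
    unfolding dr by (rule cInf_greatest[OF ne]) (simp add: A_def)
  show "\<tau> < decreasing_rearrangement x t \<longleftrightarrow> t < distribution x \<tau>"
  proof
    assume "\<tau> < decreasing_rearrangement x t"
    then have "\<tau> \<notin> A" unfolding dr using cInf_lower[OF _ bdd] by force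
    then show "t < distribution x \<tau>" using \<tau> by (simp add: A_def)
  next
    assume "t < distribution x \<tau>"
    then obtain \<sigma> where \<sigma>: "\<tau> < \<sigma>" "t < distribution x \<sigma>"
      using distribution_right_continuous[OF x] by blast
    have "\<sigma> \<le> Inf A"
    proof (rule cInf_greatest[OF ne], rule ccontr)
      fix \<rho> assume \<rho>: "\<rho> \<in> A" "\<not> \<sigma> \<le> \<rho>"
      then have "distribution x \<sigma> \<le> distribution x \<rho>" by (intro distribution_antimono[OF x]) simp
      then show False using \<sigma>(2) \<rho>(1) by (simp add: A_def)
    qed
    then show "\<tau> < decreasing_rearrangement x t" using \<sigma>(1) by (simp add: dr)
  qed
qed

locale lorentz_weight =
  fixes \<phi> :: "real \<Rightarrow> real"
  assumes strict: "strict_mono_on {0..2*pi} \<phi>"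
    and conc: "concave_on {0..2*pi} \<phi>"
    and cont: "continuous_on {0..2*pi} \<phi>"
    and zero: "\<phi> 0 = 0" and one: "\<phi> (2*pi) = 1"
begin

definition weight_ext :: "real \<Rightarrow> real" where "weight_ext t = \<phi> (max 0 (min (2*pi) t))"

lemma weight_ext_eq: "0 \<le> t \<Longrightarrow> t \<le> 2*pi \<Longrightarrow> weight_ext t = \<phi> t"
  by (simp add: weight_ext_def)

lemma weight_mono: "0 \<le> s \<Longrightarrow> s \<le> t \<Longrightarrow> t \<le> 2*pi \<Longrightarrow> \<phi> s \<le> \<phi> t"
  using strict_mono_on_leD[OF strict, of s t] by simp

lemma weight_ext_mono: "s \<le> t \<Longrightarrow> weight_ext s \<le> weight_ext t"
  unfolding weight_ext_def by (intro weight_mono) auto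

lemma weight_ext_cont: "continuous_on UNIV weight_ext"
  unfolding weight_ext_def by (intro continuous_on_compose2[OF cont] continuous_intros) auto

lemma stieltjes_eq: "stieltjes \<phi> = interval_measure weight_ext"
  unfolding stieltjes_def weight_ext_def ..

lemma sets_stieltjes [measurable_cong]: "sets (stieltjes \<phi>) = sets borel"
  by (simp add: stieltjes_eq)

lemma sigma_finite_stieltjes: "sigma_finite_measure (stieltjes \<phi>)"
  unfolding stieltjes_eq using weight_ext_mono weight_ext_cont
  by (intro sigma_finite_interval_measure) (auto simp: continuous_on_eq_continuous_within intro: continuous_within_subset)

lemma emeasure_stieltjes:
  assumes "0 \<le> d" "d \<le> 2*pi"
  shows "emeasure (stieltjes \<phi>) {0<..<d} = ennreal (\<phi> d)"
proof (cases "d = 0")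
  case False
  then have "emeasure (stieltjes \<phi>) {0<..<d} = ennreal (weight_ext d - weight_ext 0)"
    unfolding stieltjes_eq using assms by (intro emeasure_interval_measure_Ioo weight_ext_mono weight_ext_cont) auto
  then show ?thesis using assms by (simp add: weight_ext_eq zero)
qed (simp add: zero)

text \<open>Fubini over the region \<open>t < distribution x \<tau>\<close>. Afterwards
  \<open>\<phi>\<close> acts on one level at a time, so a pointwise inequality for
  \<open>\<phi>\<close> integrates to an inequality between norms.\<close>

lemma lorentz_norm_layer_cake:
  assumes x: "x \<in> borel_measurable circ_meas"
  shows "lorentz_norm \<phi> x = (\<integral>\<^sup>+\<tau>. ennreal (\<phi> (distribution x \<tau>)) * indicator {0..} \<tau> \<partial>lborel)"
proof -
  interpret S: sigma_finite_measure "stieltjes \<phi>" by (rule sigma_finite_stieltjes)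
  interpret SL: pair_sigma_finite "stieltjes \<phi>" lborel ..
  note [measurable] = distribution_measurable[OF x]
  define f :: "real \<Rightarrow> real \<Rightarrow> ennreal" where
    "f t \<tau> = indicator {0<..2*pi} t * indicator {0..} \<tau> * (if t < distribution x \<tau> then 1 else 0)" for t \<tau>
  have fm: "case_prod f \<in> borel_measurable (stieltjes \<phi> \<Otimes>\<^sub>M lborel)"
    unfolding f_def by measurable
  have 1: "ennreal (decreasing_rearrangement x t) * indicator {0<..2*pi} t = (\<integral>\<^sup>+\<tau>. f t \<tau> \<partial>lborel)" for t
  proof (cases "t \<in> {0<..2*pi}")
    case True
    then have t: "0 < t" by simp
    have "f t \<tau> = indicator {0..<decreasing_rearrangement x t} \<tau>" for \<tau>
      using True decreasing_rearrangement_greater_iff[OF x t, of \<tau>] by (auto simp: f_def indicator_def)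
    then have "(\<integral>\<^sup>+\<tau>. f t \<tau> \<partial>lborel) = emeasure lborel {0..<decreasing_rearrangement x t}"
      by simp
    also have "\<dots> = ennreal (decreasing_rearrangement x t)"
      using decreasing_rearrangement_nonneg[OF x t order_refl] by simp
    finally show ?thesis using True by simp
  qed (simp add: f_def)
  have 2: "(\<integral>\<^sup>+t. f t \<tau> \<partial>stieltjes \<phi>) = ennreal (\<phi> (distribution x \<tau>)) * indicator {0..} \<tau>" for \<tau>
  proof -
    have "f t \<tau> = indicator {0..} \<tau> * indicator {0<..<distribution x \<tau>} t" for t
      using distribution_le[of x \<tau>] by (auto simp: f_def indicator_def)
    then have "(\<integral>\<^sup>+t. f t \<tau> \<partial>stieltjes \<phi>) = indicator {0..} \<tau> * emeasure (stieltjes \<phi>) {0<..<distribution x \<tau>}"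
      by (simp add: nn_integral_cmult_indicator stieltjes_eq)
    then show ?thesis
      unfolding emeasure_stieltjes[OF distribution_nonneg distribution_le] by (simp only: mult.commute)
  qed
  have "lorentz_norm \<phi> x = (\<integral>\<^sup>+t. (\<integral>\<^sup>+\<tau>. f t \<tau> \<partial>lborel) \<partial>stieltjes \<phi>)"
    unfolding lorentz_norm_def 1 ..
  also have "\<dots> = (\<integral>\<^sup>+\<tau>. (\<integral>\<^sup>+t. f t \<tau> \<partial>stieltjes \<phi>) \<partial>lborel)"
    by (rule SL.Fubini'[OF fm, symmetric])
  finally show ?thesis unfolding 2 .
qed

end

lemma circ_lborel: "pair_sigma_finite circ_meas lborel"
  by (intro pair_sigma_finite.intro circ.sigma_finite_measure_axioms lborel.sigma_finite_measure_axioms)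

text \<open>A level between \<open>a\<close> and \<open>|x s|\<close> lies in the superlevel set if
  it is above \<open>a\<close> and in the complement if below. When \<open>a\<close> is a median the
  integrand is \<open>min m (2*pi - m)\<close> with \<open>m\<close> the distribution at
  \<open>\<tau>\<close>: the tent of \<open>weight_gap\<close>.\<close>

lemma nn_integral_deviation_layer_cake:
  assumes x: "x \<in> borel_measurable circ_meas" and a: "0 \<le> a"
  shows "(\<integral>\<^sup>+s. ennreal \<bar>cmod (x s) - a\<bar> \<partial>circ_meas) =
    (\<integral>\<^sup>+\<tau>. ennreal (if a \<le> \<tau> then distribution x \<tau> else 2*pi - distribution x \<tau>) * indicator {0..} \<tau> \<partial>lborel)"
proof -
  interpret CL: pair_sigma_finite circ_meas lborel by (rule circ_lborel)
  note [measurable] = x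
  define f :: "real \<Rightarrow> real \<Rightarrow> ennreal" where
    "f s \<tau> = indicator {0..} \<tau> * (if (a \<le> \<tau> \<and> \<tau> < cmod (x s)) \<or> (\<tau> < a \<and> cmod (x s) \<le> \<tau>) then 1 else 0)" for s \<tau>
  have fm: "case_prod f \<in> borel_measurable (circ_meas \<Otimes>\<^sub>M lborel)"
    unfolding f_def by measurable
  have 1: "ennreal \<bar>cmod (x s) - a\<bar> = (\<integral>\<^sup>+\<tau>. f s \<tau> \<partial>lborel)" for s
  proof -
    have "f s \<tau> = indicator {min a (cmod (x s))..<max a (cmod (x s))} \<tau>" for \<tau>
      using a norm_ge_zero[of "x s"] by (auto simp: f_def indicator_def min_def max_def simp del: norm_ge_zero)
    then have "(\<integral>\<^sup>+\<tau>. f s \<tau> \<partial>lborel) = emeasure lborel {min a (cmod (x s))..<max a (cmod (x s))}"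
      by simp
    also have "\<dots> = ennreal \<bar>cmod (x s) - a\<bar>"
      by (auto simp: min_def max_def abs_real_def)
    finally show ?thesis ..
  qed
  have 2: "(\<integral>\<^sup>+s. f s \<tau> \<partial>circ_meas) = ennreal (if a \<le> \<tau> then distribution x \<tau> else 2*pi - distribution x \<tau>) * indicator {0..} \<tau>" for \<tau>
  proof -
    define S where "S = {s \<in> {0..2*pi}. cmod (x s) > \<tau>}"
    have S: "S \<in> sets circ_meas" unfolding S_def by (rule distribution_set[OF x])
    have S': "space circ_meas - S \<in> sets circ_meas" using S by (rule sets.compl_sets)
    have mS: "emeasure circ_meas S = ennreal (distribution x \<tau>)"
      unfolding distribution_def S_def[symmetric] by (rule circ.emeasure_eq_measure)
    have mS': "emeasure circ_meas (space circ_meas - S) = ennreal (2*pi - distribution x \<tau>)"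
      unfolding circ.emeasure_eq_measure circ.finite_measure_compl[OF S] distribution_def S_def[symmetric]
      unfolding space_circ_meas measure_circ_meas ..
    show ?thesis
    proof (cases "a \<le> \<tau>")
      case True
      have "(\<integral>\<^sup>+s. f s \<tau> \<partial>circ_meas) = (\<integral>\<^sup>+s. indicator {0..} \<tau> * indicator S s \<partial>circ_meas)"
        by (rule nn_integral_cong) (use True in \<open>auto simp: f_def S_def indicator_def\<close>)
      also have "\<dots> = indicator {0..} \<tau> * emeasure circ_meas S" by (rule nn_integral_cmult_indicator[OF S])
      finally show ?thesis unfolding mS using True by (simp add: mult.commute)
    next
      case False
      have "(\<integral>\<^sup>+s. f s \<tau> \<partial>circ_meas) = (\<integral>\<^sup>+s. indicator {0..} \<tau> * indicator (space circ_meas - S) s \<partial>circ_meas)"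
        by (rule nn_integral_cong) (use False in \<open>auto simp: f_def S_def indicator_def\<close>)
      also have "\<dots> = indicator {0..} \<tau> * emeasure circ_meas (space circ_meas - S)" by (rule nn_integral_cmult_indicator[OF S'])
      finally show ?thesis unfolding mS' using False by (simp add: mult.commute)
    qed
  qed
  have "(\<integral>\<^sup>+s. ennreal \<bar>cmod (x s) - a\<bar> \<partial>circ_meas) = (\<integral>\<^sup>+s. (\<integral>\<^sup>+\<tau>. f s \<tau> \<partial>lborel) \<partial>circ_meas)"
    by (rule nn_integral_cong) (rule 1)
  also have "\<dots> = (\<integral>\<^sup>+\<tau>. (\<integral>\<^sup>+s. f s \<tau> \<partial>circ_meas) \<partial>lborel)"
    by (rule CL.Fubini'[OF fm, symmetric])
  finally show ?thesis unfolding 2 .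
qed

lemma nn_integral_layer_cake:
  assumes x: "x \<in> borel_measurable circ_meas"
  shows "(\<integral>\<^sup>+s. ennreal (cmod (x s)) \<partial>circ_meas) = (\<integral>\<^sup>+\<tau>. ennreal (distribution x \<tau>) * indicator {0..} \<tau> \<partial>lborel)"
proof -
  have "(\<integral>\<^sup>+s. ennreal (cmod (x s)) \<partial>circ_meas) = (\<integral>\<^sup>+s. ennreal \<bar>cmod (x s) - 0\<bar> \<partial>circ_meas)" by simp
  also have "\<dots> = (\<integral>\<^sup>+\<tau>. ennreal (if 0 \<le> \<tau> then distribution x \<tau> else 2*pi - distribution x \<tau>) * indicator {0..} \<tau> \<partial>lborel)"
    by (rule nn_integral_deviation_layer_cake[OF x order_refl])
  also have "\<dots> = (\<integral>\<^sup>+\<tau>. ennreal (distribution x \<tau>) * indicator {0..} \<tau> \<partial>lborel)"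
    by (rule nn_integral_cong) (auto simp: indicator_def)
  finally show ?thesis .
qed

section \<open>Nonlinear weights: the coordinate function is extreme\<close>

definition disc_id :: "complex \<Rightarrow> complex"
  where "disc_id z = (if z \<in> ball 0 1 then z else 0)"

lemma disc_id_not_outer: "\<not> outer_function disc_id"
  by (simp add: outer_function_def disc_id_def)

text \<open>Rests on \<open>u (1 - u) |q - p|^2 = (1 - u) |p|^2 + u |q|^2 - |z|^2\<close>. The free
  threshold \<open>d\<close> turns this quadratic identity into a bound linear in the deviations of
  \<open>|p|\<close> and \<open>|q|\<close> from \<open>1\<close>, whose means are the controlled
  quantities.\<close>

lemma cmod_diff_estimate:
  fixes p q z :: complex
  assumes u: "0 < u" "u < 1" and z: "z = of_real (1 - u) * p + of_real u * q" "cmod z = r" "r \<le> 1" and d: "d > 0"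
  shows "cmod (q - p) \<le> d + ((1 + 2 / d) * (\<bar>cmod p - 1\<bar> + \<bar>cmod q - 1\<bar>) + (1 - r\<^sup>2) / d) / (u * (1 - u))"
proof -
  define e where "e = q - p"
  have r0: "0 \<le> r" using z(2) by auto
  have r2: "r\<^sup>2 \<le> 1" using r0 z(3) by (simp add: power_le_one)
  have uu: "0 < u * (1 - u)" using u by simp
  have p: "p = z - of_real u * e" and q: "q = z + of_real (1 - u) * e"
    unfolding z(1) e_def by (simp_all add: algebra_simps)
  have id: "u * (1 - u) * (cmod e)\<^sup>2 = (1 - u) * ((cmod p)\<^sup>2 - 1) + u * ((cmod q)\<^sup>2 - 1) + (1 - r\<^sup>2)"
  proof -
    have "(1 - u) * (cmod p)\<^sup>2 + u * (cmod q)\<^sup>2 = (cmod z)\<^sup>2 + u * (1 - u) * (cmod e)\<^sup>2"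
      unfolding p q cmod_power2 by (simp add: power2_eq_square algebra_simps)
    then show ?thesis using z(2) by (simp add: algebra_simps)
  qed
  show ?thesis
  proof (cases "cmod e \<le> d")
    case True
    have "0 \<le> ((1 + 2 / d) * (\<bar>cmod p - 1\<bar> + \<bar>cmod q - 1\<bar>) + (1 - r\<^sup>2) / d) / (u * (1 - u))"
      using d uu r2 by (intro divide_nonneg_pos add_nonneg_nonneg mult_nonneg_nonneg) auto
    with True show ?thesis unfolding e_def by linarith
  next
    case False
    \<comment> \<open>Beyond the threshold one division by \<open>|e|\<close> is affordable:
      \<open>|p| + 1\<close> and \<open>|q| + 1\<close> are at most \<open>|e| + 2\<close>, and
      \<open>(|e| + 2) / |e| \<le> 1 + 2 / d\<close>.\<close>
    then have ed: "d < cmod e" by simp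
    have pe: "cmod p + 1 \<le> cmod e + 2"
    proof -
      have "cmod p \<le> cmod z + u * cmod e"
        unfolding p using norm_triangle_ineq4[of z "of_real u * e"] u by (simp add: norm_mult)
      also have "u * cmod e \<le> cmod e" using u by (intro mult_left_le_one_le) auto
      finally show ?thesis using z by simp
    qed
    have qe: "cmod q + 1 \<le> cmod e + 2"
    proof -
      have "cmod (of_real (1 - u) * e) = (1 - u) * cmod e" using u unfolding norm_mult norm_of_real by simp
      then have "cmod q \<le> cmod z + (1 - u) * cmod e"
        unfolding q using norm_triangle_ineq[of z "of_real (1 - u) * e"] by simp
      also have "(1 - u) * cmod e \<le> cmod e" using u by (intro mult_left_le_one_le) auto
      finally show ?thesis using z by simp
    qed
    have sq: "v * (s\<^sup>2 - 1) \<le> \<bar>s - 1\<bar> * (cmod e + 2)" if "0 \<le> v" "v \<le> 1" "0 \<le> s" "s + 1 \<le> cmod e + 2" for v s :: real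
    proof -
      have "v * (s\<^sup>2 - 1) = v * ((s - 1) * (s + 1))" by (simp add: power2_eq_square algebra_simps)
      also have "\<dots> \<le> v * (\<bar>s - 1\<bar> * (s + 1))" using that by (intro mult_left_mono mult_right_mono) auto
      also have "\<dots> \<le> 1 * (\<bar>s - 1\<bar> * (s + 1))" using that by (intro mult_right_mono) auto
      also have "\<dots> \<le> \<bar>s - 1\<bar> * (cmod e + 2)" using that by (simp add: mult_left_mono)
      finally show ?thesis .
    qed
    define S where "S = \<bar>cmod p - 1\<bar> + \<bar>cmod q - 1\<bar>"
    have "(1 - u) * ((cmod p)\<^sup>2 - 1) \<le> \<bar>cmod p - 1\<bar> * (cmod e + 2)" "u * ((cmod q)\<^sup>2 - 1) \<le> \<bar>cmod q - 1\<bar> * (cmod e + 2)"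
      using u by (auto intro!: sq pe qe)
    then have le: "u * (1 - u) * (cmod e)\<^sup>2 \<le> S * (cmod e + 2) + (1 - r\<^sup>2)"
      unfolding id S_def by (simp add: distrib_right)
    have e0: "0 < cmod e" using ed d by linarith
    have "u * (1 - u) * cmod e = u * (1 - u) * (cmod e)\<^sup>2 / cmod e" using e0 by (simp add: power2_eq_square)
    also have "\<dots> \<le> (S * (cmod e + 2) + (1 - r\<^sup>2)) / cmod e" using le e0 by (intro divide_right_mono) auto
    also have "\<dots> = S * (1 + 2 / cmod e) + (1 - r\<^sup>2) / cmod e" using e0 by (simp add: field_simps)
    also have "\<dots> \<le> S * (1 + 2 / d) + (1 - r\<^sup>2) / d"
      using ed d e0 r2 by (intro add_mono mult_left_mono divide_left_mono) (auto simp: S_def)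
    finally have "cmod e \<le> (S * (1 + 2 / d) + (1 - r\<^sup>2) / d) / (u * (1 - u))"
      using uu by (simp add: pos_le_divide_eq mult.commute)
    then show ?thesis unfolding e_def[symmetric] S_def[symmetric] using d by (simp add: mult.commute)
  qed
qed

context lorentz_weight
begin

lemma weight_ge_linear:
  assumes "0 \<le> t" "t \<le> 2*pi"
  shows "t / (2*pi) \<le> \<phi> t"
proof -
  have "\<phi> ((1 - t / (2*pi)) *\<^sub>R 0 + (t / (2*pi)) *\<^sub>R (2*pi)) \<ge> (1 - t / (2*pi)) * \<phi> 0 + t / (2*pi) * \<phi> (2*pi)"
    by (rule concave_onD[OF conc]) (use assms in auto)
  then show ?thesis using zero one by simp
qed

text \<open>By concavity the graph lies above the chords joining \<open>(t0, \<phi> t0)\<close> to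
  both of its end points, and these exceed the diagonal by a tent of height \<open>g\<close> at
  \<open>t0\<close>.\<close>

lemma weight_gap:
  assumes "\<not> (\<forall>t\<in>{0..2*pi}. \<phi> t = t / (2*pi))"
  obtains k where "0 < k" "\<And>t. 0 \<le> t \<Longrightarrow> t \<le> 2*pi \<Longrightarrow> t / (2*pi) + k * min t (2*pi - t) \<le> \<phi> t"
proof -
  obtain t0 where t0: "t0 \<in> {0..2*pi}" "\<phi> t0 \<noteq> t0 / (2*pi)" using assms by blast
  have gt: "t0 / (2*pi) < \<phi> t0" using weight_ge_linear[of t0] t0 by simp
  have pos: "0 < t0" "t0 < 2*pi" using t0 zero one by (auto simp: order_less_le)
  define g where "g = \<phi> t0 - t0 / (2*pi)"
  have g: "0 < g" using gt by (simp add: g_def)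
  \<comment> \<open>The sides of that tent have slopes \<open>g / t0\<close> and
    \<open>g / (2*pi - t0)\<close>, both at least \<open>g / (2*pi)\<close>.\<close>
  show ?thesis
  proof (rule that[of "g / (2*pi)"])
    show "0 < g / (2*pi)" using g by simp
    fix t assume t: "0 \<le> t" "t \<le> 2*pi"
    show "t / (2*pi) + g / (2*pi) * min t (2*pi - t) \<le> \<phi> t"
    proof (cases "t \<le> t0")
      case True
      have "\<phi> ((1 - t / t0) *\<^sub>R 0 + (t / t0) *\<^sub>R t0) \<ge> (1 - t / t0) * \<phi> 0 + t / t0 * \<phi> t0"
        by (rule concave_onD[OF conc]) (use t True t0 pos in auto)
      then have "t / t0 * \<phi> t0 \<le> \<phi> t" using pos zero by simp
      moreover have "t / t0 * \<phi> t0 = t / (2*pi) + t / t0 * g" using pos by (simp add: g_def field_simps)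
      moreover have "g / (2*pi) * min t (2*pi - t) \<le> t / t0 * g"
      proof -
        have "g / (2*pi) * min t (2*pi - t) \<le> g / (2*pi) * t" using g by (intro mult_left_mono) auto
        also have "\<dots> \<le> g / t0 * t"
          using g pos t by (intro mult_right_mono divide_left_mono) auto
        finally show ?thesis by (simp add: mult.commute)
      qed
      ultimately show ?thesis by linarith
    next
      case False
      define s where "s = (t - t0) / (2*pi - t0)"
      have s: "0 \<le> s" "s \<le> 1" "(1 - s) * t0 + s * (2*pi) = t" "1 - s = (2*pi - t) / (2*pi - t0)"
      proof -
        have "s * (2*pi - t0) = t - t0" using pos by (simp add: s_def)
        then show "(1 - s) * t0 + s * (2*pi) = t" by (simp add: algebra_simps)
        show "1 - s = (2*pi - t) / (2*pi - t0)" using pos by (simp add: s_def field_simps)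
      qed (use False t pos in \<open>auto simp: s_def\<close>)
      have "\<phi> ((1 - s) *\<^sub>R t0 + s *\<^sub>R (2*pi)) \<ge> (1 - s) * \<phi> t0 + s * \<phi> (2*pi)"
        by (rule concave_onD[OF conc]) (use s t0 in auto)
      then have "(1 - s) * \<phi> t0 + s \<le> \<phi> t" using s(3) one by simp
      moreover have "(1 - s) * \<phi> t0 + s = t / (2*pi) + (1 - s) * g"
      proof -
        have "t / (2*pi) = (1 - s) * (t0 / (2*pi)) + s" using s(3) by (simp add: field_simps)
        then show ?thesis by (simp add: g_def algebra_simps)
      qed
      moreover have "g / (2*pi) * min t (2*pi - t) \<le> (1 - s) * g"
      proof -
        have "g / (2*pi) * min t (2*pi - t) \<le> g / (2*pi) * (2*pi - t)" using g by (intro mult_left_mono) auto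
        also have "\<dots> \<le> g / (2*pi - t0) * (2*pi - t)"
          using g pos t by (intro mult_right_mono divide_left_mono) auto
        also have "\<dots> = (1 - s) * g" unfolding s(4) by simp
        finally show ?thesis .
      qed
      ultimately show ?thesis by linarith
    qed
  qed
qed

text \<open>Integrating the gap over all levels gives \<open>A + 2*pi*k*D \<le> 1\<close>, where
  \<open>A\<close> is the mean modulus and \<open>D\<close> the mean deviation from a median
  \<open>a\<close>. So \<open>D\<close> is at most a multiple of \<open>1 - A\<close>, and
  \<open>a\<close>, lying within \<open>D\<close> of \<open>A\<close>, can be exchanged for
  \<open>1\<close>.\<close>

lemma cmean_deviation_le:
  assumes k: "0 < k" "\<And>t. 0 \<le> t \<Longrightarrow> t \<le> 2*pi \<Longrightarrow> t / (2*pi) + k * min t (2*pi - t) \<le> \<phi> t"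
    and x: "continuous_on {0..2*pi} x" and le: "lorentz_norm \<phi> x \<le> 1"
  shows "cmean (\<lambda>t. cmod (x t)) \<le> 1"
    and "cmean (\<lambda>t. \<bar>cmod (x t) - 1\<bar>) \<le> (1 / (pi * k) + 1) * (1 - cmean (\<lambda>t. cmod (x t)))"
proof -
  have xm: "x \<in> borel_measurable circ_meas" using integrable_on_circle[OF x] by simp
  note [measurable] = distribution_measurable[OF xm]
  define A where "A = cmean (\<lambda>t. cmod (x t))"
  \<comment> \<open>The rearrangement at half the total measure is a median of \<open>|x|\<close>:
    superlevel sets have measure above \<open>pi\<close> for levels below \<open>a\<close> and at
    most \<open>pi\<close> from \<open>a\<close> on.\<close>
  define a where "a = decreasing_rearrangement x pi"
  have a0: "0 \<le> a" unfolding a_def by (rule decreasing_rearrangement_nonneg[OF xm, of pi 0]) auto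
  define D where "D = cmean (\<lambda>t. \<bar>cmod (x t) - a\<bar>)"
  have cx: "continuous_on {0..2*pi} (\<lambda>t. cmod (x t))" by (intro continuous_intros x)
  have ca: "continuous_on {0..2*pi} (\<lambda>t. \<bar>cmod (x t) - b\<bar>)" for b by (intro continuous_intros x)
  have A: "(\<integral>\<^sup>+s. ennreal (cmod (x s)) \<partial>circ_meas) = ennreal (2*pi*A)"
    by (subst nn_integral_eq_integral[OF integrable_on_circle[OF cx]]) (auto simp: A_def cmean_def)
  have D: "(\<integral>\<^sup>+s. ennreal \<bar>cmod (x s) - a\<bar> \<partial>circ_meas) = ennreal (2*pi*D)"
    by (subst nn_integral_eq_integral[OF integrable_on_circle[OF ca]]) (auto simp: D_def cmean_def)
  have D0: "0 \<le> D" and A0: "0 \<le> A"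
    unfolding D_def A_def cmean_def by (auto intro!: divide_nonneg_pos integral_nonneg_AE)
  let ?m = "\<lambda>\<tau>. if a \<le> \<tau> then distribution x \<tau> else 2*pi - distribution x \<tau>"
  have m0: "0 \<le> ?m \<tau>" for \<tau> using distribution_le[of x \<tau>] distribution_nonneg[of x \<tau>] by simp
  have med: "?m \<tau> = min (distribution x \<tau>) (2*pi - distribution x \<tau>)" if \<tau>: "0 \<le> \<tau>" for \<tau>
    using decreasing_rearrangement_greater_iff[OF xm pi_gt_zero \<tau>] unfolding a_def[symmetric] by (auto simp: min_def)
  have "ennreal (1 / (2*pi)) * ennreal (2*pi*A) + ennreal k * ennreal (2*pi*D) =
      (\<integral>\<^sup>+\<tau>. ennreal (1 / (2*pi)) * (ennreal (distribution x \<tau>) * indicator {0..} \<tau>) \<partial>lborel)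
      + (\<integral>\<^sup>+\<tau>. ennreal k * (ennreal (?m \<tau>) * indicator {0..} \<tau>) \<partial>lborel)"
    unfolding A[symmetric] D[symmetric] nn_integral_layer_cake[OF xm] nn_integral_deviation_layer_cake[OF xm a0]
    by (subst (1 2) nn_integral_cmult) auto
  also have "\<dots> = (\<integral>\<^sup>+\<tau>. ennreal (1 / (2*pi)) * (ennreal (distribution x \<tau>) * indicator {0..} \<tau>)
      + ennreal k * (ennreal (?m \<tau>) * indicator {0..} \<tau>) \<partial>lborel)"
    by (rule nn_integral_add[symmetric]) auto
  also have "\<dots> \<le> (\<integral>\<^sup>+\<tau>. ennreal (\<phi> (distribution x \<tau>)) * indicator {0..} \<tau> \<partial>lborel)"
  proof (rule nn_integral_mono)
    fix \<tau> :: real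
    show "ennreal (1 / (2*pi)) * (ennreal (distribution x \<tau>) * indicator {0..} \<tau>) + ennreal k * (ennreal (?m \<tau>) * indicator {0..} \<tau>)
        \<le> ennreal (\<phi> (distribution x \<tau>)) * indicator {0..} \<tau>"
    proof (cases "0 \<le> \<tau>")
      case True
      have "ennreal (1 / (2*pi)) * ennreal (distribution x \<tau>) + ennreal k * ennreal (?m \<tau>)
          = ennreal (1 / (2*pi) * distribution x \<tau> + k * ?m \<tau>)"
      proof -
        have "ennreal (1 / (2*pi)) * ennreal (distribution x \<tau>) = ennreal (1 / (2*pi) * distribution x \<tau>)"
          by (rule ennreal_mult[symmetric]) (auto simp: distribution_nonneg)
        moreover have "ennreal k * ennreal (?m \<tau>) = ennreal (k * ?m \<tau>)"
          by (rule ennreal_mult[symmetric, OF less_imp_le[OF k(1)] m0])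
        moreover have "ennreal (1 / (2*pi) * distribution x \<tau>) + ennreal (k * ?m \<tau>)
            = ennreal (1 / (2*pi) * distribution x \<tau> + k * ?m \<tau>)"
        proof (rule ennreal_plus[symmetric])
          show "0 \<le> 1 / (2*pi) * distribution x \<tau>"
            by (intro mult_nonneg_nonneg distribution_nonneg) simp
          show "0 \<le> k * ?m \<tau>"
            by (rule mult_nonneg_nonneg[OF less_imp_le[OF k(1)] m0])
        qed
        ultimately show ?thesis by simp
      qed
      also have "\<dots> \<le> ennreal (\<phi> (distribution x \<tau>))"
        using k(2)[OF distribution_nonneg distribution_le, of x \<tau>] unfolding med[OF True] by (intro ennreal_leI) simp
      finally show ?thesis using True by simp
    qed simp
  qed
  also have "\<dots> \<le> 1" using le unfolding lorentz_norm_layer_cake[OF xm] .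
  finally have "ennreal (A + k * (2*pi*D)) \<le> 1"
    using k(1) A0 D0 by (subst ennreal_plus) (auto simp: ennreal_mult[symmetric])
  then have main: "A + k * (2*pi*D) \<le> 1" by simp
  then have DA: "D \<le> 1 / (2*pi*k) * (1 - A)" using k(1) by (simp add: field_simps)
  have "0 \<le> k * (2*pi*D)" using k(1) D0 by simp
  with main have "A \<le> 1" by linarith
  then show A1: "cmean (\<lambda>t. cmod (x t)) \<le> 1" by (simp add: A_def)
  have "A \<le> cmean (\<lambda>t. a + \<bar>cmod (x t) - a\<bar>)"
    unfolding A_def by (intro cmean_mono continuous_intros x) auto
  then have u1: "A \<le> a + D" by (simp add: cmean_add ca D_def)
  have "a \<le> cmean (\<lambda>t. cmod (x t) + \<bar>cmod (x t) - a\<bar>)"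
    by (subst cmean_const[symmetric]) (intro cmean_mono continuous_intros x, auto)
  then have u2: "a \<le> A + D" by (simp add: cmean_add ca cx D_def A_def)
  have "cmean (\<lambda>t. \<bar>cmod (x t) - 1\<bar>) \<le> cmean (\<lambda>t. \<bar>cmod (x t) - a\<bar> + \<bar>a - 1\<bar>)"
    by (intro cmean_mono continuous_intros x) auto
  also have "\<dots> = D + \<bar>a - 1\<bar>" by (simp add: cmean_add ca D_def)
  \<comment> \<open>\<open>|a - A| \<le> D\<close> and \<open>A \<le> 1\<close> give
    \<open>|a - 1| \<le> D + (1 - A)\<close>; with \<open>2 * D \<le> (1 - A) / (pi * k)\<close>
    this explains the constant of the statement.\<close>
  also have "\<dots> \<le> 2 * D + (1 - A)" using u1 u2 A1 by (simp add: A_def[symmetric] abs_le_iff)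
  also have "\<dots> \<le> (1 / (pi * k) + 1) * (1 - A)" using DA by (simp add: field_simps)
  finally show "cmean (\<lambda>t. \<bar>cmod (x t) - 1\<bar>) \<le> (1 / (pi * k) + 1) * (1 - cmean (\<lambda>t. cmod (x t)))"
    unfolding A_def .
qed

lemma lorentz_norm_disc_id:
  assumes r: "0 \<le> r" "r < 1"
  shows "lorentz_norm \<phi> (circle_slice disc_id r) \<le> 1"
proof -
  have slice: "circle_slice disc_id r t = of_real r * cis t" for t
    using r by (simp add: circle_slice_def disc_id_def norm_mult)
  have "continuous_on {0..2*pi} (circle_slice disc_id r)"
    unfolding slice[abs_def] by (intro continuous_intros)
  then have m: "circle_slice disc_id r \<in> borel_measurable circ_meas"
    by (rule borel_measurable_integrable[OF integrable_on_circle])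
  have d: "distribution (circle_slice disc_id r) \<tau> = (if \<tau> < r then 2*pi else 0)" for \<tau>
  proof (cases "\<tau> < r")
    case True
    have "{s \<in> {0..2*pi}. \<tau> < cmod (circle_slice disc_id r s)} = {0..2*pi}"
      using True r by (auto simp: slice norm_mult)
    then show ?thesis using True measure_circ_meas by (simp only: distribution_def if_True)
  next
    case False
    have "{s \<in> {0..2*pi}. \<tau> < cmod (circle_slice disc_id r s)} = {}"
      using False r by (auto simp: slice norm_mult)
    then show ?thesis using False by (simp only: distribution_def measure_empty if_False)
  qed
  have "lorentz_norm \<phi> (circle_slice disc_id r) = (\<integral>\<^sup>+\<tau>. indicator {0..<r} \<tau> \<partial>lborel)"
    unfolding lorentz_norm_layer_cake[OF m] d
    by (rule nn_integral_cong) (auto simp: indicator_def zero one)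
  also have "\<dots> = ennreal r" using r by simp
  finally show ?thesis using r by simp
qed

lemma hardy_lorentz_ballD:
  assumes P: "P \<in> hardy_lorentz_ball \<phi>"
  shows "P \<in> disc_analytic" "P holomorphic_on ball 0 1"
    "0 \<le> r \<Longrightarrow> r < 1 \<Longrightarrow> lorentz_norm \<phi> (\<lambda>t. P (of_real r * cis t)) \<le> 1"
proof -
  show "P \<in> disc_analytic" "P holomorphic_on ball 0 1"
    using P by (auto simp: hardy_lorentz_ball_def hardy_lorentz_def disc_analytic_def)
  show "lorentz_norm \<phi> (\<lambda>t. P (of_real r * cis t)) \<le> 1" if "0 \<le> r" "r < 1"
  proof -
    have "lorentz_norm \<phi> (circle_slice P r) \<le> hardy_lorentz_norm \<phi> P"
      unfolding hardy_lorentz_norm_def by (rule SUP_upper) (use that in auto)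
    also have "\<dots> \<le> 1" using P by (simp add: hardy_lorentz_ball_def)
    finally show ?thesis by (simp add: circle_slice_def[abs_def])
  qed
qed

lemma disc_id_in_ball: "disc_id \<in> hardy_lorentz_ball \<phi>"
proof -
  have "disc_id holomorphic_on ball 0 1"
    by (rule holomorphic_transform[OF holomorphic_on_ident]) (simp add: disc_id_def)
  then have "disc_id \<in> disc_analytic" by (simp add: disc_analytic_def disc_id_def)
  moreover have "hardy_lorentz_norm \<phi> disc_id \<le> 1"
    unfolding hardy_lorentz_norm_def by (rule SUP_least) (use lorentz_norm_disc_id in auto)
  moreover from this have "hardy_lorentz_norm \<phi> disc_id < \<infinity>"
    using order_le_less_trans[OF _ ennreal_one_less_top] by simp
  ultimately show ?thesis by (simp add: hardy_lorentz_ball_def hardy_lorentz_def)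
qed

lemma disc_id_extreme_point:
  assumes nl: "\<not> (\<forall>t\<in>{0..2*pi}. \<phi> t = t / (2*pi))"
  shows "disc_id extreme_point_of hardy_lorentz_ball \<phi>"
  unfolding extreme_point_of_def
proof (intro conjI ballI notI)
  obtain k where k: "0 < k" "\<And>t. 0 \<le> t \<Longrightarrow> t \<le> 2*pi \<Longrightarrow> t / (2*pi) + k * min t (2*pi - t) \<le> \<phi> t"
    using weight_gap[OF nl] by metis
  fix P Q assume PS: "P \<in> hardy_lorentz_ball \<phi>" and QS: "Q \<in> hardy_lorentz_ball \<phi>" and seg: "disc_id \<in> open_segment P Q"
  then obtain u where u: "P \<noteq> Q" "0 < u" "u < 1" "disc_id = (1 - u) *\<^sub>R P + u *\<^sub>R Q"
    unfolding in_segment by blast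
  have eq: "z = of_real (1 - u) * P z + of_real u * Q z" if "z \<in> ball 0 1" for z
    using that fun_cong[OF u(4), of z] by (simp add: disc_id_def scaleR_fun_def plus_fun_def scaleR_conv_of_real)
  note holP = hardy_lorentz_ballD(2)[OF PS] and holQ = hardy_lorentz_ballD(2)[OF QS]
  have uu: "0 < u * (1 - u)" using u by simp
  define C where "C = 1 / (pi * k) + 1"
  have C: "0 < C" using k by (simp add: C_def add_pos_pos)
  define E where "E z = Q z - P z" for z
  have holE: "E holomorphic_on ball 0 1" unfolding E_def by (intro holomorphic_intros holP holQ)
  have est: "circle_mean E r \<le>
      d + ((1 + 2 / d) * (C * ((1 - r) / (1 - u)) + C * ((1 - r) / u)) + (1 - r\<^sup>2) / d) / (u * (1 - u))"
    if r: "0 \<le> r" "r < 1" and d: "0 < d" for r d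
  proof -
    note cP = continuous_on_circle[OF holP r] and cQ = continuous_on_circle[OF holQ r]
    define A where "A = circle_mean P r"
    define B where "B = circle_mean Q r"
    note dP = cmean_deviation_le[OF k cP hardy_lorentz_ballD(3)[OF PS r], folded A_def C_def]
    note dQ = cmean_deviation_le[OF k cQ hardy_lorentz_ballD(3)[OF QS r], folded B_def C_def]
    \<comment> \<open>The triangle inequality puts \<open>r\<close> below a convex combination of
      two means that are each at most \<open>1\<close>, so both lie within a multiple of
      \<open>1 - r\<close> of \<open>1\<close>.\<close>
    have "r = cmean (\<lambda>t. r)" by simp
    also have "\<dots> \<le> cmean (\<lambda>t. (1 - u) * cmod (P (of_real r * cis t)) + u * cmod (Q (of_real r * cis t)))"
    proof (intro cmean_mono continuous_intros cP cQ)
      fix t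
      have "of_real r * cis t = of_real (1 - u) * P (of_real r * cis t) + of_real u * Q (of_real r * cis t)"
        by (rule eq) (use r in \<open>simp add: norm_mult\<close>)
      then have "cmod (of_real r * cis t) \<le> cmod (of_real (1 - u) * P (of_real r * cis t)) + cmod (of_real u * Q (of_real r * cis t))"
        by (metis norm_triangle_ineq)
      then show "r \<le> (1 - u) * cmod (P (of_real r * cis t)) + u * cmod (Q (of_real r * cis t))"
        unfolding norm_mult norm_of_real using r u by simp
    qed
    also have "\<dots> = (1 - u) * A + u * B"
      by (subst cmean_add) (auto intro!: continuous_intros cP cQ simp: cmean_mult_left A_def B_def)
    finally have rAB: "r \<le> (1 - u) * A + u * B" .
    have AB1: "A \<le> 1" "B \<le> 1" using dP(1) dQ(1) by auto
    have uA: "(1 - u) * A \<le> (1 - u) * 1" and uB: "u * B \<le> u * 1"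
      using AB1 u(2,3) by (intro mult_left_mono; simp)+
    have "(1 - u) * (1 - A) = (1 - u) - (1 - u) * A" by (simp only: right_diff_distrib mult_1_right)
    then have "(1 - u) * (1 - A) \<le> 1 - r"
      using rAB uB by linarith
    then have A: "1 - A \<le> (1 - r) / (1 - u)" using u by (simp add: pos_le_divide_eq mult.commute)
    have "u * (1 - B) = u - u * B" by (simp only: right_diff_distrib mult_1_right)
    moreover have "(1 - u) * A \<le> 1 - u" using uA by (simp only: mult_1_right)
    ultimately have "u * (1 - B) \<le> 1 - r"
      using rAB by linarith
    then have B: "1 - B \<le> (1 - r) / u" using u by (simp add: pos_le_divide_eq mult.commute)
    let ?a = "\<lambda>t. \<bar>cmod (P (of_real r * cis t)) - 1\<bar>" and ?b = "\<lambda>t. \<bar>cmod (Q (of_real r * cis t)) - 1\<bar>"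
    have ca: "continuous_on {0..2*pi} ?a" and cb: "continuous_on {0..2*pi} ?b" by (intro continuous_intros cP cQ)+
    have lin: "cmean (\<lambda>t. e + c * (?a t + ?b t)) = e + c * (cmean ?a + cmean ?b)" for e c
    proof -
      have "cmean (\<lambda>t. e + c * (?a t + ?b t)) = cmean (\<lambda>t. e) + cmean (\<lambda>t. c * (?a t + ?b t))"
        by (rule cmean_add) (intro continuous_intros cP cQ)+
      then show ?thesis by (simp only: cmean_const cmean_mult_left cmean_add[OF ca cb])
    qed
    have alg: "d + (c * S + T) / w = (d + T / w) + c / w * S" for c S T w :: real
      by (simp add: add_divide_distrib)
    have "circle_mean E r \<le>
        cmean (\<lambda>t. (d + (1 - r\<^sup>2) / d / (u * (1 - u))) + (1 + 2 / d) / (u * (1 - u)) * (?a t + ?b t))"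
    proof (intro cmean_mono continuous_intros cP cQ continuous_on_circle[OF holE] r)
      fix t
      have "cmod (E (of_real r * cis t)) \<le> d + ((1 + 2 / d) * (?a t + ?b t) + (1 - r\<^sup>2) / d) / (u * (1 - u))"
        unfolding E_def
        by (rule cmod_diff_estimate[OF u(2,3) eq _ _ d]) (use r in \<open>auto simp: norm_mult\<close>)
      then show "cmod (E (of_real r * cis t)) \<le> (d + (1 - r\<^sup>2) / d / (u * (1 - u))) + (1 + 2 / d) / (u * (1 - u)) * (?a t + ?b t)"
        by (simp only: alg)
    qed
    also have "\<dots> = (d + (1 - r\<^sup>2) / d / (u * (1 - u))) + (1 + 2 / d) / (u * (1 - u)) * (cmean ?a + cmean ?b)"
      by (rule lin)
    also have "\<dots> \<le> (d + (1 - r\<^sup>2) / d / (u * (1 - u))) + (1 + 2 / d) / (u * (1 - u)) * (C * ((1 - r) / (1 - u)) + C * ((1 - r) / u))"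
    proof (intro add_left_mono mult_left_mono add_mono)
      show "cmean ?a \<le> C * ((1 - r) / (1 - u))"
        using dP(2) mult_left_mono[OF A less_imp_le[OF C]] by linarith
      show "cmean ?b \<le> C * ((1 - r) / u)"
        using dQ(2) mult_left_mono[OF B less_imp_le[OF C]] by linarith
      show "0 \<le> (1 + 2 / d) / (u * (1 - u))" using d uu by (intro divide_nonneg_pos) auto
    qed
    finally show ?thesis by (simp only: alg)
  qed
  \<comment> \<open>At fixed threshold \<open>d\<close> every other term of \<open>est\<close>
    vanishes as \<open>r\<close> tends to \<open>1\<close>, and monotonicity brings the bound down
    to radius \<open>s\<close>; only then is \<open>d\<close> made small.\<close>
  have small: "circle_mean E s \<le> d" if s: "0 \<le> s" "s < 1" and d: "0 < d" for s d
  proof -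
    define b where "b r = d + ((1 + 2 / d) * (C * ((1 - r) / (1 - u)) + C * ((1 - r) / u)) + (1 - r\<^sup>2) / d) / (u * (1 - u))" for r
    have "circle_mean E s \<le> b r" if "s < r" "r < 1" for r
      using circle_mean_cmod_mono[OF holE s(1) less_imp_le[OF that(1)] that(2)] est[of r d] that s d unfolding b_def by linarith
    then have ev: "\<forall>\<^sub>F r in at_left 1. circle_mean E s \<le> b r"
      using s eventually_at_left_real[of s 1] by (auto elim!: eventually_mono)
    have "(b \<longlongrightarrow> b 1) (at_left 1)"
      unfolding b_def using u d by (intro tendsto_intros) auto
    moreover have "b 1 = d" by (simp add: b_def)
    ultimately show ?thesis
      using tendsto_lowerbound[OF _ ev] by simp
  qed
  have "P z = Q z" if z: "z \<in> ball 0 1" for z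
  proof -
    define s where "s = (1 + cmod z) / 2"
    have s: "cmod z < s" "s < 1" "0 \<le> s" using z norm_ge_zero[of z] by (auto simp: s_def simp del: norm_ge_zero)
    have "circle_mean E s \<le> 0"
      by (rule field_le_epsilon) (use small s in auto)
    then have "s / (s - cmod z) * circle_mean E s \<le> s / (s - cmod z) * 0"
      using s by (intro mult_left_mono) auto
    with cmod_le_circle_mean[OF holE s(1,2)] have "cmod (E z) \<le> 0" by linarith
    then show ?thesis by (simp add: E_def)
  qed
  then have "P = Q"
    using hardy_lorentz_ballD(1)[OF PS] hardy_lorentz_ballD(1)[OF QS] by (intro disc_analytic_eqI) auto
  with u(1) show False by simp
qed (rule disc_id_in_ball)

section \<open>Linear weights, and the two cases together\<close>

lemma hardy_lorentz_norm_linear: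
  assumes lin: "\<forall>t\<in>{0..2*pi}. \<phi> t = t / (2*pi)" and f: "f \<in> disc_analytic"
  shows "hardy_lorentz_norm \<phi> f = hardy1_norm f"
  unfolding hardy_lorentz_norm_def hardy1_norm_def
proof (rule SUP_cong[OF refl])
  fix r :: real assume r: "r \<in> {0..<1}"
  have hol: "f holomorphic_on ball 0 1" using f by (simp add: disc_analytic_def)
  have x: "circle_slice f r \<in> borel_measurable circ_meas"
    unfolding circle_slice_def[abs_def] using circle_slice_integrable[OF hol, of r] r by simp
  note [measurable] = distribution_measurable[OF x]
  have "lorentz_norm \<phi> (circle_slice f r) =
      (\<integral>\<^sup>+\<tau>. ennreal (1 / (2*pi)) * (ennreal (distribution (circle_slice f r) \<tau>) * indicator {0..} \<tau>) \<partial>lborel)"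
    unfolding lorentz_norm_layer_cake[OF x]
  proof (rule nn_integral_cong)
    fix \<tau> :: real
    have "\<phi> (distribution (circle_slice f r) \<tau>) = 1 / (2*pi) * distribution (circle_slice f r) \<tau>"
      using lin distribution_nonneg[of "circle_slice f r" \<tau>] distribution_le[of "circle_slice f r" \<tau>] by simp
    then show "ennreal (\<phi> (distribution (circle_slice f r) \<tau>)) * indicator {0..} \<tau> =
        ennreal (1 / (2*pi)) * (ennreal (distribution (circle_slice f r) \<tau>) * indicator {0..} \<tau>)"
      by (simp only: ennreal_mult'' distribution_nonneg mult.assoc)
  qed
  also have "\<dots> = ennreal (1 / (2*pi)) * (\<integral>\<^sup>+\<tau>. ennreal (distribution (circle_slice f r) \<tau>) * indicator {0..} \<tau> \<partial>lborel)"
    by (rule nn_integral_cmult) simp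
  also have "\<dots> = ennreal (1 / (2*pi)) * (\<integral>\<^sup>+t. ennreal (cmod (circle_slice f r t)) \<partial>circ_meas)"
    by (simp only: nn_integral_layer_cake[OF x])
  finally show "lorentz_norm \<phi> (circle_slice f r) = ennreal (1 / (2*pi)) * (\<integral>\<^sup>+t. ennreal (cmod (circle_slice f r t)) \<partial>circ_meas)" .
qed

end

theorem extreme_points_hardy1_ball:
  "F extreme_point_of hardy1_ball \<longleftrightarrow> outer_function F \<and> hardy1_norm F = 1"
proof
  assume ext: "F extreme_point_of hardy1_ball"
  then have "F \<in> hardy1_ball" by (simp add: extreme_point_of_def)
  then show "outer_function F \<and> hardy1_norm F = 1"
    using extreme_point_hardy1_ball_imp_outer[OF ext] extreme_point_hardy1_ball_norm[OF ext] hardy1_norm_eq_1_iff by blast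
next
  assume F: "outer_function F \<and> hardy1_norm F = 1"
  then have FS: "F \<in> hardy1_ball" by (simp add: hardy1_ball_eq outer_function_def)
  show "F extreme_point_of hardy1_ball"
    using outer_function_imp_extreme_point[OF FS] F hardy1_norm_eq_1_iff[OF FS] by blast
qed

theorem theorem13:
  fixes \<phi> :: "real \<Rightarrow> real"
  assumes "strict_mono_on {0..2*pi} \<phi>"
    and "concave_on {0..2*pi} \<phi>"
    and "continuous_on {0..2*pi} \<phi>"
    and "\<phi> 0 = 0"
    and "\<phi> (2*pi) = 1"
  shows "{F. F extreme_point_of hardy_lorentz_ball \<phi>} =
           {F \<in> hardy_lorentz \<phi>. outer_function F \<and> hardy_lorentz_norm \<phi> F = 1}
         \<longleftrightarrow> (\<forall>t\<in>{0..2*pi}. \<phi> t = t / (2*pi))"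
proof -
  interpret lorentz_weight \<phi> by standard (use assms in auto)
  show ?thesis
  proof
    assume eq: "{F. F extreme_point_of hardy_lorentz_ball \<phi>} =
        {F \<in> hardy_lorentz \<phi>. outer_function F \<and> hardy_lorentz_norm \<phi> F = 1}"
    show "\<forall>t\<in>{0..2*pi}. \<phi> t = t / (2*pi)"
    proof (rule ccontr)
      assume "\<not> ?thesis"
      then have "disc_id \<in> {F. F extreme_point_of hardy_lorentz_ball \<phi>}"
        using disc_id_extreme_point by blast
      then show False unfolding eq using disc_id_not_outer by simp
    qed
  next
    assume lin: "\<forall>t\<in>{0..2*pi}. \<phi> t = t / (2*pi)"
    have H: "hardy_lorentz \<phi> = hardy1"
      unfolding hardy_lorentz_def hardy1_def using hardy_lorentz_norm_linear[OF lin] by auto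
    have norm: "hardy_lorentz_norm \<phi> F = hardy1_norm F" if "F \<in> hardy1" for F
      using that hardy_lorentz_norm_linear[OF lin] by (simp add: hardy1_def)
    have "hardy_lorentz_ball \<phi> = hardy1_ball"
      unfolding hardy_lorentz_ball_def hardy1_ball_eq H using norm by auto
    then show "{F. F extreme_point_of hardy_lorentz_ball \<phi>} =
        {F \<in> hardy_lorentz \<phi>. outer_function F \<and> hardy_lorentz_norm \<phi> F = 1}"
      unfolding H using norm by (auto simp: extreme_points_hardy1_ball outer_function_def)
  qed
qed

end
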